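(* Let $C_1,C_2>0$ be fixed. For finite sets $B$ of integers of polynomial growth, i.e. with $|b|<C_1|B|^{C_2}$ for every $b\in B$, one has $$E_{+}(B.B)=o(|B|^6)\qquad\text{as } |B|\to\infty .$$ Explicitly: for all $C_1,C_2>0$ and every $\eta>0$ there is $N$ such that every finite $B\subset\mathbb{Z}$ with $|B|\ge N$ and $|b|<C_1|B|^{C_2}$ for all $b\in B$ satisfies $E_+(B.B)\le\eta|B|^6$.
   Context: $B.B=\{bb' : b,b'\in B\}$ is the product set. The additive energy $E_+(A)$ of a finite set $A$ is the number of quadruples $(a_1,a_2,a_3,a_4)\in A^4$ with $a_1+a_2=a_3+a_4$. $|X|$ denotes the cardinality of a finite set $X$, while $|b|$ for an integer $b$ is its absolute value. *)

theory Defs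
  imports Complex_Main "HOL-Library.Set_Algebras"
begin

text \<open>The product set \<open>B.B\<close> is \<open>B * B\<close> in the sense of \<^theory>\<open>HOL-Library.Set_Algebras\<close>.\<close>

definition additive_energy :: "'a::plus set \<Rightarrow> nat" where
  "additive_energy A =
     card {(a1, a2, a3, a4). a1 \<in> A \<and> a2 \<in> A \<and> a3 \<in> A \<and> a4 \<in> A \<and> a1 + a2 = a3 + a4}"

end

theory Submission
  imports Defs "HOL-Analysis.Convex" "HOL-Number_Theory.Cong" "HOL-Number_Theory.Prime_Powers"
begin

text \<open>Suppose that \<open>B\<close> has \<open>n\<close> elements and that \<open>B * B\<close> has additive energy at least
  \<open>\<eta> n\<^sup>6\<close>. By Balog--Szemeredi--Gowers and Pluennecke's inequality a subset \<open>A\<close> of \<open>B * B\<close> with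
  about \<open>n\<^sup>2\<close> elements has bounded additive doubling. The contradiction comes from counting prime
  factors: additively structured sets look like intervals to the primes, and a product of two typical
  integers has twice as many prime factors as a typical integer.

  To make this precise, let \<open>k\<close> have the order of the cube root of \<open>log n\<close>, let \<open>W\<close> be the set of
  primes between \<open>k\<^sup>4\<close> and a larger fixed power of \<open>k\<close>, and let \<open>\<omega>(x)\<close> be the number of
  primes of \<open>W\<close> that divide \<open>x\<close>. If the window is long enough, the sum of \<open>1/p\<close> over \<open>W\<close> exceeds any prescribed constant \<open>L\<close>
  (\<open>recip_sum_long_window\<close>, from Mertens-type bounds).

  A set \<open>X\<close> of small doubling contains many elements \<open>x\<close> for which a whole progression \<open>x + t g\<close>,
  with \<open>t < 2\<^sup>k\<close>, stays in a set of size \<open>O(|X|)\<close>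
  (\<open>structured_set_contains_translates\<close>). Here \<open>g\<close> is found by pigeonholing Croot--Sisask
  almost-periods along the dyadic multiples \<open>g, 2g, 4g, ...\<close>, and it is essential that the implied
  constant depends on the doubling only, not on the length of the progression. On a progression whose
  step is prime to the members of \<open>W\<close> the variance of \<open>\<omega>\<close> is that of the Turan--Kubilius
  inequality, so most of these \<open>x\<close> have \<open>\<omega>(x)\<close> close to \<open>L\<close>
  (\<open>structured_set_concentration\<close>). Primes that divide \<open>g\<close> have to be left out; since the
  elements of \<open>B\<close> are polynomially bounded there are only \<open>O(log n) = O(k\<^sup>3)\<close> of them,
  and as all primes of \<open>W\<close> are larger than \<open>k\<^sup>4\<close>, their contribution to \<open>L\<close> is negligible. This is
  the only use of the growth hypothesis.

  It remains to see additive structure in \<open>B\<close> itself. Let \<open>G\<close> be the graph of pairs \<open>(b, c)\<close> whose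
  product is a typical element of \<open>A\<close>; it has a positive proportion of the \<open>n\<^sup>2\<close> pairs.
  In every dense subgraph there is some \<open>b\<close> for which a positive
  proportion of its neighbours forms a set \<open>C\<close> of bounded doubling
  (\<open>neighbourhood_with_small_doubling\<close>). The reason is an ordering argument. Let \<open>b1, b2\<close> be the
  closest pair with many common neighbours, and \<open>c0\<close> the largest vertex. The numbers \<open>b c0\<close> are
  then spread out at scale \<open>|b1 - b2| |c0|\<close>, and \<open>(b1 - b2)(c + c')\<close> varies at a smaller scale
  when the common neighbours \<open>c, c'\<close> come from a short interval. Hence the sums
  \<open>b c0 + (b1 - b2)(c + c')\<close> are essentially distinct. They lie in \<open>A + A + A - A - A\<close>, which has
  \<open>O(n\<^sup>2)\<close> elements, and the number of choices of \<open>b\<close> has order \<open>n\<close>; so \<open>C + C\<close> has \<open>O(n)\<close> elements.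

  Now \<open>\<omega>(b c)\<close> is about \<open>L\<close> for \<open>c \<in> C\<close>, because \<open>b c \<in> A\<close> is typical, and \<open>\<omega>(c)\<close> is about \<open>L\<close> for
  some \<open>c \<in> C\<close>, because \<open>C\<close> has small doubling. Hence \<open>\<omega>(b)\<close> is small. Every dense subgraph
  contains such a \<open>b\<close>, so on most edges the first vertex has few prime factors, and by symmetry so
  has the second. On an edge where both have few, \<open>\<omega>(b c)\<close> is far below \<open>L\<close>, a contradiction
  (\<open>no_structured_dense_product_subset\<close>).\<close>

section \<open>Sumsets\<close>

lemma image_uminus_set_plus: "uminus ` (A + B) = uminus ` A + uminus ` (B :: 'a::ab_group_add set)"
proof -
  have "- (a + b) = - a + - b" for a b :: 'a by simp
  then show ?thesis unfolding set_plus_def by (force simp: image_iff)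
qed

lemma card_image_uminus [simp]: "card (uminus ` A) = card (A :: 'a::ab_group_add set)"
  by (simp add: card_image)

lemma card_set_plus_singleton_left: "card ({a} + A) = card (A :: 'a::ab_group_add set)"
  using card_plus_sing[of A a] by (simp add: add.commute)

lemma set_plus_singleton: "A + {a} = (\<lambda>x. x + a) ` (A :: 'a::ab_group_add set)"
  by (auto simp: set_plus_def)

lemma ruzsa_triangle:
  fixes X U V :: "'a::ab_group_add set"
  assumes "finite X" "finite U" "finite V"
  shows "card X * card (U + uminus ` V) \<le> card (X + U) * card (X + V)"
proof -
  have "\<forall>d\<in>U + uminus ` V. \<exists>u v. u \<in> U \<and> v \<in> V \<and> d = u - v"
    by (force simp: set_plus_def)
  then obtain u v where uv: "\<And>d. d \<in> U + uminus ` V \<Longrightarrow> u d \<in> U \<and> v d \<in> V \<and> d = u d - v d"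
    by metis
  let ?h = "\<lambda>(x, d). (x + u d, x + v d)"
  have "inj_on ?h (X \<times> (U + uminus ` V))"
  proof (rule inj_onI, clarify)
    fix x d x' d'
    assume a: "d \<in> U + uminus ` V" "d' \<in> U + uminus ` V"
      and e: "x + u d = x' + u d'" "x + v d = x' + v d'"
    have "(x + u d) - (x + v d) = (x' + u d') - (x' + v d')" using e by simp
    then have "d = d'" using uv[OF a(1)] uv[OF a(2)] by simp
    with e show "x = x' \<and> d = d'" by simp
  qed
  moreover have "?h ` (X \<times> (U + uminus ` V)) \<subseteq> (X + U) \<times> (X + V)"
    using uv by (auto simp: set_plus_def; metis)
  moreover have "finite ((X + U) \<times> (X + V))"
    using assms by (simp add: finite_set_plus)
  ultimately have "card (X \<times> (U + uminus ` V)) \<le> card ((X + U) \<times> (X + V))"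
    by (rule card_inj_on_le)
  then show ?thesis by (simp add: card_cartesian_product)
qed

text \<open>Petridis's lemma behind Pluennecke's inequality. The set \<open>X\<close> minimises the growth ratio
  \<open>|Z + B| / |Z|\<close>. Adding one element \<open>c\<close> to \<open>C\<close> adds to \<open>X + C\<close> all translates \<open>x + c\<close> except those already
  present, while the part of \<open>X + B + c\<close> that is already present contains \<open>Z + B + c\<close> for a set \<open>Z\<close> that
  contains all these exceptional \<open>x\<close>; minimality bounds \<open>|Z + B|\<close> from below.\<close>

lemma petridis:
  fixes X B C :: "'a::ab_group_add set"
  assumes fin: "finite X" "finite B" "finite C"
    and min: "\<And>Z. Z \<subseteq> X \<Longrightarrow> card (X + B) * card Z \<le> card (Z + B) * card X"
  shows "card (X + B + C) * card X \<le> card (X + B) * card (X + C)"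
  using fin(3)
proof (induction C rule: finite_induct)
  case empty
  then show ?case by simp
next
  case (insert c C)
  define Z where "Z = {x \<in> X. {x} + B + {c} \<subseteq> X + B + C}"
  define W where "W = {x \<in> X. x + c \<in> X + C}"
  have ZX: "Z \<subseteq> X" by (auto simp: Z_def)
  have WZ: "W \<subseteq> Z"
  proof
    fix x assume x: "x \<in> W"
    then obtain x' c' where "x' \<in> X" "c' \<in> C" "x + c = x' + c'"
      by (auto simp: W_def set_plus_def)
    then have *: "x + b + c = x' + b + c'" for b by (metis add.commute add.left_commute)
    have "x + b + c \<in> X + B + C" if "b \<in> B" for b
      unfolding * using that \<open>x' \<in> X\<close> \<open>c' \<in> C\<close> by (intro set_plus_intro)
    then have "{x} + B + {c} \<subseteq> X + B + C" by (auto elim!: set_plus_elim)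
    then show "x \<in> Z" using x by (simp add: W_def Z_def)
  qed
  have finXB: "finite (X + B)" "finite (X + C)" "finite (X + B + C)" "finite (Z + B)"
    using fin insert ZX by (auto intro!: finite_set_plus intro: finite_subset)
  have ZB: "Z + B + {c} \<subseteq> (X + B + {c}) \<inter> (X + B + C)"
  proof
    fix y assume "y \<in> Z + B + {c}"
    then obtain x b where xb: "x \<in> Z" "b \<in> B" "y = x + b + c" by (auto simp: set_plus_def)
    then have "y \<in> {x} + B + {c}" by (auto simp: set_plus_def)
    then have "y \<in> X + B + C" using xb by (auto simp: Z_def)
    moreover have "y \<in> X + B + {c}" using xb ZX by (auto simp: set_plus_def)
    ultimately show "y \<in> (X + B + {c}) \<inter> (X + B + C)" by simp
  qed
  have 1: "card (X + B + insert c C) + card (Z + B) \<le> card (X + B + C) + card (X + B)"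
  proof -
    have eq: "X + B + insert c C = (X + B + C) \<union> (X + B + {c})"
      using set_plus_Un[of "X + B" C "{c}"] by simp
    have "card ((X + B + C) \<union> (X + B + {c})) + card ((X + B + C) \<inter> (X + B + {c}))
        = card (X + B + C) + card (X + B + {c})"
      using card_Un_Int[of "X + B + C" "X + B + {c}"] finXB by (simp add: finite_set_plus)
    moreover have "card (Z + B + {c}) \<le> card ((X + B + C) \<inter> (X + B + {c}))"
      using ZB finXB by (intro card_mono) auto
    ultimately show ?thesis unfolding eq card_plus_sing by simp
  qed
  have 2: "card (X + insert c C) + card Z \<ge> card (X + C) + card X"
  proof -
    have eq: "X + insert c C = (X + C) \<union> (X + {c})"
      using set_plus_Un[of X C "{c}"] by simp
    have "(X + C) \<inter> (X + {c}) = W + {c}"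
      by (auto simp: W_def set_plus_singleton)
    then have "card ((X + C) \<inter> (X + {c})) = card W" by (simp add: card_plus_sing)
    moreover have "card W \<le> card Z" using WZ ZX fin by (meson card_mono finite_subset)
    moreover have "card ((X + C) \<union> (X + {c})) + card ((X + C) \<inter> (X + {c}))
        = card (X + C) + card (X + {c})"
      using card_Un_Int[of "X + C" "X + {c}"] finXB fin by (simp add: finite_set_plus)
    ultimately show ?thesis unfolding eq card_plus_sing by simp
  qed
  have "card (X + B + insert c C) * card X + card (Z + B) * card X
      \<le> card (X + B + C) * card X + card (X + B) * card X"
    using mult_right_mono[OF 1, of "card X"] by (simp add: algebra_simps)
  moreover have "card (X + B) * card (X + C) + card (X + B) * card X
      \<le> card (X + B) * card (X + insert c C) + card (X + B) * card Z"
    using mult_left_mono[OF 2, of "card (X + B)"] by (simp add: algebra_simps)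
  ultimately show ?case using insert.IH min[OF ZX] by linarith
qed

text \<open>The set \<open>3X - 2X\<close>. A bound for its cardinality is the form in which small doubling is used
  throughout: it controls all shorter sums and differences, it is what the covering lemma needs, and
  it is exactly where the sums built from products in the graph argument live.\<close>

definition three_minus_two :: "'a::ab_group_add set \<Rightarrow> 'a set" where
  "three_minus_two X = X + X + X + uminus ` (X + X)"

lemma finite_three_minus_two: "finite X \<Longrightarrow> finite (three_minus_two X)"
  by (simp add: three_minus_two_def finite_set_plus)

text \<open>Pluennecke's inequality for the combination needed here: pass to a subset of \<open>A\<close> with the least
  growth ratio, iterate Petridis's lemma to bound \<open>X + 3B\<close> and \<open>X + 2B\<close>, and combine the two by
  Ruzsa's triangle inequality. It is applied with \<open>B = A\<close> and with \<open>B = -A\<close>.\<close>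

lemma plunnecke_three_minus_two:
  fixes A B :: "'a::ab_group_add set"
  assumes "finite A" "finite B" "A \<noteq> {}" and AB: "card (A + B) \<le> K * card A"
  shows "card (three_minus_two B) \<le> K ^ 5 * card A"
proof -
  define S where "S = {Z. Z \<subseteq> A \<and> Z \<noteq> {}}"
  define q where "q Z = real (card (Z + B)) / real (card Z)" for Z :: "'a set"
  have "finite S" "S \<noteq> {}" using assms by (auto simp: S_def)
  then obtain X where X: "X \<in> S" and Xmin: "\<And>Z. Z \<in> S \<Longrightarrow> q X \<le> q Z"
    using ex_is_arg_min_if_finite[of S q] by (auto simp: is_arg_min_def not_less)
  have XA: "X \<subseteq> A" "X \<noteq> {}" and finX: "finite X"
    using X assms by (auto simp: S_def intro: finite_subset)
  then have X0: "card X > 0" by (simp add: card_gt_0_iff)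
  have min: "card (X + B) * card Z \<le> card (Z + B) * card X" if "Z \<subseteq> X" for Z
  proof (cases "Z = {}")
    case False
    then have "card Z > 0" using that finX by (simp add: card_gt_0_iff finite_subset)
    moreover have "q X \<le> q Z" using Xmin[of Z] that XA False by (auto simp: S_def)
    ultimately have "real (card (X + B)) * card Z \<le> real (card (Z + B)) * card X"
      using X0 by (simp add: q_def field_simps)
    then show ?thesis by (simp flip: of_nat_mult)
  qed simp
  have step: "card (X + B + C) \<le> K * card (X + C)" if "finite C" for C
  proof -
    have "card A > 0" using assms by (simp add: card_gt_0_iff)
    moreover have "q X \<le> q A" using Xmin[of A] assms by (auto simp: S_def)
    ultimately have "real (card (X + B)) * card A \<le> real (card (A + B)) * card X"
      using X0 by (simp add: q_def field_simps)
    then have "card (X + B) * card A \<le> card (A + B) * card X"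
      by (simp flip: of_nat_mult)
    also have "\<dots> \<le> (K * card X) * card A"
      using mult_right_mono[OF AB, of "card X"] by (simp add: mult_ac)
    finally have XB: "card (X + B) \<le> K * card X" using \<open>card A > 0\<close> by simp
    have "card (X + B + C) * card X \<le> card (X + B) * card (X + C)"
      by (rule petridis[OF finX \<open>finite B\<close> that min])
    also have "\<dots> \<le> (K * card X) * card (X + C)" using XB by (rule mult_right_mono) simp
    finally have "card (X + B + C) * card X \<le> (K * card (X + C)) * card X" by (simp add: mult_ac)
    then show ?thesis using X0 by simp
  qed
  have s1: "card (X + B) \<le> K * card X" using step[of 0] by simp
  have s2: "card (X + (B + B)) \<le> K ^ 2 * card X"
  proof -
    have "card (X + (B + B)) \<le> K * card (X + B)" using step[OF \<open>finite B\<close>] by (simp add: add.assoc)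
    also have "\<dots> \<le> K * (K * card X)" using s1 by simp
    finally show ?thesis by (simp only: power2_eq_square mult.assoc)
  qed
  have s3: "card (X + (B + B + B)) \<le> K ^ 3 * card X"
  proof -
    have "card (X + (B + B + B)) \<le> K * card (X + (B + B))"
      using step[of "B + B"] \<open>finite B\<close> by (simp add: add.assoc finite_set_plus)
    also have "\<dots> \<le> K * (K ^ 2 * card X)" using s2 by simp
    finally show ?thesis by (simp only: power2_eq_square power3_eq_cube mult.assoc)
  qed
  have "card X * card (three_minus_two B) \<le> card (X + (B + B + B)) * card (X + (B + B))"
    unfolding three_minus_two_def using ruzsa_triangle[of X "B + B + B" "B + B"] finX \<open>finite B\<close>
    by (simp add: finite_set_plus)
  also have "\<dots> \<le> (K ^ 3 * card X) * (K ^ 2 * card X)" by (rule mult_mono[OF s3 s2]) auto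
  also have "\<dots> = card X * (K ^ 5 * card X)"
    using power_add[of K 3 2] by simp
  finally have "card (three_minus_two B) \<le> K ^ 5 * card X" using X0 by simp
  also have "\<dots> \<le> K ^ 5 * card A" using XA assms by (simp add: card_mono)
  finally show ?thesis .
qed

lemma three_minus_two_uminus: "three_minus_two (uminus ` A) = uminus ` three_minus_two (A :: 'a::ab_group_add set)"
  by (simp add: three_minus_two_def image_uminus_set_plus)

text \<open>Ruzsa's covering lemma: a maximal family of disjoint translates of \<open>V\<close> by elements of \<open>U\<close> is small, and
  maximality means that every other translate meets one of them.\<close>

lemma ruzsa_covering:
  fixes U V :: "'a::ab_group_add set"
  assumes "finite U" "finite V" "V \<noteq> {}" "card (U + V) \<le> K * card V"
  obtains F where "F \<subseteq> U" "card F \<le> K" "U \<subseteq> F + (V + uminus ` V)"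
proof -
  define good where "good F \<longleftrightarrow> F \<subseteq> U \<and> (\<forall>f\<in>F. \<forall>f'\<in>F. f \<noteq> f' \<longrightarrow> ({f} + V) \<inter> ({f'} + V) = {})" for F
  have "finite {F. good F}" by (rule finite_subset[of _ "Pow U"]) (use assms in \<open>auto simp: good_def\<close>)
  moreover have "{} \<in> {F. good F}" by (simp add: good_def)
  ultimately obtain F where "F \<in> {F. good F}" "\<forall>F'\<in>{F. good F}. F \<subseteq> F' \<longrightarrow> F = F'"
    using finite_has_maximal[of "{F. good F}"] by blast
  then have F: "good F" and Fmax: "\<And>F'. good F' \<Longrightarrow> F \<subseteq> F' \<Longrightarrow> F' = F" by blast+
  have finF: "finite F" using F assms by (auto simp: good_def intro: finite_subset)
  have "card F * card V = card (\<Union>f\<in>F. {f} + V)"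
    by (subst card_UN_disjoint)
       (use F finF assms in \<open>auto simp: good_def finite_set_plus card_set_plus_singleton_left\<close>)
  also have "\<dots> \<le> card (U + V)"
    using assms F by (intro card_mono) (auto simp: good_def finite_set_plus set_plus_def)
  also have "\<dots> \<le> K * card V" by fact
  finally have "card F \<le> K" using assms by (simp add: card_gt_0_iff)
  moreover have "U \<subseteq> F + (V + uminus ` V)"
  proof
    fix u assume u: "u \<in> U"
    have "\<exists>f\<in>F. ({u} + V) \<inter> ({f} + V) \<noteq> {}"
    proof (rule ccontr)
      assume "\<not> ?thesis"
      then have d: "\<And>f. f \<in> F \<Longrightarrow> ({u} + V) \<inter> ({f} + V) = {}" by blast
      then have "good (insert u F)" using F u unfolding good_def by blast
      then have "insert u F = F" using Fmax by blast
      then have "({u} + V) \<inter> ({u} + V) = {}" using d by blast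
      then show False using assms(3) by (auto simp: set_plus_def)
    qed
    then obtain f v v' where f: "f \<in> F" "v \<in> V" "v' \<in> V" and "u + v = f + v'"
      by (auto simp: set_plus_def)
    then have eq: "u = f + (v' + - v)"
      by (simp add: algebra_simps eq_diff_eq)
    show "u \<in> F + (V + uminus ` V)" unfolding eq using f by (intro set_plus_intro) auto
  qed
  ultimately show ?thesis using that[of F] F unfolding good_def by blast
qed

section \<open>The theorem of Balog, Szemeredi and Gowers\<close>

definition diff_count :: "'a::ab_group_add set \<Rightarrow> 'a \<Rightarrow> nat" where
  "diff_count A d = card {(x, y) \<in> A \<times> A. x - y = d}"

lemma diff_count_le: "finite A \<Longrightarrow> diff_count A d \<le> card A"
  unfolding diff_count_def
proof (rule card_inj_on_le[where f = snd])
  show "inj_on snd {(x, y). (x, y) \<in> A \<times> A \<and> x - y = d}"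
    by (rule inj_onI) (auto simp: diff_eq_eq)
qed auto

lemma diff_count_uminus: "diff_count A (- d) = diff_count A d"
  unfolding diff_count_def
proof (rule bij_betw_same_card[of prod.swap], rule bij_betw_byWitness[where f' = prod.swap])
  have "b - a = - d \<longleftrightarrow> a - b = d" for a b :: 'a by (metis minus_diff_eq minus_minus)
  then show "prod.swap ` {(x, y). (x, y) \<in> A \<times> A \<and> x - y = - d} \<subseteq> {(x, y). (x, y) \<in> A \<times> A \<and> x - y = d}"
    "prod.swap ` {(x, y). (x, y) \<in> A \<times> A \<and> x - y = d} \<subseteq> {(x, y). (x, y) \<in> A \<times> A \<and> x - y = - d}"
    by auto
qed auto

lemma additive_energy_eq_sum_diff_count:
  fixes A :: "'a::ab_group_add set"
  assumes "finite A"
  shows "additive_energy A = (\<Sum>(a, c)\<in>A \<times> A. diff_count A (a - c))"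
proof -
  let ?S = "Sigma (A \<times> A) (\<lambda>p. {(x, y) \<in> A \<times> A. x - y = fst p - snd p})"
  let ?T = "{(a1, a2, a3, a4). a1 \<in> A \<and> a2 \<in> A \<and> a3 \<in> A \<and> a4 \<in> A \<and> a1 + a2 = a3 + a4}"
  have eq: "x - y = a - c \<longleftrightarrow> a + y = c + x" for a c x y :: 'a
  proof -
    have *: "(x - y) - (a - c) = (c + x) - (a + y)" by (simp add: algebra_simps)
    have "x - y = a - c \<longleftrightarrow> (x - y) - (a - c) = 0" by (simp only: right_minus_eq)
    also have "\<dots> \<longleftrightarrow> c + x = a + y" unfolding * by (rule right_minus_eq)
    finally show ?thesis by (simp only: eq_commute[of "a + y"])
  qed
  have "bij_betw (\<lambda>((a, c), (x, y)). (a, y, c, x)) ?S ?T"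
    by (rule bij_betw_byWitness[where f' = "\<lambda>(a, y, c, x). ((a, c), (x, y))"])
       (clarsimp, clarsimp, clarsimp simp: eq, clarsimp simp: eq)
  then have "card ?T = card ?S" by (rule bij_betw_same_card[symmetric])
  also have "\<dots> = (\<Sum>p\<in>A \<times> A. diff_count A (fst p - snd p))"
  proof -
    have "finite {(x, y) \<in> A \<times> A. x - y = d}" for d
      by (rule finite_subset[of _ "A \<times> A"]) (use assms in auto)
    then show ?thesis using assms unfolding diff_count_def by (intro card_SigmaI) auto
  qed
  also have "\<dots> = (\<Sum>(a, c)\<in>A \<times> A. diff_count A (a - c))"
    by (simp add: case_prod_unfold)
  finally show ?thesis unfolding additive_energy_def .
qed

lemma sum_card_fibres:
  assumes "finite A" "finite B"
  shows "(\<Sum>a\<in>A. card {b \<in> B. R a b}) = (\<Sum>b\<in>B. card {a \<in> A. R a b})"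
proof -
  have "(\<Sum>a\<in>A. \<Sum>b\<in>B. of_bool (R a b) :: nat) = (\<Sum>b\<in>B. \<Sum>a\<in>A. of_bool (R a b))"
    by (rule sum.swap)
  then show ?thesis using assms by (simp add: sum.If_cases Int_def of_bool_def)
qed

text \<open>The graph lemma in the theorem of Balog--Szemeredi--Gowers. Few pairs of vertices have few common
  neighbours and such pairs lie rarely in a common neighbourhood, so on average over \<open>v\<close> a
  neighbourhood contains few bad pairs. In a good neighbourhood \<open>V\<close>, vertices that are bad with at
  most a quarter of \<open>V\<close> form \<open>A'\<close>; any two of them share half of \<open>V\<close> as good partners, which gives
  many paths of length four between them.\<close>

lemma dense_graph_path_lemma:
  fixes R :: "'a \<Rightarrow> 'a \<Rightarrow> bool" and \<alpha> :: real
  assumes fin: "finite A" and sym: "\<And>x y. R x y \<Longrightarrow> R y x"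
    and \<alpha>: "\<alpha> > 0" and dense: "\<alpha> * real (card A) ^ 2 \<le> real (card {(x, y) \<in> A \<times> A. R x y})"
    and "A \<noteq> {}"
  obtains V A' where "V \<subseteq> A" "A' \<subseteq> V" "\<alpha> / 2 * card A \<le> card V" "card A' \<ge> 3 / 4 * real (card V)"
    "\<And>a a'. a \<in> A' \<Longrightarrow> a' \<in> A' \<Longrightarrow> \<exists>W \<subseteq> V. real (card W) \<ge> card V / 2 \<and>
       (\<forall>w\<in>W. card {x \<in> A. R a x \<and> R x w} \<ge> \<alpha>\<^sup>2 / 32 * card A \<and>
              card {y \<in> A. R w y \<and> R y a'} \<ge> \<alpha>\<^sup>2 / 32 * card A)"
proof -
  define N where "N = real (card A)"
  have N0: "N > 0" using assms by (simp add: N_def card_gt_0_iff)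
  (* with this threshold the weight 16 below leaves half of the main term \<alpha>\<^sup>2 N\<^sup>3 *)
  define \<beta> where "\<beta> = \<alpha>\<^sup>2 / 32"
  define nb where "nb v = {a \<in> A. R v a}" for v
  define common where "common a a' = {x \<in> A. R a x \<and> R x a'}" for a a'
  define bad where "bad = {(a, a') \<in> A \<times> A. real (card (common a a')) < \<beta> * N}"
  have fin_nb [simp]: "finite (nb v)" for v using fin by (simp add: nb_def)
  have fin_bad: "finite bad" unfolding bad_def by (rule finite_subset[of _ "A \<times> A"]) (use fin in auto)
  have edges: "(\<Sum>v\<in>A. real (card (nb v))) \<ge> \<alpha> * N ^ 2"
  proof -
    have "card {(x, y) \<in> A \<times> A. R x y} = card (Sigma A nb)"
      by (rule arg_cong[where f = card]) (auto simp: nb_def)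
    also have "\<dots> = (\<Sum>v\<in>A. card (nb v))" using fin by simp
    finally show ?thesis using dense by (simp add: N_def)
  qed
  have sq: "(\<Sum>v\<in>A. real (card (nb v)) ^ 2) \<ge> \<alpha>\<^sup>2 * N ^ 3"
  proof -
    have "(\<alpha> * N ^ 2)\<^sup>2 \<le> (\<Sum>v\<in>A. real (card (nb v)))\<^sup>2"
      using edges \<alpha> by (intro power_mono) auto
    also have "\<dots> \<le> (\<Sum>v\<in>A. real (card (nb v)) ^ 2) * N"
      unfolding N_def by (rule sum_squared_le_sum_of_squares)
    finally have "\<alpha>\<^sup>2 * N ^ 3 * N \<le> (\<Sum>v\<in>A. real (card (nb v)) ^ 2) * N"
      by (simp add: power_mult_distrib power2_eq_square power3_eq_cube mult_ac)
    then show ?thesis using N0 by simp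
  qed
  have badsum: "(\<Sum>v\<in>A. real (card (bad \<inter> nb v \<times> nb v))) \<le> \<beta> * N ^ 3"
  proof -
    have "(\<Sum>v\<in>A. card (bad \<inter> nb v \<times> nb v)) = (\<Sum>v\<in>A. card {p \<in> bad. fst p \<in> nb v \<and> snd p \<in> nb v})"
      by (intro sum.cong refl arg_cong[where f = card]) auto
    also have "\<dots> = (\<Sum>p\<in>bad. card {v \<in> A. fst p \<in> nb v \<and> snd p \<in> nb v})"
      by (rule sum_card_fibres[OF fin fin_bad])
    also have "\<dots> = (\<Sum>p\<in>bad. card (common (fst p) (snd p)))"
    proof (rule sum.cong[OF refl])
      fix p assume "p \<in> bad"
      then have "fst p \<in> A" "snd p \<in> A" by (auto simp: bad_def)
      moreover have "R v (fst p) \<longleftrightarrow> R (fst p) v" for v using sym by blast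
      ultimately have "{v \<in> A. fst p \<in> nb v \<and> snd p \<in> nb v} = common (fst p) (snd p)"
        by (simp add: nb_def common_def)
      then show "card {v \<in> A. fst p \<in> nb v \<and> snd p \<in> nb v} = card (common (fst p) (snd p))" by simp
    qed
    finally have "(\<Sum>v\<in>A. real (card (bad \<inter> nb v \<times> nb v))) = (\<Sum>p\<in>bad. real (card (common (fst p) (snd p))))"
      by (simp flip: of_nat_sum)
    also have "\<dots> \<le> (\<Sum>p\<in>bad. \<beta> * N)" by (rule sum_mono) (auto simp: bad_def)
    also have "\<dots> = real (card bad) * (\<beta> * N)" by simp
    also have "\<dots> \<le> N ^ 2 * (\<beta> * N)"
    proof (rule mult_right_mono)
      have "card bad \<le> card (A \<times> A)" unfolding bad_def by (rule card_mono) (use fin in auto)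
      then show "real (card bad) \<le> N ^ 2"
        by (simp add: N_def card_cartesian_product power2_eq_square flip: of_nat_mult)
    qed (use \<alpha> N0 in \<open>auto simp: \<beta>_def\<close>)
    finally show ?thesis by (simp add: power2_eq_square power3_eq_cube mult_ac)
  qed
  obtain v where v: "v \<in> A" and vb: "real (card (nb v)) ^ 2 - 16 * real (card (bad \<inter> nb v \<times> nb v)) \<ge> \<alpha>\<^sup>2 / 2 * N ^ 2"
  proof (rule ccontr)
    assume neg: "\<not> thesis"
    have "(\<Sum>v\<in>A. real (card (nb v)) ^ 2 - 16 * real (card (bad \<inter> nb v \<times> nb v))) < (\<Sum>v\<in>A. \<alpha>\<^sup>2 / 2 * N ^ 2)"
      using neg that assms by (intro sum_strict_mono) (auto simp: not_le[symmetric])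
    also have "\<dots> = \<alpha>\<^sup>2 / 2 * N ^ 3" by (simp add: N_def power2_eq_square power3_eq_cube mult_ac)
    finally have "(\<Sum>v\<in>A. real (card (nb v)) ^ 2) - 16 * (\<Sum>v\<in>A. real (card (bad \<inter> nb v \<times> nb v))) < \<alpha>\<^sup>2 / 2 * N ^ 3"
      by (simp add: sum_subtractf sum_distrib_left)
    then show False using sq badsum by (simp add: \<beta>_def)
  qed
  define V where "V = nb v"
  define A' where "A' = {a \<in> V. real (card {w \<in> V. (a, w) \<in> bad}) \<le> card V / 4}"
  have VA: "V \<subseteq> A" by (auto simp: V_def nb_def)
  have finV: "finite V" using VA fin by (rule finite_subset)
  have cV2: "real (card V) ^ 2 \<ge> \<alpha>\<^sup>2 / 2 * N ^ 2" using vb by (simp add: V_def)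
  have cV: "\<alpha> / 2 * N \<le> card V"
  proof (rule power2_le_imp_le)
    have "(\<alpha> / 2 * N)\<^sup>2 = (\<alpha>\<^sup>2 / 2 * N\<^sup>2) / 2" by (simp add: power_mult_distrib power_divide)
    then show "(\<alpha> / 2 * N)\<^sup>2 \<le> (real (card V))\<^sup>2"
      using cV2 zero_le_power2[of "real (card V)"] by linarith
  qed simp
  have cV0: "card V > 0"
  proof -
    have "\<alpha> / 2 * N > 0" using \<alpha> N0 by simp
    then show ?thesis using cV by linarith
  qed
  have badV: "16 * real (card (bad \<inter> V \<times> V)) \<le> real (card V) ^ 2"
  proof -
    have "0 \<le> \<alpha>\<^sup>2 / 2 * N ^ 2" by simp
    then show ?thesis using vb unfolding V_def by linarith
  qed
  have cA': "card A' \<ge> 3 / 4 * real (card V)"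
  proof -
    have "card (V - A') * (card V / 4) \<le> (\<Sum>a\<in>V - A'. real (card {w \<in> V. (a, w) \<in> bad}))"
      by (rule order_trans[OF _ sum_mono[of _ "\<lambda>_. card V / 4"]]) (auto simp: A'_def)
    also have "\<dots> \<le> (\<Sum>a\<in>V. real (card {w \<in> V. (a, w) \<in> bad}))"
      by (rule sum_mono2) (use finV in auto)
    also have "\<dots> = real (card (Sigma V (\<lambda>a. {w \<in> V. (a, w) \<in> bad})))" using finV by simp
    also have "Sigma V (\<lambda>a. {w \<in> V. (a, w) \<in> bad}) = bad \<inter> V \<times> V" by auto
    finally have "4 * card (V - A') * real (card V) \<le> real (card V) ^ 2" using badV by simp
    then have "4 * real (card (V - A')) \<le> card V" using cV0 by (simp add: power2_eq_square)
    moreover have "real (card (V - A')) = card V - card A'"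
      using finV by (subst card_Diff_subset) (auto simp: A'_def of_nat_diff card_mono intro: finite_subset)
    ultimately show ?thesis
      using card_mono[OF finV, of A'] by (simp add: A'_def)
  qed
  have "\<exists>W \<subseteq> V. real (card W) \<ge> card V / 2 \<and>
       (\<forall>w\<in>W. card {x \<in> A. R a x \<and> R x w} \<ge> \<alpha>\<^sup>2 / 32 * card A \<and>
              card {y \<in> A. R w y \<and> R y a'} \<ge> \<alpha>\<^sup>2 / 32 * card A)"
    if a: "a \<in> A'" "a' \<in> A'" for a a'
  proof -
    define W where "W = V - {w \<in> V. (a, w) \<in> bad} - {w \<in> V. (a', w) \<in> bad}"
    have "card V \<le> card (W \<union> {w \<in> V. (a, w) \<in> bad} \<union> {w \<in> V. (a', w) \<in> bad})"
      by (rule card_mono) (use finV in \<open>auto simp: W_def\<close>)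
    also have "\<dots> \<le> card W + card {w \<in> V. (a, w) \<in> bad} + card {w \<in> V. (a', w) \<in> bad}"
      by (meson card_Un_le le_trans add_le_mono1)
    finally have "real (card W) \<ge> card V / 2" using a by (simp add: A'_def)
    moreover have comm: "{y \<in> A. R w y \<and> R y a'} = {y \<in> A. R a' y \<and> R y w}" for w
    proof -
      have "R w y \<and> R y a' \<longleftrightarrow> R a' y \<and> R y w" for y using sym[of w y] sym[of y w] sym[of y a'] sym[of a' y] by blast
      then show ?thesis by simp
    qed
    moreover have "\<forall>w\<in>W. card {x \<in> A. R a x \<and> R x w} \<ge> \<alpha>\<^sup>2 / 32 * card A \<and>
              card {y \<in> A. R w y \<and> R y a'} \<ge> \<alpha>\<^sup>2 / 32 * card A"
      unfolding comm using a VA by (auto simp: W_def bad_def A'_def common_def \<beta>_def N_def not_less)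
    ultimately show ?thesis by (intro exI[of _ W]) (auto simp: W_def)
  qed
  then show ?thesis using that[of V A'] VA cV cA' by (auto simp: A'_def N_def)
qed

text \<open>Join two elements when their difference is popular. A difference of two elements of \<open>A'\<close> is then a
  sum of four popular differences in about \<open>|A|\<^sup>3\<close> ways, and as there are only \<open>O(|A|)\<close> popular
  differences, there are \<open>O(|A|)\<close> such sums.\<close>

theorem balog_szemeredi_gowers:
  fixes A :: "'a::ab_group_add set" and \<eta> :: real
  assumes fin: "finite A" and "A \<noteq> {}" and \<eta>: "\<eta> > 0"
    and en: "\<eta> * real (card A) ^ 3 \<le> real (additive_energy A)"
  obtains A' where "A' \<subseteq> A" "A' \<noteq> {}" "real (card A') \<ge> \<eta> / 8 * card A"
    "real (card (A' + uminus ` A')) \<le> 4 * 32\<^sup>2 * (2 / \<eta>) ^ 9 * card A"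
proof -
  define \<alpha> where "\<alpha> = \<eta> / 2"
  have \<alpha>: "\<alpha> > 0" using \<eta> by (simp add: \<alpha>_def)
  define N where "N = real (card A)"
  have N0: "N > 0" using assms by (simp add: N_def card_gt_0_iff)
  define R where "R x y \<longleftrightarrow> real (diff_count A (x - y)) \<ge> \<alpha> * N" for x y
  have sym: "R x y \<Longrightarrow> R y x" for x y
    unfolding R_def using diff_count_uminus[of A "x - y"] by simp
  have dense: "\<alpha> * real (card A) ^ 2 \<le> real (card {(x, y) \<in> A \<times> A. R x y})"
  proof -
    have "\<eta> * N ^ 3 \<le> (\<Sum>(a, c)\<in>A \<times> A. real (diff_count A (a - c)))"
      using en by (simp add: additive_energy_eq_sum_diff_count[OF fin] N_def case_prod_unfold)
    also have "\<dots> \<le> (\<Sum>(a, c)\<in>A \<times> A. \<alpha> * N + (if R a c then N else 0))"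
    proof (rule sum_mono, clarify)
      fix a c
      show "real (diff_count A (a - c)) \<le> \<alpha> * N + (if R a c then N else 0)"
      proof -
        have "real (diff_count A (a - c)) \<le> N" using diff_count_le[OF fin, of "a - c"] by (simp add: N_def)
        moreover have "0 \<le> \<alpha> * N" using \<alpha> N0 by simp
        ultimately show ?thesis by (auto simp: R_def)
      qed
    qed
    also have "\<dots> = N ^ 2 * (\<alpha> * N) + (\<Sum>p\<in>A \<times> A. if R (fst p) (snd p) then N else 0)"
      by (simp add: case_prod_unfold sum.distrib N_def card_cartesian_product power2_eq_square)
    also have "(\<Sum>p\<in>A \<times> A. if R (fst p) (snd p) then N else 0)
        = real (card {(x, y) \<in> A \<times> A. R x y}) * N"
      using fin by (simp add: sum.If_cases Int_def case_prod_unfold mem_Times_iff)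
    finally have "\<alpha> * N ^ 2 * N \<le> real (card {(x, y) \<in> A \<times> A. R x y}) * N"
      by (simp add: \<alpha>_def power2_eq_square power3_eq_cube algebra_simps)
    then show ?thesis using N0 by (simp add: N_def)
  qed
  obtain V A' where V: "V \<subseteq> A" "A' \<subseteq> V" "\<alpha> / 2 * card A \<le> card V" "card A' \<ge> 3 / 4 * real (card V)"
    and paths: "\<And>a a'. a \<in> A' \<Longrightarrow> a' \<in> A' \<Longrightarrow> \<exists>W \<subseteq> V. real (card W) \<ge> card V / 2 \<and>
       (\<forall>w\<in>W. card {x \<in> A. R a x \<and> R x w} \<ge> \<alpha>\<^sup>2 / 32 * card A \<and>
              card {y \<in> A. R w y \<and> R y a'} \<ge> \<alpha>\<^sup>2 / 32 * card A)"
    using dense_graph_path_lemma[OF fin sym \<alpha> dense \<open>A \<noteq> {}\<close>] by blast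
  define D where "D = {d. real (diff_count A d) \<ge> \<alpha> * N}"
  have "\<alpha> * N > 0" using \<alpha> N0 by simp
  have Dsub: "D \<subseteq> (\<lambda>(x, y). x - y) ` (A \<times> A)"
  proof
    fix d assume "d \<in> D"
    then have "diff_count A d > 0" using \<open>\<alpha> * N > 0\<close> by (simp add: D_def)
    then show "d \<in> (\<lambda>(x, y). x - y) ` (A \<times> A)"
      by (auto simp: diff_count_def card_gt_0_iff)
  qed
  have finD: "finite D" by (rule finite_subset[OF Dsub]) (use fin in simp)
  have cD: "real (card D) * \<alpha> \<le> N"
  proof -
    have "real (card D) * (\<alpha> * N) \<le> (\<Sum>d\<in>D. real (diff_count A d))"
      by (rule order_trans[OF _ sum_mono[of _ "\<lambda>_. \<alpha> * N"]]) (auto simp: D_def)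
    also have "\<dots> = real (card (\<Union>d\<in>D. {(x, y) \<in> A \<times> A. x - y = d}))"
    proof -
      have "finite {(x, y) \<in> A \<times> A. x - y = d}" for d
        by (rule finite_subset[of _ "A \<times> A"]) (use fin in auto)
      then have "card (\<Union>d\<in>D. {(x, y) \<in> A \<times> A. x - y = d}) = (\<Sum>d\<in>D. diff_count A d)"
        unfolding diff_count_def by (intro card_UN_disjoint finD) auto
      then show ?thesis by simp
    qed
    also have "\<dots> \<le> real (card (A \<times> A))"
      by (intro of_nat_mono card_mono) (use fin in auto)
    also have "\<dots> = N * N" by (simp add: N_def card_cartesian_product)
    finally have "real (card D) * \<alpha> * N \<le> N * N" by (simp add: mult_ac)
    then show ?thesis using N0 by simp
  qed
  define Q where "Q d = {(d1, d2, d3, d4). d1 \<in> D \<and> d2 \<in> D \<and> d3 \<in> D \<and> d4 \<in> D \<and> d1 + d2 + d3 + d4 = d}" for d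
  have Qsub: "Q d \<subseteq> D \<times> D \<times> D \<times> D" for d by (auto simp: Q_def)
  have finQ: "finite (Q d)" for d by (rule finite_subset[OF Qsub]) (use finD in simp)
  have finA': "finite A'" using V fin by (meson finite_subset)
  have many: "real (card (Q d)) \<ge> \<alpha> / 4 * N * (\<alpha>\<^sup>2 / 32 * N)\<^sup>2" if "d \<in> A' + uminus ` A'" for d
  proof -
    from that obtain a a' where a: "a \<in> A'" "a' \<in> A'" "d = a - a'" by (auto simp: set_plus_def)
    obtain W where W: "W \<subseteq> V" "real (card W) \<ge> card V / 2"
      and wx: "\<And>w. w \<in> W \<Longrightarrow> card {x \<in> A. R a x \<and> R x w} \<ge> \<alpha>\<^sup>2 / 32 * N"
      and wy: "\<And>w. w \<in> W \<Longrightarrow> card {y \<in> A. R w y \<and> R y a'} \<ge> \<alpha>\<^sup>2 / 32 * N"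
      using paths[OF a(1,2)] unfolding N_def by blast
    have finW: "finite W" using W V fin by (meson finite_subset)
    (* a path a, x, w, y, a' gives the four popular differences, and they determine it *)
    let ?T = "Sigma W (\<lambda>w. {x \<in> A. R a x \<and> R x w} \<times> {y \<in> A. R w y \<and> R y a'})"
    have "card ?T \<le> card (Q d)"
    proof (rule card_inj_on_le[where f = "\<lambda>(w, x, y). (a - x, x - w, w - y, y - a')"])
      show "(\<lambda>(w, x, y). (a - x, x - w, w - y, y - a')) ` ?T \<subseteq> Q d"
        by (auto simp: Q_def D_def R_def a)
    qed (auto simp: inj_on_def finQ)
    have "\<alpha> / 4 * N * (\<alpha>\<^sup>2 / 32 * N)\<^sup>2 \<le> real (card W) * (\<alpha>\<^sup>2 / 32 * N)\<^sup>2"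
      using W(2) V(3) by (intro mult_right_mono) (auto simp: N_def)
    also have "\<dots> = (\<Sum>w\<in>W. (\<alpha>\<^sup>2 / 32 * N) * (\<alpha>\<^sup>2 / 32 * N))" by (simp add: power2_eq_square)
    also have "\<dots> \<le> (\<Sum>w\<in>W. real (card {x \<in> A. R a x \<and> R x w}) * real (card {y \<in> A. R w y \<and> R y a'}))"
      using wx wy N0 by (intro sum_mono mult_mono) auto
    also have "\<dots> = real (card ?T)"
      using finW fin by (simp add: card_cartesian_product)
    also have "\<dots> \<le> real (card (Q d))" using \<open>card ?T \<le> card (Q d)\<close> by simp
    finally show ?thesis .
  qed
  have "real (card (A' + uminus ` A')) * (\<alpha> / 4 * N * (\<alpha>\<^sup>2 / 32 * N)\<^sup>2) \<le> (\<Sum>d\<in>A' + uminus ` A'. real (card (Q d)))"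
    by (rule order_trans[OF _ sum_mono[OF many]]) auto
  also have "\<dots> = real (card (\<Union>d\<in>A' + uminus ` A'. Q d))"
  proof -
    have "card (\<Union>d\<in>A' + uminus ` A'. Q d) = (\<Sum>d\<in>A' + uminus ` A'. card (Q d))"
      by (intro card_UN_disjoint finite_set_plus finite_imageI finA' finQ ballI)
         (auto simp: Q_def)
    then show ?thesis by simp
  qed
  also have "\<dots> \<le> real (card (D \<times> D \<times> D \<times> D))"
    using Qsub finD by (intro of_nat_mono card_mono) auto
  also have "\<dots> = real (card D) ^ 4" by (simp add: card_cartesian_product power4_eq_xxxx)
  also have "\<dots> \<le> (N / \<alpha>) ^ 4" using cD \<alpha> by (intro power_mono) (auto simp: field_simps)
  finally have *: "real (card (A' + uminus ` A')) * (\<alpha> / 4 * N * (\<alpha>\<^sup>2 / 32 * N)\<^sup>2) \<le> (N / \<alpha>) ^ 4" .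
  have "(N / \<alpha>) ^ 4 = (4 * 32\<^sup>2 * (1 / \<alpha>) ^ 9 * N) * (\<alpha> / 4 * N * (\<alpha>\<^sup>2 / 32 * N)\<^sup>2)"
  proof -
    define i where "i = 1 / \<alpha>"
    have "i * \<alpha> = 1" using \<alpha> by (simp add: i_def)
    then have "(N * i) ^ 4 = (N * i) ^ 4 * (i * \<alpha>) ^ 5" by simp
    also have "\<dots> = (4 * 32\<^sup>2 * i ^ 9 * N) * (\<alpha> / 4 * N * (\<alpha>\<^sup>2 / 32 * N)\<^sup>2)"
    proof -
      have "i ^ 9 = i ^ 4 * i ^ 5" "(\<alpha>\<^sup>2)\<^sup>2 = \<alpha> ^ 4" by (simp_all flip: power_add power_mult)
      moreover have "\<alpha> ^ 5 = \<alpha> * \<alpha> ^ 4" "N ^ 4 = N * (N * N\<^sup>2)"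
        by (simp_all add: power_numeral_reduce power2_eq_square)
      ultimately show ?thesis by (simp add: power_mult_distrib power_divide mult_ac)
    qed
    finally show ?thesis by (simp add: i_def)
  qed
  with * have "real (card (A' + uminus ` A')) * (\<alpha> / 4 * N * (\<alpha>\<^sup>2 / 32 * N)\<^sup>2)
    \<le> (4 * 32\<^sup>2 * (1 / \<alpha>) ^ 9 * N) * (\<alpha> / 4 * N * (\<alpha>\<^sup>2 / 32 * N)\<^sup>2)" by simp
  then have "real (card (A' + uminus ` A')) \<le> 4 * 32\<^sup>2 * (1 / \<alpha>) ^ 9 * N"
  proof (rule mult_right_le_imp_le[of _ "\<alpha> / 4 * N * (\<alpha>\<^sup>2 / 32 * N)\<^sup>2"])
    show "0 < \<alpha> / 4 * N * (\<alpha>\<^sup>2 / 32 * N)\<^sup>2" using N0 \<alpha> by simp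
  qed
  then have 1: "real (card (A' + uminus ` A')) \<le> 4 * 32\<^sup>2 * (2 / \<eta>) ^ 9 * card A"
    by (simp add: \<alpha>_def N_def)
  have "\<alpha> / 2 * card A > 0" using \<alpha> N0 by (simp add: N_def)
  then have c: "real (card A') \<ge> \<eta> / 8 * card A" "real (card A') > 0"
    using V(3,4) by (auto simp: \<alpha>_def)
  from c(2) have "A' \<noteq> {}" by auto
  moreover have "A' \<subseteq> A" using V by blast
  ultimately show ?thesis using that[of A'] 1 c(1) by blast
qed

section \<open>Almost periods by random sampling\<close>

definition tuples :: "nat \<Rightarrow> 'a set \<Rightarrow> 'a list set" where
  "tuples m X = {xs. set xs \<subseteq> X \<and> length xs = m}"

lemma finite_tuples: "finite X \<Longrightarrow> finite (tuples m X)"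
  by (simp add: tuples_def finite_lists_length_eq)

lemma card_tuples: "finite X \<Longrightarrow> card (tuples m X) = card X ^ m"
  by (simp add: tuples_def card_lists_length_eq)

lemma sum_tuples_Suc:
  "(\<Sum>xs\<in>tuples (Suc m) X. f xs) = (\<Sum>xs\<in>tuples m X. \<Sum>x\<in>X. f (x # xs))"
proof -
  have "tuples (Suc m) X = (\<lambda>(xs, x). x # xs) ` (tuples m X \<times> X)"
    by (simp add: tuples_def lists_length_Suc_eq)
  then have "(\<Sum>xs\<in>tuples (Suc m) X. f xs) = (\<Sum>p\<in>tuples m X \<times> X. f (snd p # fst p))"
    by (simp add: sum.reindex inj_on_def case_prod_unfold)
  then show ?thesis by (simp add: sum.cartesian_product case_prod_unfold)
qed

text \<open>The variance of a sum of independent centred samples is the sum of the variances.\<close>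

lemma variance_of_sample:
  fixes a :: "'a \<Rightarrow> real"
  assumes fin: "finite X" and mean: "(\<Sum>x\<in>X. a x) = 0"
  shows "(\<Sum>xs\<in>tuples m X. (\<Sum>x\<leftarrow>xs. a x)\<^sup>2) * card X = m * real (card X) ^ m * (\<Sum>x\<in>X. (a x)\<^sup>2)"
proof (induction m)
  case 0
  then show ?case by (simp add: tuples_def)
next
  case (Suc m)
  have "(\<Sum>x\<in>X. (a x + s)\<^sup>2) = (\<Sum>x\<in>X. (a x)\<^sup>2) + card X * s\<^sup>2" for s :: real
  proof -
    have "(\<Sum>x\<in>X. (a x + s)\<^sup>2) = (\<Sum>x\<in>X. (a x)\<^sup>2 + 2 * s * a x + s\<^sup>2)"
      by (simp add: power2_sum algebra_simps)
    also have "\<dots> = (\<Sum>x\<in>X. (a x)\<^sup>2) + 2 * s * (\<Sum>x\<in>X. a x) + card X * s\<^sup>2"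
      by (simp add: sum.distrib sum_distrib_left)
    finally show ?thesis using mean by simp
  qed
  then have "(\<Sum>xs\<in>tuples (Suc m) X. (\<Sum>x\<leftarrow>xs. a x)\<^sup>2)
      = real (card X) ^ m * (\<Sum>x\<in>X. (a x)\<^sup>2) + card X * (\<Sum>xs\<in>tuples m X. (\<Sum>x\<leftarrow>xs. a x)\<^sup>2)"
    by (simp add: sum_tuples_Suc sum.distrib sum_distrib_left card_tuples fin)
  then show ?case using Suc by (simp add: algebra_simps)
qed

text \<open>The convolutions of indicator functions \<open>1\<^sub>X * 1\<^sub>X\<close> and \<open>1\<^sub>X * 1\<^sub>X * 1\<^sub>-\<^sub>X\<close>.\<close>

definition conv2 :: "'a::ab_group_add set \<Rightarrow> 'a \<Rightarrow> real" where
  "conv2 X z = real (card {x \<in> X. z - x \<in> X})"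

definition conv3 :: "'a::ab_group_add set \<Rightarrow> 'a \<Rightarrow> real" where
  "conv3 X z = (\<Sum>y\<in>X. conv2 X (z + y))"

lemma conv2_eq_sum: "finite X \<Longrightarrow> conv2 X z = (\<Sum>x\<in>X. of_bool (z - x \<in> X))"
  by (simp add: conv2_def of_bool_def sum.If_cases Int_def)

lemma diff_notin_of_notin_sumset:
  fixes z :: "'a::ab_group_add"
  assumes "z \<notin> X + X" "x \<in> X"
  shows "z - x \<notin> X"
proof
  assume "z - x \<in> X"
  then have "x + (z - x) \<in> X + X" using assms(2) by (rule set_plus_intro[rotated])
  then show False using assms(1) by simp
qed

lemma conv2_eq_0: "z \<notin> X + X \<Longrightarrow> conv2 X z = 0"
  using diff_notin_of_notin_sumset[of z X] by (auto simp: conv2_def card_eq_0_iff)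

lemma sum_conv2:
  assumes "finite X"
  shows "(\<Sum>z\<in>X + X. conv2 X z) = real (card X) ^ 2"
proof -
  have "(\<Sum>z\<in>X + X. card {x \<in> X. z - x \<in> X}) = (\<Sum>x\<in>X. card {z \<in> X + X. z - x \<in> X})"
    by (rule sum_card_fibres) (use assms in \<open>auto simp: finite_set_plus\<close>)
  also have "\<dots> = (\<Sum>x\<in>X. card X)"
  proof (rule sum.cong[OF refl])
    fix x assume x: "x \<in> X"
    have "bij_betw (\<lambda>y. y + x) X {z \<in> X + X. z - x \<in> X}"
      by (rule bij_betw_byWitness[where f' = "\<lambda>z. z - x"]) (use x in \<open>auto simp: set_plus_def\<close>)
    then show "card {z \<in> X + X. z - x \<in> X} = card X" by (simp add: bij_betw_same_card)
  qed
  finally show ?thesis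
    by (simp add: conv2_def power2_eq_square flip: of_nat_sum of_nat_mult)
qed

lemma sum_conv3_eq: "finite X \<Longrightarrow> (\<Sum>x\<in>X. conv3 X x) = (\<Sum>z\<in>X + X. (conv2 X z)\<^sup>2)"
proof -
  assume fin: "finite X"
  have "(\<Sum>x\<in>X. conv3 X x) = (\<Sum>(x, y)\<in>X \<times> X. conv2 X (x + y))"
    by (simp add: conv3_def sum.cartesian_product)
  also have "\<dots> = (\<Sum>z\<in>X + X. \<Sum>p\<in>{p \<in> X \<times> X. fst p + snd p = z}. conv2 X (fst p + snd p))"
    unfolding case_prod_unfold
    by (rule sum.group[symmetric]) (use fin in \<open>auto simp: finite_set_plus intro: set_plus_intro\<close>)
  also have "\<dots> = (\<Sum>z\<in>X + X. (conv2 X z)\<^sup>2)"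
  proof (rule sum.cong[OF refl])
    fix z
    have "bij_betw fst {p \<in> X \<times> X. fst p + snd p = z} {x \<in> X. z - x \<in> X}"
      by (rule bij_betw_byWitness[where f' = "\<lambda>x. (x, z - x)"]) auto
    then have "real (card {p \<in> X \<times> X. fst p + snd p = z}) = conv2 X z"
      by (simp add: conv2_def bij_betw_same_card)
    then show "(\<Sum>p\<in>{p \<in> X \<times> X. fst p + snd p = z}. conv2 X (fst p + snd p)) = (conv2 X z)\<^sup>2"
      by (simp add: power2_eq_square)
  qed
  finally show ?thesis .
qed

text \<open>Croot and Sisask's sampling: the convolution \<open>1\<^sub>X * 1\<^sub>X\<close> is \<open>|X|\<close> times the average of \<open>1\<^sub>X(z - x)\<close> over
  \<open>x \<in> X\<close>, so it is close in mean square to \<open>|X|\<close> times the average over \<open>m\<close> random \<open>x\<close>. By Markov's inequality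
  at least half of the \<open>m\<close>-tuples are good samples. The error is multiplied by \<open>m\<close> to avoid divisions.\<close>

lemma good_samples:
  fixes X :: "'a::ab_group_add set"
  assumes fin: "finite X" and "X \<noteq> {}" and m: "m > 0"
  defines "err \<equiv> \<lambda>xs z. real m * conv2 X z - real (card X) * (\<Sum>x\<leftarrow>xs. of_bool (z - x \<in> X))"
  defines "Good \<equiv> {xs \<in> tuples m X. \<forall>Z. finite Z \<longrightarrow> (\<Sum>z\<in>Z. (err xs z)\<^sup>2) \<le> 2 * m * real (card X) ^ 3}"
  shows "card X ^ m \<le> 2 * card Good"
proof -
  define n where "n = real (card X)"
  have n0: "n > 0" using assms by (simp add: n_def card_gt_0_iff)
  have finS: "finite (X + X)" using fin by (simp add: finite_set_plus)
  have total: "(\<Sum>xs\<in>tuples m X. \<Sum>z\<in>X + X. (err xs z)\<^sup>2) \<le> m * n ^ m * n ^ 3"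
  proof -
    have one: "(\<Sum>xs\<in>tuples m X. (err xs z)\<^sup>2) * n \<le> m * n ^ m * (n\<^sup>2 * conv2 X z)" for z
    proof -
      define a where "a x = conv2 X z - n * of_bool (z - x \<in> X)" for x
      have mean: "(\<Sum>x\<in>X. a x) = 0"
        by (simp add: a_def sum_subtractf conv2_eq_sum[OF fin] n_def flip: sum_distrib_left)
      have "(\<Sum>xs\<in>tuples m X. (err xs z)\<^sup>2) = (\<Sum>xs\<in>tuples m X. (\<Sum>x\<leftarrow>xs. a x)\<^sup>2)"
        by (intro sum.cong refl arg_cong[where f = "\<lambda>x. x\<^sup>2"])
           (auto simp: err_def a_def tuples_def n_def sum_list_subtractf sum_list_const_mult sum_list_triv)
      then have "(\<Sum>xs\<in>tuples m X. (err xs z)\<^sup>2) * n = m * n ^ m * (\<Sum>x\<in>X. (a x)\<^sup>2)"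
        using variance_of_sample[OF fin mean, of m] by (simp add: n_def)
      also have "(\<Sum>x\<in>X. (a x)\<^sup>2) = (\<Sum>x\<in>X. (conv2 X z)\<^sup>2 - 2 * n * conv2 X z * of_bool (z - x \<in> X) + n\<^sup>2 * of_bool (z - x \<in> X))"
        by (intro sum.cong refl) (auto simp: a_def power2_diff)
      also have "\<dots> = n * (conv2 X z)\<^sup>2 - 2 * n * conv2 X z * conv2 X z + n\<^sup>2 * conv2 X z"
        by (simp add: sum.distrib sum_subtractf n_def conv2_eq_sum[OF fin] flip: sum_distrib_left)
      also have "\<dots> \<le> n\<^sup>2 * conv2 X z" using n0 by (simp add: power2_eq_square)
      finally show ?thesis using n0 by (simp add: mult_left_mono)
    qed
    have "(\<Sum>xs\<in>tuples m X. \<Sum>z\<in>X + X. (err xs z)\<^sup>2) * n = (\<Sum>z\<in>X + X. (\<Sum>xs\<in>tuples m X. (err xs z)\<^sup>2) * n)"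
      by (subst sum.swap) (simp add: sum_distrib_right)
    also have "\<dots> \<le> (\<Sum>z\<in>X + X. m * n ^ m * (n\<^sup>2 * conv2 X z))" by (rule sum_mono[OF one])
    also have "\<dots> = m * n ^ m * (n\<^sup>2 * n\<^sup>2)"
      using sum_conv2[OF fin] by (simp add: n_def flip: sum_distrib_left)
    finally have "(\<Sum>xs\<in>tuples m X. \<Sum>z\<in>X + X. (err xs z)\<^sup>2) * n \<le> (m * n ^ m * n ^ 3) * n"
      by (simp add: power2_eq_square power3_eq_cube mult_ac)
    then show ?thesis using n0 by simp
  qed
  define Bad where "Bad = tuples m X - Good"
  have supp: "(\<Sum>z\<in>Z. (err xs z)\<^sup>2) \<le> (\<Sum>z\<in>X + X. (err xs z)\<^sup>2)" if "finite Z" "xs \<in> tuples m X" for Z xs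
  proof -
    have "err xs z = 0" if "z \<notin> X + X" for z
    proof -
      have "z - x \<notin> X" if "x \<in> X" for x
        using \<open>z \<notin> X + X\<close> that by (rule diff_notin_of_notin_sumset)
      then have "(\<Sum>x\<leftarrow>xs. of_bool (z - x \<in> X) :: real) = (\<Sum>x\<leftarrow>xs. 0)"
        using \<open>xs \<in> tuples m X\<close>
        by (intro arg_cong[where f = sum_list] list.map_cong0) (auto simp: tuples_def)
      then show ?thesis using conv2_eq_0[OF that] by (simp add: err_def)
    qed
    then have "(\<Sum>z\<in>Z. (err xs z)\<^sup>2) = (\<Sum>z\<in>Z \<inter> (X + X). (err xs z)\<^sup>2)"
      by (intro sum.mono_neutral_right) (use that in auto)
    also have "\<dots> \<le> (\<Sum>z\<in>X + X. (err xs z)\<^sup>2)" by (rule sum_mono2) (use finS in auto)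
    finally show ?thesis .
  qed
  have finT: "finite (tuples m X)" using fin by (rule finite_tuples)
  have "card Bad * (2 * m * n ^ 3) \<le> (\<Sum>xs\<in>Bad. \<Sum>z\<in>X + X. (err xs z)\<^sup>2)"
  proof -
    have "2 * m * n ^ 3 \<le> (\<Sum>z\<in>X + X. (err xs z)\<^sup>2)" if "xs \<in> Bad" for xs
    proof (rule ccontr)
      assume "\<not> ?thesis"
      then have "(\<Sum>z\<in>Z. (err xs z)\<^sup>2) \<le> 2 * m * n ^ 3" if "finite Z" for Z
        using supp[OF that, of xs] \<open>xs \<in> Bad\<close> by (simp add: Bad_def)
      then show False using \<open>xs \<in> Bad\<close> by (simp add: Bad_def Good_def n_def)
    qed
    then have "(\<Sum>xs\<in>Bad. 2 * m * n ^ 3) \<le> (\<Sum>xs\<in>Bad. \<Sum>z\<in>X + X. (err xs z)\<^sup>2)" by (rule sum_mono)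
    then show ?thesis by simp
  qed
  also have "\<dots> \<le> (\<Sum>xs\<in>tuples m X. \<Sum>z\<in>X + X. (err xs z)\<^sup>2)"
    by (rule sum_mono2) (use finT in \<open>auto simp: Bad_def intro: sum_nonneg\<close>)
  also note total
  finally have "(2 * real (card Bad)) * (m * n ^ 3) \<le> n ^ m * (m * n ^ 3)" by (simp add: mult_ac)
  then have "2 * real (card Bad) \<le> n ^ m" using n0 m by simp
  moreover have "card Bad + card Good = card X ^ m"
  proof -
    have "Good \<subseteq> tuples m X" by (auto simp: Good_def)
    then show ?thesis using finT card_mono[OF finT] unfolding Bad_def
      by (subst card_Diff_subset) (auto simp: card_tuples[OF fin] intro: finite_subset)
  qed
  ultimately show ?thesis unfolding n_def by (simp flip: of_nat_power of_nat_mult)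
qed

text \<open>Translate the good samples by \<open>\<psi> u\<close> for \<open>u \<in> U\<close>. All these tuples live in \<open>X + X - X\<close>, a set not much
  larger than \<open>X\<close>, so many \<open>u\<close> share one translated tuple. That tuple approximates the translate of
  \<open>1\<^sub>X * 1\<^sub>X\<close> by \<open>\<psi> u\<close> for each of these \<open>u\<close>, hence the differences \<open>\<psi> u - \<psi> u'\<close> are almost periods
  in mean square, and one more convolution makes them almost periods in the maximum norm. An arbitrary
  index set \<open>U\<close> is allowed because the lemma will be applied repeatedly to the survivors of
  earlier steps.\<close>

lemma almost_periods:
  fixes X :: "'a::ab_group_add set" and \<psi> :: "'u \<Rightarrow> 'a"
  assumes fin: "finite X" and "X \<noteq> {}" and K: "card (X + (X + uminus ` X)) \<le> K * card X"
    and q: "q > 0" and finU: "finite U" and \<psi>: "\<psi> ` U \<subseteq> X + uminus ` X"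
  obtains U' where "U' \<subseteq> U" "card U \<le> 2 * K ^ (8 * q\<^sup>2) * card U'"
    "\<And>u u' x. u \<in> U' \<Longrightarrow> u' \<in> U' \<Longrightarrow>
       real q * \<bar>conv3 X (x + (\<psi> u - \<psi> u')) - conv3 X x\<bar> \<le> real (card X) ^ 2"
proof -
  define m where "m = 8 * q\<^sup>2"
  have m: "m > 0" using q by (simp add: m_def)
  define n where "n = real (card X)"
  have n0: "n > 0" using assms by (simp add: n_def card_gt_0_iff)
  define cnt where "cnt ys z = (\<Sum>y\<leftarrow>ys. of_bool (z - y \<in> X) :: real)" for ys z
  define Good where "Good = {xs \<in> tuples m X. \<forall>Z. finite Z \<longrightarrow> (\<Sum>z\<in>Z. (m * conv2 X z - n * cnt xs z)\<^sup>2) \<le> 2 * m * n ^ 3}"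
  have Good: "card X ^ m \<le> 2 * card Good"
    using good_samples[OF fin \<open>X \<noteq> {}\<close> m] by (simp add: Good_def n_def cnt_def)
  define T where "T = tuples m (X + (X + uminus ` X))"
  have finT: "finite T" unfolding T_def by (intro finite_tuples finite_set_plus finite_imageI fin)
  have cT: "card T \<le> K ^ m * card X ^ m"
  proof -
    have "card T = card (X + (X + uminus ` X)) ^ m"
      unfolding T_def by (intro card_tuples finite_set_plus finite_imageI fin)
    also have "\<dots> \<le> (K * card X) ^ m" using K by (rule power_mono) simp
    finally show ?thesis by (simp add: power_mult_distrib)
  qed
  (* the indices for which ys is the translate by \<psi> u of a good sample *)
  define V where "V ys = {u \<in> U. map (\<lambda>y. y - \<psi> u) ys \<in> Good}" for ys
  have "card U * card Good \<le> (\<Sum>u\<in>U. card {ys \<in> T. map (\<lambda>y. y - \<psi> u) ys \<in> Good})"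
  proof -
    have "card Good \<le> card {ys \<in> T. map (\<lambda>y. y - \<psi> u) ys \<in> Good}" if "u \<in> U" for u
    proof (rule card_inj_on_le[where f = "map (\<lambda>x. x + \<psi> u)"])
      show "map (\<lambda>x. x + \<psi> u) ` Good \<subseteq> {ys \<in> T. map (\<lambda>y. y - \<psi> u) ys \<in> Good}"
      proof -
        have "\<psi> u \<in> X + uminus ` X" using \<psi> that by blast
        then have "x + \<psi> u \<in> X + (X + uminus ` X)" if "x \<in> X" for x
          using that by (intro set_plus_intro)
        then have "map (\<lambda>x. x + \<psi> u) xs \<in> T" if "xs \<in> tuples m X" for xs
          using that unfolding T_def tuples_def by (auto simp: image_subset_iff subset_iff)
        then show ?thesis by (auto simp: Good_def o_def)
      qed
    qed (use finT in \<open>auto intro!: inj_on_mapI inj_onI simp: inj_def\<close>)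
    then have "(\<Sum>u\<in>U. card Good) \<le> (\<Sum>u\<in>U. card {ys \<in> T. map (\<lambda>y. y - \<psi> u) ys \<in> Good})"
      by (rule sum_mono)
    then show ?thesis by simp
  qed
  also have "\<dots> = (\<Sum>ys\<in>T. card (V ys))"
    unfolding V_def by (rule sum_card_fibres[OF finU finT])
  finally have total: "card U * card Good \<le> (\<Sum>ys\<in>T. card (V ys))" .
  have "\<exists>ys\<in>T. card U * card X ^ m \<le> 2 * K ^ m * card X ^ m * card (V ys)"
  proof (rule ccontr)
    assume neg: "\<not> ?thesis"
    obtain x where "x \<in> X" using \<open>X \<noteq> {}\<close> by blast
    then have "x + (x + - x) \<in> X + (X + uminus ` X)" by (intro set_plus_intro imageI)
    then have "replicate m (x + (x + - x)) \<in> T" unfolding T_def tuples_def by auto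
    then have "T \<noteq> {}" by blast
      have "card T * (card U * card X ^ m) > 2 * K ^ m * card X ^ m * (\<Sum>ys\<in>T. card (V ys))"
      proof -
        have "(\<Sum>ys\<in>T. 2 * K ^ m * card X ^ m * card (V ys)) < (\<Sum>ys\<in>T. card U * card X ^ m)"
          using neg \<open>T \<noteq> {}\<close> finT by (intro sum_strict_mono) (auto simp: not_le)
        then show ?thesis by (simp add: sum_distrib_left)
      qed
      moreover have "card T * (card U * card X ^ m) \<le> (K ^ m * card X ^ m) * (card U * (2 * card Good))"
        using cT Good by (intro mult_mono) auto
      moreover have "\<dots> \<le> 2 * K ^ m * card X ^ m * (\<Sum>ys\<in>T. card (V ys))"
        using mult_left_mono[OF total, of "2 * K ^ m * card X ^ m"] by (simp add: mult_ac)
      ultimately show False by linarith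
  qed
  then obtain ys where "card U * card X ^ m \<le> 2 * K ^ m * card X ^ m * card (V ys)" by blast
  then have "card U * card X ^ m \<le> 2 * K ^ m * card (V ys) * card X ^ m" by (simp add: mult_ac)
  then have cV: "card U \<le> 2 * K ^ m * card (V ys)" using n0 by (simp add: n_def)
  have approx: "(\<Sum>z\<in>Z. (m * conv2 X (z - \<psi> u) - n * cnt ys z)\<^sup>2) \<le> 2 * m * n ^ 3"
    if "u \<in> V ys" "finite Z" for u Z
  proof -
    have shift: "cnt (map (\<lambda>y. y - \<psi> u) ys) (z - \<psi> u) = cnt ys z" for z
      by (simp add: cnt_def o_def algebra_simps)
    have "(\<Sum>z\<in>Z. (m * conv2 X (z - \<psi> u) - n * cnt ys z)\<^sup>2)
        = (\<Sum>z\<in>(\<lambda>z. z - \<psi> u) ` Z. (m * conv2 X z - n * cnt (map (\<lambda>y. y - \<psi> u) ys) z)\<^sup>2)"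
      by (subst sum.reindex) (auto simp: inj_on_def shift)
    also have "\<dots> \<le> 2 * m * n ^ 3" using that by (auto simp: V_def Good_def)
    finally show ?thesis .
  qed
  have close2: "(\<Sum>z\<in>Z. (conv2 X (z + (\<psi> u - \<psi> u')) - conv2 X z)\<^sup>2) * (real q)\<^sup>2 \<le> n ^ 3"
    if u: "u \<in> V ys" "u' \<in> V ys" and Z: "finite Z" for u u' Z
  proof -
    let ?Z = "(\<lambda>z. z + \<psi> u) ` Z"
    have *: "(\<Sum>z\<in>?Z. (m * conv2 X (z - \<psi> u') - m * conv2 X (z - \<psi> u))\<^sup>2) \<le> 8 * m * n ^ 3"
    proof -
      have sq: "(a - b)\<^sup>2 \<le> 2 * (a - c)\<^sup>2 + 2 * (b - c)\<^sup>2" for a b c :: real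
      proof -
        have "2 * (a - c)\<^sup>2 + 2 * (b - c)\<^sup>2 - (a - b)\<^sup>2 = (a + b - 2 * c)\<^sup>2"
          by (simp add: power2_eq_square algebra_simps)
        then show ?thesis by (metis diff_ge_0_iff_ge zero_le_power2)
      qed
      have "(\<Sum>z\<in>?Z. (m * conv2 X (z - \<psi> u') - m * conv2 X (z - \<psi> u))\<^sup>2)
          \<le> (\<Sum>z\<in>?Z. 2 * (m * conv2 X (z - \<psi> u') - n * cnt ys z)\<^sup>2 + 2 * (m * conv2 X (z - \<psi> u) - n * cnt ys z)\<^sup>2)"
        by (rule sum_mono[OF sq])
      also have "\<dots> \<le> 2 * (2 * m * n ^ 3) + 2 * (2 * m * n ^ 3)"
        unfolding sum.distrib sum_distrib_left[symmetric]
        using approx[OF u(1), of ?Z] approx[OF u(2), of ?Z] Z by (intro add_mono) auto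
      finally show ?thesis by simp
    qed
    have "(\<Sum>z\<in>?Z. (m * conv2 X (z - \<psi> u') - m * conv2 X (z - \<psi> u))\<^sup>2)
        = (\<Sum>z\<in>Z. (m * conv2 X (z + (\<psi> u - \<psi> u')) - m * conv2 X z)\<^sup>2)"
      by (subst sum.reindex) (auto simp: inj_on_def algebra_simps)
    also have "\<dots> = (\<Sum>z\<in>Z. (conv2 X (z + (\<psi> u - \<psi> u')) - conv2 X z)\<^sup>2) * m * m"
      by (simp only: right_diff_distrib[symmetric] power_mult_distrib sum_distrib_left[symmetric])
         (simp only: power2_eq_square mult_ac)
    finally have "(\<Sum>z\<in>Z. (conv2 X (z + (\<psi> u - \<psi> u')) - conv2 X z)\<^sup>2) * m * m \<le> (8 * n ^ 3) * m"
      using * by (simp add: mult_ac)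
    then have "(\<Sum>z\<in>Z. (conv2 X (z + (\<psi> u - \<psi> u')) - conv2 X z)\<^sup>2) * m \<le> 8 * n ^ 3"
      using m by (simp only: mult_le_cancel_right)
    then show ?thesis by (simp add: m_def)
  qed
  have close3: "real q * \<bar>conv3 X (x + (\<psi> u - \<psi> u')) - conv3 X x\<bar> \<le> real (card X) ^ 2"
    if u: "u \<in> V ys" "u' \<in> V ys" for u u' x
  proof -
    define \<delta> where "\<delta> y = conv2 X (x + y + (\<psi> u - \<psi> u')) - conv2 X (x + y)" for y
    have "conv3 X (x + (\<psi> u - \<psi> u')) - conv3 X x = (\<Sum>y\<in>X. \<delta> y)"
      by (simp add: conv3_def \<delta>_def sum_subtractf add_ac algebra_simps)
    then have "(conv3 X (x + (\<psi> u - \<psi> u')) - conv3 X x)\<^sup>2 \<le> (\<Sum>y\<in>X. (\<delta> y)\<^sup>2) * n"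
      using sum_squared_le_sum_of_squares[of \<delta> X] by (simp add: n_def)
    then have "(conv3 X (x + (\<psi> u - \<psi> u')) - conv3 X x)\<^sup>2 * (real q)\<^sup>2 \<le> (\<Sum>y\<in>X. (\<delta> y)\<^sup>2) * n * (real q)\<^sup>2"
      by (rule mult_right_mono) simp
    also have "\<dots> = ((\<Sum>z\<in>(\<lambda>y. x + y) ` X. (conv2 X (z + (\<psi> u - \<psi> u')) - conv2 X z)\<^sup>2) * (real q)\<^sup>2) * n"
      by (subst sum.reindex) (auto simp: inj_on_def \<delta>_def mult_ac)
    also have "\<dots> \<le> n ^ 3 * n"
      using close2[OF u, of "(\<lambda>y. x + y) ` X"] fin n0 by (intro mult_right_mono) auto
    finally have "(real q * \<bar>conv3 X (x + (\<psi> u - \<psi> u')) - conv3 X x\<bar>)\<^sup>2 \<le> (n\<^sup>2)\<^sup>2"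
      by (simp add: power_mult_distrib power2_eq_square power3_eq_cube mult_ac)
    then show ?thesis unfolding n_def[symmetric] by (rule power2_le_imp_le) simp
  qed
  show ?thesis using that[of "V ys"] cV close3 by (auto simp: V_def m_def)
qed

section \<open>Long progressions of translates\<close>

lemma pigeonhole_fibre:
  assumes "finite U" "f ` U \<subseteq> F" "finite F" "card F \<le> c"
  obtains y where "card U \<le> c * card {u \<in> U. f u = y}"
proof (cases "U = {}")
  case False
  then have "F \<noteq> {}" using assms by auto
  have "card U = (\<Sum>y\<in>F. card {u \<in> U. f u = y})"
    using sum.group[of U F f "\<lambda>_. 1 :: nat"] assms by simp
  have "\<exists>y\<in>F. card U \<le> card F * card {u \<in> U. f u = y}"
  proof (rule ccontr)
    assume "\<not> ?thesis"
    then have "(\<Sum>y\<in>F. card F * card {u \<in> U. f u = y}) < (\<Sum>y\<in>F. card U)"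
      using assms \<open>F \<noteq> {}\<close> by (intro sum_strict_mono) (auto simp: not_le)
    then show False using \<open>card U = _\<close> by (simp flip: sum_distrib_left)
  qed
  then obtain y where y: "card U \<le> card F * card {u \<in> U. f u = y}" by blast
  also have "\<dots> \<le> c * card {u \<in> U. f u = y}" using assms by simp
  finally show ?thesis by (rule that)
qed (use that in simp)

lemma add_diff_subset_three_minus_two:
  fixes X :: "'a::ab_group_add set"
  shows "X + (X + uminus ` X) \<subseteq> three_minus_two X"
proof
  fix w assume "w \<in> X + (X + uminus ` X)"
  then obtain x y z where xyz: "x \<in> X" "y \<in> X" "z \<in> X" "w = x + (y + - z)" by (auto elim!: set_plus_elim)
  then have w: "w = x + y + x + - (z + x)" by (simp add: algebra_simps)
  show "w \<in> three_minus_two X" unfolding w three_minus_two_def using xyz by (intro set_plus_intro imageI)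
qed

lemma card_add_self_le_three_minus_two:
  fixes X :: "'a::ab_group_add set"
  assumes "finite X"
  shows "card (X + X) \<le> card (three_minus_two X)"
proof (cases "X = {}")
  case False
  then obtain x where x: "x \<in> X" by blast
  have "(\<lambda>z. z + - x) ` (X + X) \<subseteq> three_minus_two X"
  proof (clarify elim!: set_plus_elim)
    fix a b assume ab: "a \<in> X" "b \<in> X"
    have w: "a + b + - x = a + b + x + - (x + x)" by (simp add: algebra_simps)
    show "a + b + - x \<in> three_minus_two X" unfolding w three_minus_two_def using ab x by (intro set_plus_intro imageI)
  qed
  then show ?thesis by (intro card_inj_on_le[of "\<lambda>z. z + - x"]) (auto simp: finite_three_minus_two assms inj_on_def)
qed simp

text \<open>For many pairs \<open>u, u'\<close> the multiples \<open>2\<^sup>l (u - u')\<close>, \<open>l < i\<close>, are all almost periods. The map \<open>\<psi>\<close>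
  keeps representatives of \<open>2\<^sup>i u\<close> inside \<open>X - X\<close> modulo a common shift: doubling leaves \<open>X - X\<close>, but
  \<open>2 (X - X)\<close> is covered by \<open>K\<close> translates of \<open>X - X\<close>, and a pigeonhole step makes all surviving \<open>u\<close> use
  the same translate. Each step thus costs one constant factor for the translate and one for the
  almost periods.\<close>

lemma dyadic_chain:
  fixes X :: "int set"
  assumes fin: "finite X" and ne: "X \<noteq> {}" and K: "card (three_minus_two X) \<le> K * card X" and q: "q > 0"
  shows "\<exists>U \<psi>. U \<subseteq> X \<and> \<psi> ` U \<subseteq> X + uminus ` X \<and> card X \<le> card U * (2 * K ^ (8 * q\<^sup>2) * K) ^ i \<and>
    (\<forall>u\<in>U. \<forall>u'\<in>U. \<psi> u - \<psi> u' = 2 ^ i * (u - u')) \<and>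
    (\<forall>l<i. \<forall>u\<in>U. \<forall>u'\<in>U. \<forall>x.
        real q * \<bar>conv3 X (x + 2 ^ l * (u - u')) - conv3 X x\<bar> \<le> real (card X) ^ 2)"
proof (induction i)
  case 0
  obtain x0 where x0: "x0 \<in> X" using ne by blast
  then have "u + - x0 \<in> X + uminus ` X" if "u \<in> X" for u
    using that by (intro set_plus_intro imageI)
  then show ?case by (intro exI[of _ X] exI[of _ "\<lambda>u. u + - x0"]) auto
next
  case (Suc i)
  let ?D = "X + uminus ` X"
  from Suc obtain U \<psi> where U: "U \<subseteq> X" "\<psi> ` U \<subseteq> ?D" "card X \<le> card U * (2 * K ^ (8 * q\<^sup>2) * K) ^ i"
    and \<psi>: "\<And>u u'. u \<in> U \<Longrightarrow> u' \<in> U \<Longrightarrow> \<psi> u - \<psi> u' = 2 ^ i * (u - u')"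
    and per: "\<And>l u u' x. l < i \<Longrightarrow> u \<in> U \<Longrightarrow> u' \<in> U \<Longrightarrow>
        real q * \<bar>conv3 X (x + 2 ^ l * (u - u')) - conv3 X x\<bar> \<le> real (card X) ^ 2"
    by metis
  have finU: "finite U" using U(1) fin by (rule finite_subset)
  have "card (X + ?D) \<le> K * card X"
    using card_mono[OF finite_three_minus_two[OF fin] add_diff_subset_three_minus_two] K by (rule order_trans)
  then obtain U1 where U1: "U1 \<subseteq> U" "card U \<le> 2 * K ^ (8 * q\<^sup>2) * card U1"
    and per1: "\<And>u u' x. u \<in> U1 \<Longrightarrow> u' \<in> U1 \<Longrightarrow>
       real q * \<bar>conv3 X (x + (\<psi> u - \<psi> u')) - conv3 X x\<bar> \<le> real (card X) ^ 2"
    using almost_periods[OF fin ne _ q finU U(2)] by metis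
  (* the covering lemma for 2 (X - X) needs exactly the bound on 3X - 2X *)
  have "?D + ?D + X = three_minus_two X" by (simp add: three_minus_two_def image_uminus_set_plus ac_simps)
  then have "card (?D + ?D + X) \<le> K * card X" using K by simp
  then obtain F where F: "F \<subseteq> ?D + ?D" "card F \<le> K" "?D + ?D \<subseteq> F + ?D"
    using ruzsa_covering[of "?D + ?D" X K] fin ne by (metis finite_imageI finite_set_plus)
  have finF: "finite F" using F(1) fin by (meson finite_imageI finite_set_plus finite_subset)
  have "\<forall>d\<in>?D + ?D. \<exists>f. f \<in> F \<and> d - f \<in> ?D"
  proof
    fix d assume "d \<in> ?D + ?D"
    then have "d \<in> F + ?D" using F(3) by blast
    then obtain f e where "f \<in> F" "e \<in> ?D" "d = f + e" by (rule set_plus_elim)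
    then show "\<exists>f. f \<in> F \<and> d - f \<in> ?D" by (intro exI[of _ f]) simp
  qed
  then obtain f where f: "\<And>d. d \<in> ?D + ?D \<Longrightarrow> f d \<in> F \<and> d - f d \<in> ?D" by metis
  have dbl: "2 * \<psi> u \<in> ?D + ?D" if "u \<in> U1" for u
  proof -
    have "\<psi> u \<in> ?D" using that U(2) U1(1) by blast
    then have "\<psi> u + \<psi> u \<in> ?D + ?D" by (intro set_plus_intro)
    then show ?thesis by simp
  qed
  have "finite U1" using U1(1) finU by (rule finite_subset)
  moreover have "(\<lambda>u. f (2 * \<psi> u)) ` U1 \<subseteq> F" using f[OF dbl] by blast
  ultimately obtain y where y: "card U1 \<le> K * card {u \<in> U1. f (2 * \<psi> u) = y}"
    using finF F(2) by (rule pigeonhole_fibre)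
  define U2 where "U2 = {u \<in> U1. f (2 * \<psi> u) = y}"
  have "card X \<le> card U * (2 * K ^ (8 * q\<^sup>2) * K) ^ i" by fact
  also have "\<dots> \<le> (2 * K ^ (8 * q\<^sup>2) * (K * card U2)) * (2 * K ^ (8 * q\<^sup>2) * K) ^ i"
    using U1(2) y by (intro mult_right_mono order_trans[OF U1(2)] mult_left_mono) (auto simp: U2_def)
  also have "\<dots> = card U2 * (2 * K ^ (8 * q\<^sup>2) * K) ^ Suc i" by (simp only: power_Suc mult_ac)
  finally have c: "card X \<le> card U2 * (2 * K ^ (8 * q\<^sup>2) * K) ^ Suc i" .
  show ?case
  proof (intro exI[of _ U2] exI[of _ "\<lambda>u. 2 * \<psi> u - y"] conjI ballI allI impI)
    show "U2 \<subseteq> X" using U(1) U1(1) by (auto simp: U2_def)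
    show "(\<lambda>u. 2 * \<psi> u - y) ` U2 \<subseteq> ?D" using f[OF dbl] by (auto simp: U2_def)
    show "card X \<le> card U2 * (2 * K ^ (8 * q\<^sup>2) * K) ^ Suc i" by (fact c)
    fix u u' assume u: "u \<in> U2" "u' \<in> U2"
    then have uU: "u \<in> U" "u' \<in> U" "u \<in> U1" "u' \<in> U1" using U1(1) by (auto simp: U2_def)
    show "(2 * \<psi> u - y) - (2 * \<psi> u' - y) = 2 ^ Suc i * (u - u')"
      using \<psi>[OF uU(1,2)] by simp
    fix l x assume "l < Suc i"
    then consider "l < i" | "l = i" by linarith
    then show "real q * \<bar>conv3 X (x + 2 ^ l * (u - u')) - conv3 X x\<bar> \<le> real (card X) ^ 2"
    proof cases
      case 1
      then show ?thesis using per uU by blast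
    next
      case 2
      then show ?thesis using per1[OF uU(3,4), of x] \<psi>[OF uU(1,2)] by simp
    qed
  qed
qed

lemma conv2_le: "finite X \<Longrightarrow> conv2 X z \<le> real (card X)"
  unfolding conv2_def by (intro of_nat_mono card_mono) auto

lemma conv2_nonneg: "0 \<le> conv2 X z"
  by (simp add: conv2_def)

lemma sum_conv2_le:
  assumes "finite X" "finite Z"
  shows "(\<Sum>z\<in>Z. conv2 X z) \<le> real (card X) ^ 2"
proof -
  have "(\<Sum>z\<in>Z. conv2 X z) = (\<Sum>z\<in>Z \<inter> (X + X). conv2 X z)"
    by (rule sum.mono_neutral_right) (use assms conv2_eq_0 in auto)
  also have "\<dots> \<le> (\<Sum>z\<in>X + X. conv2 X z)"
    by (rule sum_mono2) (use assms conv2_nonneg in \<open>auto simp: finite_set_plus\<close>)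
  finally show ?thesis using sum_conv2[OF assms(1)] by simp
qed

lemma sum_conv3_le:
  assumes "finite X" "finite Z"
  shows "(\<Sum>z\<in>Z. conv3 X z) \<le> real (card X) ^ 3"
proof -
  have "(\<Sum>z\<in>Z. conv3 X z) = (\<Sum>y\<in>X. \<Sum>z\<in>Z. conv2 X (z + y))"
    unfolding conv3_def by (rule sum.swap)
  also have "\<dots> = (\<Sum>y\<in>X. \<Sum>z\<in>(\<lambda>z. z + y) ` Z. conv2 X z)"
    by (simp add: sum.reindex inj_on_def)
  also have "\<dots> \<le> (\<Sum>y\<in>X. real (card X) ^ 2)"
    using assms by (intro sum_mono sum_conv2_le) auto
  finally show ?thesis by (simp add: power2_eq_square power3_eq_cube)
qed

text \<open>A number \<open>t < 2\<^sup>k\<close> is a sum of at most \<open>k\<close> powers of two, so \<open>t g\<close> is an almost period with \<open>k\<close> times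
  the error. With error \<open>|X|\<^sup>2 / (4 K k)\<close> per step, a point where \<open>1\<^sub>X * 1\<^sub>X * 1\<^sub>-\<^sub>X\<close> is at least
  \<open>|X|\<^sup>2 / (2 K)\<close> is moved to points where it is at least half as large. Small doubling provides
  many points of the first kind in \<open>X\<close>, and the total mass \<open>|X|\<^sup>3\<close> allows few of the second kind. The
  bound on \<open>P\<close> does not depend on \<open>k\<close>, that is, on the length of the progressions; merely covering multiples
  of \<open>g\<close> by sumsets of \<open>X\<close> would lose a factor that grows with it.\<close>

lemma structured_set_contains_translates:
  fixes X :: "int set"
  assumes fin: "finite X" and ne: "X \<noteq> {}" and K: "card (three_minus_two X) \<le> K * card X" and k: "k > 0"
    and big: "(2 * K ^ (8 * (4 * K * k)\<^sup>2) * K) ^ k < card X"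
  obtains Y P g where "Y \<subseteq> X" "card X \<le> 2 * K * card Y"
    "g \<noteq> 0" "g \<in> X + uminus ` X" "finite P" "card P \<le> 4 * K * card X"
    "\<And>x t. x \<in> Y \<Longrightarrow> t < 2 ^ k \<Longrightarrow> x + int t * g \<in> P"
proof -
  define n where "n = real (card X)"
  have n0: "n > 0" using fin ne by (simp add: n_def card_gt_0_iff)
  have K0: "K > 0"
  proof (rule ccontr)
    assume "\<not> ?thesis"
    then have "card (X + X) = 0" using K card_add_self_le_three_minus_two[OF fin] by simp
    then show False using fin ne by (auto simp: finite_set_plus set_plus_def)
  qed
  define q where "q = 4 * K * k"
  have q: "q > 0" using K0 k by (simp add: q_def)
  obtain U where U: "U \<subseteq> X" "card X \<le> card U * (2 * K ^ (8 * q\<^sup>2) * K) ^ k"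
    and per: "\<And>l u u' x. l < k \<Longrightarrow> u \<in> U \<Longrightarrow> u' \<in> U \<Longrightarrow>
        real q * \<bar>conv3 X (x + 2 ^ l * (u - u')) - conv3 X x\<bar> \<le> real (card X) ^ 2"
    using dyadic_chain[OF fin ne K q, of k] by metis
  have "card U > 1"
  proof (rule ccontr)
    assume "\<not> ?thesis"
    then have "card U * (2 * K ^ (8 * q\<^sup>2) * K) ^ k \<le> 1 * (2 * K ^ (8 * q\<^sup>2) * K) ^ k"
      by (intro mult_right_mono) auto
    then show False using U(2) big unfolding q_def by linarith
  qed
  then obtain u u' where u: "u \<in> U" "u' \<in> U" "u \<noteq> u'"
    by (metis One_nat_def card_le_Suc0_iff_eq card.infinite not_less zero_le)
  define g where "g = u - u'"
  have g: "g \<noteq> 0" "g \<in> X + uminus ` X"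
  proof -
    have "u + - u' \<in> X + uminus ` X" using u U(1) by (intro set_plus_intro imageI) auto
    then show "g \<in> X + uminus ` X" by (simp add: g_def)
  qed (use u in \<open>simp add: g_def\<close>)
  have per': "real q * \<bar>conv3 X (x + int t * g) - conv3 X x\<bar> \<le> j * n\<^sup>2" if "j \<le> k" "t < 2 ^ j" for j t x
    using that
  proof (induction j arbitrary: t x)
    case (Suc j)
    show ?case
    proof (cases "t < 2 ^ j")
      case True
      then have "real q * \<bar>conv3 X (x + int t * g) - conv3 X x\<bar> \<le> j * n\<^sup>2" using Suc by simp
      also have "\<dots> \<le> Suc j * n\<^sup>2" by (intro mult_right_mono) auto
      finally show ?thesis .
    next
      case False
      define t' where "t' = t - 2 ^ j"
      have t: "int t = int t' + 2 ^ j" "t' < 2 ^ j" using False Suc.prems by (auto simp: t'_def of_nat_diff)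
      have 1: "real q * \<bar>conv3 X (x + 2 ^ j * g + int t' * g) - conv3 X (x + 2 ^ j * g)\<bar> \<le> j * n\<^sup>2"
        using Suc t by simp
      have 2: "real q * \<bar>conv3 X (x + 2 ^ j * g) - conv3 X x\<bar> \<le> n\<^sup>2"
        using per[of j u u' x] u Suc.prems by (simp add: g_def n_def)
      have eq: "x + int t * g = x + 2 ^ j * g + int t' * g" using t by (simp add: algebra_simps)
      have "real q * \<bar>conv3 X (x + int t * g) - conv3 X x\<bar>
          \<le> real q * (\<bar>conv3 X (x + 2 ^ j * g + int t' * g) - conv3 X (x + 2 ^ j * g)\<bar> + \<bar>conv3 X (x + 2 ^ j * g) - conv3 X x\<bar>)"
        unfolding eq by (intro mult_left_mono) auto
      also have "\<dots> \<le> j * n\<^sup>2 + n\<^sup>2" using 1 2 by (simp add: distrib_left)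
      finally show ?thesis by (simp add: algebra_simps)
    qed
  qed simp
  define Y where "Y = {x \<in> X. conv3 X x \<ge> n\<^sup>2 / (2 * K)}"
  have YX: "Y \<subseteq> X" by (auto simp: Y_def)
  have cY: "card X \<le> 2 * K * card Y"
  proof -
    have "(n\<^sup>2)\<^sup>2 \<le> (\<Sum>z\<in>X + X. (conv2 X z)\<^sup>2) * card (X + X)"
      using sum_squared_le_sum_of_squares[of "conv2 X" "X + X"] sum_conv2[OF fin] by (simp add: n_def)
    also have "\<dots> \<le> (\<Sum>z\<in>X + X. (conv2 X z)\<^sup>2) * (K * n)"
    proof (rule mult_left_mono)
      have "card (X + X) \<le> K * card X" using card_add_self_le_three_minus_two[OF fin] K by (rule order_trans)
      then show "real (card (X + X)) \<le> K * n" by (simp add: n_def flip: of_nat_mult)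
    qed (simp add: sum_nonneg)
    also have "(\<Sum>z\<in>X + X. (conv2 X z)\<^sup>2) = (\<Sum>x\<in>X. conv3 X x)" using sum_conv3_eq[OF fin] by simp
    finally have "n ^ 3 * n \<le> ((\<Sum>x\<in>X. conv3 X x) * K) * n" by (simp add: power2_eq_square power3_eq_cube mult_ac)
    then have 1: "n ^ 3 \<le> (\<Sum>x\<in>X. conv3 X x) * K" using n0 by simp
    have "conv3 X x \<le> n\<^sup>2" for x
    proof -
      have "conv3 X x \<le> (\<Sum>y\<in>X. n)" unfolding conv3_def n_def by (rule sum_mono) (rule conv2_le[OF fin])
      then show ?thesis by (simp add: n_def power2_eq_square)
    qed
    then have "(\<Sum>x\<in>X. conv3 X x) \<le> (\<Sum>x\<in>X. n\<^sup>2 / (2 * K) + (if x \<in> Y then n\<^sup>2 else 0))"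
      by (intro sum_mono) (auto simp: Y_def not_le less_imp_le intro: add_increasing)
    also have "\<dots> = n * (n\<^sup>2 / (2 * K)) + card Y * n\<^sup>2"
      using fin YX by (simp add: sum.distrib n_def sum.If_cases Int_absorb1)
    finally have "(\<Sum>x\<in>X. conv3 X x) * K \<le> (n * (n\<^sup>2 / (2 * K)) + card Y * n\<^sup>2) * K"
      by (rule mult_right_mono) simp
    also have "\<dots> = n ^ 3 / 2 + card Y * n\<^sup>2 * K"
      using K0 by (simp add: field_simps power2_eq_square power3_eq_cube)
    finally have "n ^ 3 / 2 \<le> card Y * n\<^sup>2 * K" using 1 by linarith
    then have "n * n\<^sup>2 \<le> (2 * K * card Y) * n\<^sup>2" by (simp add: power2_eq_square power3_eq_cube mult_ac)
    then have "n \<le> 2 * K * card Y" using n0 by (simp only: mult_le_cancel_right) auto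
    then show ?thesis unfolding n_def by (simp flip: of_nat_mult)
  qed
  define P where "P = {z. conv3 X z \<ge> n\<^sup>2 / (4 * K)}"
  have thr: "n\<^sup>2 / (4 * K) > 0" using n0 K0 by simp
  have supp: "P \<subseteq> X + X + uminus ` X"
  proof
    fix z assume "z \<in> P"
    then have "conv3 X z \<noteq> 0" using thr by (auto simp: P_def)
    then obtain y where "y \<in> X" "conv2 X (z + y) \<noteq> 0" unfolding conv3_def by (meson sum.neutral)
    moreover from this have "z + y \<in> X + X" using conv2_eq_0 by blast
    ultimately have "(z + y) + - y \<in> X + X + uminus ` X"
      by (intro set_plus_intro[of "z + y"] imageI)
    then show "z \<in> X + X + uminus ` X" by simp
  qed
  have finP: "finite P" by (rule finite_subset[OF supp]) (simp add: finite_set_plus fin)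
  have "card P \<le> 4 * K * card X"
  proof -
    have "card P * (n\<^sup>2 / (4 * K)) \<le> (\<Sum>z\<in>P. conv3 X z)"
      by (rule order_trans[OF _ sum_mono[of _ "\<lambda>_. n\<^sup>2 / (4 * K)"]]) (auto simp: P_def)
    also have "\<dots> \<le> n ^ 3" using sum_conv3_le[OF fin finP] by (simp add: n_def)
    finally have "card P * n\<^sup>2 \<le> n ^ 3 * (4 * K)" using K0 by (simp add: field_simps)
    also have "\<dots> = (4 * K * n) * n\<^sup>2" by (simp add: power2_eq_square power3_eq_cube mult_ac)
    finally have "card P \<le> 4 * K * n" using n0 by (simp only: mult_le_cancel_right) auto
    then show ?thesis unfolding n_def by (simp flip: of_nat_mult)
  qed
  moreover have "x + int t * g \<in> P" if "x \<in> Y" "t < 2 ^ k" for x t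
  proof -
    have "(4 * K * \<bar>conv3 X (x + int t * g) - conv3 X x\<bar>) * k \<le> n\<^sup>2 * k"
      using per'[of k t x] that by (simp add: q_def mult_ac)
    then have "4 * K * \<bar>conv3 X (x + int t * g) - conv3 X x\<bar> \<le> n\<^sup>2"
      using k by (simp only: mult_le_cancel_right)
    then have "\<bar>conv3 X (x + int t * g) - conv3 X x\<bar> \<le> n\<^sup>2 / (4 * K)" using K0 by (simp add: field_simps)
    moreover have "conv3 X x \<ge> n\<^sup>2 / (4 * K) + n\<^sup>2 / (4 * K)"
      using that K0 by (simp add: Y_def field_simps)
    ultimately show ?thesis unfolding P_def by (simp add: abs_le_iff)
  qed
  ultimately show ?thesis using that[OF YX cY g finP] by blast
qed

section \<open>Prime divisors on progressions and on structured sets\<close>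

lemma card_residue_class:
  fixes q M r :: nat
  assumes "r < q"
  shows "\<bar>real (card {t. t < M \<and> t mod q = r}) - real M / real q\<bar> \<le> 1"
proof -
  have q: "q > 0" using assms by simp
  define n where "n = (M + q - 1 - r) div q"
  have "bij_betw (\<lambda>j. j * q + r) {..<n} {t. t < M \<and> t mod q = r}"
  proof (rule bij_betw_byWitness[where f' = "\<lambda>t. t div q"])
    have less: "j * q + r < M \<longleftrightarrow> j < n" for j
    proof -
      have "j < n \<longleftrightarrow> Suc j \<le> n" by auto
      also have "\<dots> \<longleftrightarrow> Suc j * q \<le> M + q - 1 - r"
        unfolding n_def using q by (simp add: less_eq_div_iff_mult_less_eq)
      also have "\<dots> \<longleftrightarrow> j * q + r < M" using assms by auto
      finally show ?thesis by simp
    qed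
    show "(\<lambda>j. j * q + r) ` {..<n} \<subseteq> {t. t < M \<and> t mod q = r}"
    proof (rule image_subsetI, rule CollectI)
      fix j assume "j \<in> {..<n}"
      then show "j * q + r < M \<and> (j * q + r) mod q = r" using less[of j] assms by simp
    qed
    show "(\<lambda>t. t div q) ` {t. t < M \<and> t mod q = r} \<subseteq> {..<n}"
    proof (rule image_subsetI)
      fix t assume "t \<in> {t. t < M \<and> t mod q = r}"
      then have "(t div q) * q + r < M" by auto
      then show "t div q \<in> {..<n}" using less[of "t div q"] by simp
    qed
  qed (use assms q in auto)
  then have "card {..<n} = card {t. t < M \<and> t mod q = r}" by (rule bij_betw_same_card)
  then have c: "card {t. t < M \<and> t mod q = r} = n" by simp
  have "n * q \<le> M + q - 1 - r" unfolding n_def by simp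
  then have 1: "real n * q \<le> M + q" using assms by (simp flip: of_nat_mult of_nat_add)
  have "M + q - 1 - r < (n + 1) * q" unfolding n_def
    using dividend_less_div_times[OF q, of "M + q - 1 - r"] by simp
  then have "M < (n + 1) * q" using assms by linarith
  then have "real M < real ((n + 1) * q)" by (simp only: of_nat_less_iff)
  then have 2: "real M < (real n + 1) * q" by (simp add: algebra_simps)
  show ?thesis unfolding c using 1 2 q by (simp add: abs_le_iff field_simps)
qed

text \<open>Since \<open>g\<close> is invertible modulo \<open>q\<close>, the divisibility condition fixes \<open>t\<close> modulo \<open>q\<close>.\<close>

lemma card_dvd_progression:
  fixes y g :: int and q M :: nat
  assumes q: "q > 0" and cop: "coprime (int q) g"
  shows "\<bar>real (card {t. t < M \<and> int q dvd y + int t * g}) - real M / real q\<bar> \<le> 1"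
proof -
  obtain x where x: "[g * x = 1] (mod int q)"
    using cong_solve_coprime_int[of g "int q"] cop by (auto simp: coprime_commute)
  define r where "r = nat ((- y * x) mod int q)"
  have r: "r < q" "int r = (- y * x) mod int q" using q by (auto simp: r_def nat_less_iff)
  have iff: "int q dvd y + int t * g \<longleftrightarrow> t mod q = r" for t
  proof -
    have "[int r * g = - y * (g * x)] (mod int q)"
      unfolding r(2) by (simp add: cong_def mod_mult_right_eq mult_ac)
    also have "[- y * (g * x) = - y * 1] (mod int q)" by (rule cong_scalar_left[OF x])
    finally have "[int r * g = - y] (mod int q)" by simp
    then have d: "int q dvd y + int r * g" by (simp add: cong_iff_dvd_diff add.commute)
    have "int q dvd y + int t * g \<longleftrightarrow> int q dvd (y + int t * g) - (y + int r * g)"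
      using dvd_add_left_iff[OF d, of "(y + int t * g) - (y + int r * g)"]
      by (simp only: diff_add_cancel)
    also have "(y + int t * g) - (y + int r * g) = (int t - int r) * g" by (simp add: algebra_simps)
    also have "int q dvd (int t - int r) * g \<longleftrightarrow> int q dvd int t - int r"
      using cop by (simp add: coprime_dvd_mult_left_iff)
    also have "\<dots> \<longleftrightarrow> int t mod int q = int r mod int q" by (simp add: mod_eq_dvd_iff)
    also have "\<dots> \<longleftrightarrow> t mod q = r" using r(1) by (simp flip: of_nat_mod)
    finally show ?thesis .
  qed
  show ?thesis unfolding iff by (rule card_residue_class[OF r(1)])
qed

text \<open>The number of prime divisors, counted in \<open>S\<close> only, and its expected value on a random integer.\<close>

definition omega :: "nat set \<Rightarrow> int \<Rightarrow> real" where
  "omega S x = real (card {p \<in> S. int p dvd x})"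

definition recip_sum :: "nat set \<Rightarrow> real" where
  "recip_sum S = (\<Sum>p\<in>S. 1 / real p)"

text \<open>The Turan--Kubilius inequality: divisibility by distinct primes is nearly independent along the
  progression, so the variance is at most the mean up to rounding errors; there are at most
  \<open>3 |S|\<^sup>2\<close> of those, which the hypothesis on \<open>M\<close> absorbs.\<close>

lemma turan_kubilius_progression:
  fixes y g :: int
  assumes fin: "finite S" and prime: "\<And>p. p \<in> S \<Longrightarrow> prime p"
    and g: "\<And>p. p \<in> S \<Longrightarrow> \<not> int p dvd g" and M: "3 * (card S)\<^sup>2 \<le> M"
  shows "(\<Sum>t<M. (omega S (y + int t * g) - recip_sum S)\<^sup>2) \<le> M * (recip_sum S + 1)"
proof -
  define s where "s = real (card S)"
  define L where "L = recip_sum S"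
  define D where "D p t \<longleftrightarrow> int p dvd y + int t * g" for p t
  have p1: "real p \<ge> 1" if "p \<in> S" for p using prime_gt_0_nat[OF prime[OF that]] by simp
  have L: "0 \<le> L" "L \<le> s"
  proof -
    show "0 \<le> L" unfolding L_def recip_sum_def by (simp add: sum_nonneg)
    have "L \<le> (\<Sum>p\<in>S. 1)" unfolding L_def recip_sum_def using p1 by (intro sum_mono) (auto simp: divide_le_eq_1)
    then show "L \<le> s" by (simp add: s_def)
  qed
  have om: "omega S (y + int t * g) = (\<Sum>p\<in>S. of_bool (D p t))" for t
    using fin by (simp add: omega_def D_def of_bool_def sum.If_cases Int_def)
  have cop: "coprime (int p) g" if "p \<in> S" for p
    using prime_imp_coprime[of "int p" g] prime[OF that] g[OF that] by simp
  have count1: "\<bar>(\<Sum>t<M. of_bool (D p t)) - M / real p\<bar> \<le> 1" if "p \<in> S" for p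
    using card_dvd_progression[OF _ cop[OF that], of M y] prime_gt_0_nat[OF prime[OF that]]
    by (simp add: D_def of_bool_def sum.If_cases lessThan_def Int_def)
  have count2: "(\<Sum>t<M. of_bool (D p t) * of_bool (D r t)) \<le> M / (real p * real r) + 1 + (if p = r then M / real p else 0)"
    if pr: "p \<in> S" "r \<in> S" for p r
  proof (cases "p = r")
    case True
    then have "(\<Sum>t<M. of_bool (D p t) * of_bool (D r t) :: real) = (\<Sum>t<M. of_bool (D p t))"
      by (auto simp: of_bool_def intro!: sum.cong)
    also have "\<dots> \<le> M / real p + 1" using count1[OF pr(1)] by (simp add: abs_le_iff)
    finally have "(\<Sum>t<M. of_bool (D p t) * of_bool (D r t) :: real) \<le> M / real p + 1" .
    moreover have "(if p = r then M / real p else 0) = M / real p" using True by simp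
    moreover have "0 \<le> M / (real p * real r)" by simp
    ultimately show ?thesis by linarith
  next
    case False
    have "coprime p r" using False pr prime by (simp add: primes_coprime)
    then have c: "coprime (int p) (int r)" by simp
    have "of_bool (D p t) * of_bool (D r t) = (of_bool (int (p * r) dvd y + int t * g) :: real)" for t
      using divides_mult[OF _ _ c, of "y + int t * g"] by (auto simp: D_def of_bool_def intro: dvd_mult_left dvd_mult_right)
    moreover have "coprime (int (p * r)) g" using cop pr by simp
    moreover have "p * r > 0" using prime_gt_0_nat[OF prime] pr by simp
    ultimately show ?thesis
      using card_dvd_progression[of "p * r" g M y] False
      by (simp add: of_bool_def sum.If_cases lessThan_def Int_def abs_le_iff)
  qed
  have lin: "(\<Sum>t<M. omega S (y + int t * g)) \<ge> M * L - s"
  proof -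
    have "(\<Sum>t<M. omega S (y + int t * g)) = (\<Sum>p\<in>S. \<Sum>t<M. of_bool (D p t))"
      unfolding om by (rule sum.swap)
    also have "\<dots> \<ge> (\<Sum>p\<in>S. M / real p - 1)" 
    proof (rule sum_mono)
      fix p assume "p \<in> S"
      then show "M / real p - 1 \<le> (\<Sum>t<M. of_bool (D p t))" using count1[of p] by linarith
    qed
    also have "(\<Sum>p\<in>S. M / real p - 1) = M * L - s"
      by (simp add: sum_subtractf L_def recip_sum_def s_def sum_distrib_left)
    finally show ?thesis .
  qed
  have quad: "(\<Sum>t<M. (omega S (y + int t * g))\<^sup>2) \<le> M * L\<^sup>2 + s\<^sup>2 + M * L"
  proof -
    have "(\<Sum>t<M. (omega S (y + int t * g))\<^sup>2) = (\<Sum>t<M. \<Sum>p\<in>S. \<Sum>r\<in>S. of_bool (D p t) * of_bool (D r t))"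
      unfolding om by (simp add: power2_eq_square sum_product)
    also have "\<dots> = (\<Sum>p\<in>S. \<Sum>r\<in>S. \<Sum>t<M. of_bool (D p t) * of_bool (D r t))"
      by (subst sum.swap) (rule sum.cong[OF refl], rule sum.swap)
    also have "\<dots> \<le> (\<Sum>p\<in>S. \<Sum>r\<in>S. M / (real p * real r) + 1 + (if p = r then M / real p else 0))"
      by (intro sum_mono count2)
    also have "\<dots> = (\<Sum>p\<in>S. \<Sum>r\<in>S. M * ((1 / real p) * (1 / real r))) + s * s + (\<Sum>p\<in>S. M / real p)"
      using fin by (simp add: sum.distrib s_def)
    also have "(\<Sum>p\<in>S. \<Sum>r\<in>S. M * ((1 / real p) * (1 / real r))) = M * (L * L)"
      unfolding L_def recip_sum_def sum_product by (simp add: sum_distrib_left)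
    also have "(\<Sum>p\<in>S. M / real p) = M * L" by (simp add: L_def recip_sum_def sum_distrib_left)
    finally show ?thesis by (simp add: power2_eq_square)
  qed
  have "(\<Sum>t<M. (omega S (y + int t * g) - L)\<^sup>2)
      = (\<Sum>t<M. (omega S (y + int t * g))\<^sup>2) - 2 * L * (\<Sum>t<M. omega S (y + int t * g)) + M * L\<^sup>2"
    by (simp add: power2_diff sum.distrib sum_subtractf sum_distrib_left mult_ac)
  also have "\<dots> \<le> (M * L\<^sup>2 + s\<^sup>2 + M * L) - 2 * L * (M * L - s) + M * L\<^sup>2"
    using quad lin L by (intro add_mono diff_mono mult_left_mono) auto
  also have "\<dots> = M * L + s\<^sup>2 + 2 * (L * s)" by (simp add: power2_eq_square algebra_simps)
  also have "\<dots> \<le> M * L + 3 * s\<^sup>2"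
    using L mult_right_mono[of L s s] by (simp add: power2_eq_square)
  also have "3 * s\<^sup>2 \<le> M" unfolding s_def using M by (metis of_nat_le_iff of_nat_mult of_nat_numeral of_nat_power)
  finally show ?thesis by (simp add: L_def algebra_simps)
qed

text \<open>Each \<open>x \<in> Y\<close> is the term with index \<open>t\<close> of the progression with step \<open>-g\<close> that starts at \<open>x + t g \<in> P\<close>. Counting every
  \<open>x\<close> once for each \<open>t\<close> bounds the variance over \<open>Y\<close> by the average variance over the progressions
  that start in \<open>P\<close>.\<close>

theorem structured_set_concentration:
  fixes X :: "int set"
  assumes fin: "finite X" and ne: "X \<noteq> {}" and K: "card (three_minus_two X) \<le> K * card X" and k: "k > 0"
    and big: "(2 * K ^ (8 * (4 * K * k)\<^sup>2) * K) ^ k < card X"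
  obtains Y g where "Y \<subseteq> X" "card X \<le> 2 * K * card Y" "g \<noteq> 0" "g \<in> X + uminus ` X"
    "\<And>S. finite S \<Longrightarrow> (\<And>p. p \<in> S \<Longrightarrow> prime p) \<Longrightarrow> (\<And>p. p \<in> S \<Longrightarrow> \<not> int p dvd g) \<Longrightarrow>
       3 * (card S)\<^sup>2 \<le> 2 ^ k \<Longrightarrow>
       (\<Sum>x\<in>Y. (omega S x - recip_sum S)\<^sup>2) \<le> 4 * K * card X * (recip_sum S + 1)"
proof -
  obtain Y P g where Y: "Y \<subseteq> X" "card X \<le> 2 * K * card Y" "g \<noteq> 0" "g \<in> X + uminus ` X"
    and P: "finite P" "card P \<le> 4 * K * card X" "\<And>x t. x \<in> Y \<Longrightarrow> t < 2 ^ k \<Longrightarrow> x + int t * g \<in> P"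
    using structured_set_contains_translates[OF fin ne K k big] by metis
  have "(\<Sum>x\<in>Y. (omega S x - recip_sum S)\<^sup>2) \<le> 4 * K * card X * (recip_sum S + 1)"
    if S: "finite S" "\<And>p. p \<in> S \<Longrightarrow> prime p" "\<And>p. p \<in> S \<Longrightarrow> \<not> int p dvd g" "3 * (card S)\<^sup>2 \<le> 2 ^ k" for S
  proof -
    define M where "M = (2 :: nat) ^ k"
    define f where "f x = (omega S x - recip_sum S)\<^sup>2" for x
    have m0: "recip_sum S + 1 \<ge> 0" unfolding recip_sum_def by (simp add: sum_nonneg add_nonneg_nonneg)
    have "(\<Sum>x\<in>Y. f x) * M = (\<Sum>(x, t)\<in>Y \<times> {..<M}. f x)"
      by (simp add: sum_distrib_left mult.commute flip: sum.cartesian_product)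
    also have "\<dots> = (\<Sum>(y, t)\<in>(\<lambda>(x, t). (x + int t * g, t)) ` (Y \<times> {..<M}). f (y + int t * (- g)))"
      by (subst sum.reindex) (auto simp: inj_on_def case_prod_unfold)
    also have "\<dots> \<le> (\<Sum>(y, t)\<in>P \<times> {..<M}. f (y + int t * (- g)))"
      by (rule sum_mono2) (use P in \<open>auto simp: M_def f_def\<close>)
    also have "\<dots> = (\<Sum>y\<in>P. \<Sum>t<M. f (y + int t * (- g)))" by (simp add: sum.cartesian_product)
    also have "\<dots> \<le> (\<Sum>y\<in>P. M * (recip_sum S + 1))"
      unfolding f_def by (intro sum_mono turan_kubilius_progression) (use S in \<open>auto simp: M_def\<close>)
    also have "\<dots> = (card P * (recip_sum S + 1)) * M" by simp
    finally have "(\<Sum>x\<in>Y. f x) \<le> card P * (recip_sum S + 1)" by (simp add: M_def)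
    also have "\<dots> \<le> (4 * K * card X) * (recip_sum S + 1)"
      using P(2) m0 by (intro mult_right_mono) (auto simp flip: of_nat_mult)
    finally show ?thesis by (simp add: f_def)
  qed
  then show ?thesis using that[OF Y] by blast
qed

section \<open>Sums of reciprocals of primes\<close>

definition primes_upto :: "nat \<Rightarrow> nat set" where
  "primes_upto n = {p. prime p \<and> p \<le> n}"

definition mertens_sum :: "nat \<Rightarrow> real" where
  "mertens_sum n = (\<Sum>p\<in>primes_upto n. ln (real p) / real p)"

lemma finite_primes_upto [simp]: "finite (primes_upto n)"
  unfolding primes_upto_def by (rule finite_subset[of _ "{..n}"]) auto

lemma card_multiples:
  fixes d n :: nat
  assumes "d > 0"
  shows "card {m \<in> {1..n}. d dvd m} = n div d"
proof -
  have "bij_betw (\<lambda>k. k * d) {1..n div d} {m \<in> {1..n}. d dvd m}"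
  proof (rule bij_betw_byWitness[where f' = "\<lambda>m. m div d"])
    show "(\<lambda>k. k * d) ` {1..n div d} \<subseteq> {m \<in> {1..n}. d dvd m}"
    proof (rule image_subsetI)
      fix k assume "k \<in> {1..n div d}"
      then have "k * d \<le> n" "k \<ge> 1" using assms by (auto simp: less_eq_div_iff_mult_less_eq)
      then show "k * d \<in> {m \<in> {1..n}. d dvd m}" using assms by simp
    qed
    show "(\<lambda>m. m div d) ` {m \<in> {1..n}. d dvd m} \<subseteq> {1..n div d}"
    proof (rule image_subsetI)
      fix m assume "m \<in> {m \<in> {1..n}. d dvd m}"
      then have "m \<le> n" "d dvd m" "m > 0" by auto
      then have "d \<le> m" by (auto dest: dvd_imp_le)
      then have "1 \<le> m div d" using assms by (simp add: less_eq_div_iff_mult_less_eq)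
      moreover have "m div d \<le> n div d" using \<open>m \<le> n\<close> by (rule div_le_mono)
      ultimately show "m div d \<in> {1..n div d}" by simp
    qed
  qed (use assms in auto)
  then have "card {1..n div d} = card {m \<in> {1..n}. d dvd m}" by (rule bij_betw_same_card)
  then show ?thesis by simp
qed

text \<open>Legendre's formula for \<open>log n!\<close>.\<close>

lemma sum_ln_eq_sum_mangoldt:
  "(\<Sum>m\<in>{1..n}. ln (real m)) = (\<Sum>d\<in>{1..n}. mangoldt d * real (n div d))"
proof -
  have "ln (real m) = (\<Sum>d\<in>{1..n}. if d dvd m then mangoldt d else 0)" if "m \<in> {1..n}" for m
  proof -
    have "ln (real m) = (\<Sum>d | d dvd m. mangoldt d)" using mangoldt_sum[where 'a = real, of m] that by simp
    also have "\<dots> = (\<Sum>d\<in>{d \<in> {1..n}. d dvd m}. mangoldt d)"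
    proof (rule sum.cong)
      show "{d. d dvd m} = {d \<in> {1..n}. d dvd m}"
      proof (intro set_eqI iffI; clarsimp)
        fix d assume "d dvd m"
        then have "d \<le> m" "d > 0" using that by (auto intro: dvd_imp_le dvd_pos_nat)
        then show "Suc 0 \<le> d \<and> d \<le> n" using that by simp
      qed
    qed simp
    finally show ?thesis by (simp only: sum.inter_filter[OF finite_atLeastAtMost])
  qed
  then have "(\<Sum>m\<in>{1..n}. ln (real m)) = (\<Sum>m\<in>{1..n}. \<Sum>d\<in>{1..n}. if d dvd m then mangoldt d else 0)"
    by (rule sum.cong[OF refl])
  also have "\<dots> = (\<Sum>d\<in>{1..n}. \<Sum>m\<in>{1..n}. if d dvd m then mangoldt d else 0)" by (rule sum.swap)
  also have "\<dots> = (\<Sum>d\<in>{1..n}. mangoldt d * real (n div d))"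
  proof (rule sum.cong[OF refl])
    fix d assume "d \<in> {1..n}"
    then have "card {m \<in> {1..n}. d dvd m} = n div d" by (intro card_multiples) simp
    then show "(\<Sum>m\<in>{1..n}. if d dvd m then mangoldt d else 0) = mangoldt d * real (n div d)"
      by (simp only: sum.inter_filter[OF finite_atLeastAtMost, symmetric]) (simp add: mult.commute)
  qed
  finally show ?thesis .
qed

lemma sum_ln_le: "(\<Sum>m\<in>{1..n}. ln (real m)) \<le> n * ln (real n)"
proof -
  have "(\<Sum>m\<in>{1..n}. ln (real m)) \<le> (\<Sum>m\<in>{1..n}. ln (real n))" by (rule sum_mono) auto
  then show ?thesis by simp
qed

lemma sum_ln_ge: "n * ln (real n) - n \<le> (\<Sum>m\<in>{1..n}. ln (real m))"
proof (induction n)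
  case (Suc n)
  show ?case
  proof (cases "n = 0")
    case False
    have "ln (real (Suc n) / real n) \<le> real (Suc n) / real n - 1"
      by (rule ln_le_minus_one) (use False in simp)
    then have "n * (ln (real (Suc n)) - ln (real n)) \<le> n * (1 / real n)"
      using False by (intro mult_left_mono) (auto simp: ln_div field_simps)
    then have "n * ln (real (Suc n)) - n * ln (real n) \<le> 1" using False by (simp add: right_diff_distrib)
    moreover have "real (Suc n) * ln (real (Suc n)) = n * ln (real (Suc n)) + ln (real (Suc n))"
      by (simp add: algebra_simps)
    ultimately show ?thesis using Suc by simp
  qed simp
qed simp

text \<open>In Legendre's formula replace \<open>n div p\<close> by \<open>n / p - 1\<close>; bounding the number of primes up to \<open>n\<close> trivially by \<open>n\<close>
  costs a factor of two only.\<close>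

lemma mertens_sum_le:
  assumes "n \<ge> 1"
  shows "mertens_sum n \<le> 2 * ln (real n)"
proof -
  have n0: "real n > 0" using assms by simp
  have prime_pos: "real p \<ge> 1" if "p \<in> primes_upto n" for p
    using that prime_ge_1_nat by (auto simp: primes_upto_def)
  have "n * mertens_sum n - n * ln (real n) \<le> (\<Sum>p\<in>primes_upto n. n * (ln (real p) / real p)) - (\<Sum>p\<in>primes_upto n. ln (real p))"
  proof -
    have "card (primes_upto n) \<le> card {1..n}"
      by (rule card_mono) (auto simp: primes_upto_def dest: prime_ge_1_nat)
    then have "real (card (primes_upto n)) \<le> real n" by simp
    have "(\<Sum>p\<in>primes_upto n. ln (real p)) \<le> (\<Sum>p\<in>primes_upto n. ln (real n))"
    proof (rule sum_mono)
      fix p assume "p \<in> primes_upto n"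
      then show "ln (real p) \<le> ln (real n)" using prime_pos[of p] by (simp add: primes_upto_def)
    qed
    also have "\<dots> \<le> n * ln (real n)"
      using \<open>real (card (primes_upto n)) \<le> real n\<close> assms by (simp add: mult_right_mono)
    finally show ?thesis by (simp add: mertens_sum_def sum_distrib_left)
  qed
  also have "\<dots> = (\<Sum>p\<in>primes_upto n. ln (real p) * (n / real p - 1))"
    by (simp add: sum_subtractf right_diff_distrib mult_ac)
  also have "\<dots> \<le> (\<Sum>p\<in>primes_upto n. mangoldt p * real (n div p))"
  proof (rule sum_mono)
    fix p assume p: "p \<in> primes_upto n"
    have "real n = real (n div p) * real p + real (n mod p)" by (simp flip: of_nat_mult of_nat_add)
    also have "\<dots> \<le> (real (n div p) + 1) * real p"
      using prime_pos[OF p] by (simp add: algebra_simps less_imp_le)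
    finally have "n / real p - 1 \<le> real (n div p)" using prime_pos[OF p] by (simp add: field_simps)
    then have "ln (real p) * (n / real p - 1) \<le> ln (real p) * real (n div p)"
      using prime_pos[OF p] by (intro mult_left_mono) auto
    then show "ln (real p) * (n / real p - 1) \<le> mangoldt p * real (n div p)"
      using p by (simp add: primes_upto_def)
  qed
  also have "\<dots> \<le> (\<Sum>d\<in>{1..n}. mangoldt d * real (n div d))"
    by (rule sum_mono2) (auto simp: primes_upto_def mangoldt_nonneg dest: prime_ge_1_nat)
  also have "\<dots> \<le> n * ln (real n)" using sum_ln_le[of n] sum_ln_eq_sum_mangoldt[of n] by simp
  finally have "real n * mertens_sum n \<le> real n * (2 * ln (real n))" by simp
  then show ?thesis using n0 by simp
qed

lemma geometric_sum_le:
  fixes x :: real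
  assumes "0 \<le> x" "x \<le> 1 / 2"
  shows "(\<Sum>k\<in>{1..n}. x ^ k) + 2 * x ^ Suc n \<le> 2 * x"
proof (induction n)
  case (Suc n)
  have "2 * x ^ Suc (Suc n) \<le> x ^ Suc n"
    using mult_right_mono[of "2 * x" 1 "x ^ Suc n"] assms by simp
  then show ?case using Suc by simp
qed simp

text \<open>Prime powers contribute at most as much as the primes themselves, by summing a geometric series with
  ratio at most one half.\<close>

lemma mertens_sum_ge:
  assumes "n \<ge> 1"
  shows "(ln (real n) - 1) / 2 \<le> mertens_sum n"
proof -
  have n0: "real n > 0" using assms by simp
  have "n * ln (real n) - n \<le> (\<Sum>d\<in>{1..n}. mangoldt d * real (n div d))"
    using sum_ln_ge[of n] sum_ln_eq_sum_mangoldt[of n] by simp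
  also have "\<dots> \<le> (\<Sum>d\<in>{1..n}. n * (mangoldt d / real d))"
  proof (rule sum_mono)
    fix d assume "d \<in> {1..n}"
    have "real (n div d) \<le> real n / real d" by (rule of_nat_div_le_of_nat)
    then have "mangoldt d * real (n div d) \<le> mangoldt d * (real n / real d)"
      by (rule mult_left_mono) (rule mangoldt_nonneg)
    then show "mangoldt d * real (n div d) \<le> n * (mangoldt d / real d)" by (simp add: mult_ac)
  qed
  also have "\<dots> = n * (\<Sum>d\<in>{1..n}. mangoldt d / real d)" by (simp add: sum_distrib_left)
  also have "(\<Sum>d\<in>{1..n}. mangoldt d / real d) \<le> 2 * mertens_sum n"
  proof -
    let ?I = "primes_upto n \<times> {1..n}"
    let ?f = "\<lambda>(p, k). p ^ k :: nat"
    have "(\<Sum>d\<in>{1..n}. mangoldt d / real d) = (\<Sum>d\<in>{d \<in> {1..n}. primepow d}. mangoldt d / real d)"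
      by (rule sum.mono_neutral_right) (auto simp: mangoldt_def)
    also have "\<dots> \<le> (\<Sum>d\<in>?f ` ?I. mangoldt d / real d)"
    proof (rule sum_mono2)
      show "{d \<in> {1..n}. primepow d} \<subseteq> ?f ` ?I"
      proof clarify
        fix d assume d: "d \<in> {1..n}" "primepow d"
        then obtain p k where pk: "prime p" "k > 0" "d = p ^ k" by (auto simp: primepow_def)
        have "p \<le> p ^ k" using pk prime_ge_1_nat[OF pk(1)] by (simp add: self_le_power)
        moreover have "k \<le> p ^ k"
          using less_exp[of k] power_mono[of 2 p k] prime_ge_2_nat[OF pk(1)] by linarith
        ultimately have "(p, k) \<in> ?I" using pk d by (auto simp: primes_upto_def)
        then show "d \<in> ?f ` ?I" using pk(3) by force
      qed
    qed (auto simp: mangoldt_nonneg)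
    also have "\<dots> \<le> (\<Sum>q\<in>?I. mangoldt (?f q) / real (?f q))"
      using sum_image_le[of ?I "\<lambda>d. mangoldt d / real d" ?f] by (simp add: o_def mangoldt_nonneg)
    also have "\<dots> = (\<Sum>p\<in>primes_upto n. \<Sum>k\<in>{1..n}. mangoldt (p ^ k) / real (p ^ k))"
      by (simp add: sum.cartesian_product case_prod_unfold)
    also have "\<dots> = (\<Sum>p\<in>primes_upto n. \<Sum>k\<in>{1..n}. ln (real p) * (1 / real p) ^ k)"
      by (intro sum.cong refl) (auto simp: primes_upto_def power_one_over divide_simps)
    also have "\<dots> \<le> (\<Sum>p\<in>primes_upto n. 2 * (ln (real p) / real p))"
    proof (rule sum_mono)
      fix p assume "p \<in> primes_upto n"
      then have p: "real p \<ge> 2" using prime_ge_2_nat by (auto simp: primes_upto_def)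
      have "(\<Sum>k\<in>{1..n}. (1 / real p) ^ k) + 2 * (1 / real p) ^ Suc n \<le> 2 * (1 / real p)"
        by (rule geometric_sum_le) (use p in \<open>auto simp: field_simps\<close>)
      moreover have "2 * (1 / real p) ^ Suc n \<ge> 0" using p by simp
      ultimately have "(\<Sum>k\<in>{1..n}. (1 / real p) ^ k) \<le> 2 * (1 / real p)" by linarith
      then have "ln (real p) * (\<Sum>k\<in>{1..n}. (1 / real p) ^ k) \<le> ln (real p) * (2 * (1 / real p))"
        using p by (intro mult_left_mono) auto
      moreover have "ln (real p) * (2 * (1 / real p)) = 2 * (ln (real p) / real p)" by simp
      ultimately show "(\<Sum>k\<in>{1..n}. ln (real p) * (1 / real p) ^ k) \<le> 2 * (ln (real p) / real p)"
        by (simp only: sum_distrib_left)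
    qed
    also have "\<dots> = 2 * mertens_sum n" by (simp add: mertens_sum_def sum_distrib_left)
    finally show ?thesis .
  qed
  finally have "n * (ln (real n) - 1) \<le> n * (2 * mertens_sum n)"
    by (simp add: right_diff_distrib mult_left_mono)
  then show ?thesis using n0 by simp
qed

definition primes_between :: "nat \<Rightarrow> nat \<Rightarrow> nat set" where
  "primes_between w z = {p. prime p \<and> w < p \<and> p \<le> z}"

lemma finite_primes_between [simp]: "finite (primes_between w z)"
  unfolding primes_between_def by (rule finite_subset[of _ "{..z}"]) auto

text \<open>The exponent 8 makes the lower bound \<open>(log n - 1) / 2\<close> at \<open>n = x\<^sup>8\<close> exceed the upper bound
  \<open>2 log n\<close> at \<open>n = x\<close>.\<close>

lemma recip_sum_window:
  assumes x: "x \<ge> 2"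
  shows "1 / 8 \<le> recip_sum (primes_between x (x ^ 8))"
proof -
  have l: "ln (real x) \<ge> 1 / 2"
  proof -
    have "(2 :: real) \<le> real x" using x by simp
    with exp_half_le2 have "exp (1 / 2) \<le> real x" by (rule order_trans)
    then show ?thesis using x ln_ge_iff[of "real x" "1 / 2"] by simp
  qed
  have x8: "x \<le> x ^ 8" using x by (simp add: self_le_power)
  have "primes_upto (x ^ 8) = primes_upto x \<union> primes_between x (x ^ 8)"
    using x8 by (auto simp: primes_upto_def primes_between_def)
  moreover have "primes_upto x \<inter> primes_between x (x ^ 8) = {}"
    by (auto simp: primes_upto_def primes_between_def)
  ultimately have "mertens_sum (x ^ 8) = mertens_sum x + (\<Sum>p\<in>primes_between x (x ^ 8). ln (real p) / real p)"
    by (simp add: mertens_sum_def sum.union_disjoint)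
  moreover have "mertens_sum (x ^ 8) \<ge> (8 * ln (real x) - 1) / 2"
    using mertens_sum_ge[of "x ^ 8"] x by (simp add: ln_realpow)
  moreover have "mertens_sum x \<le> 2 * ln (real x)" using mertens_sum_le[of x] x by simp
  moreover have "3 * ln (real x) \<le> (8 * ln (real x) - 1) / 2" using l by simp
  ultimately have "ln (real x) \<le> (\<Sum>p\<in>primes_between x (x ^ 8). ln (real p) / real p)"
    by argo
  also have "\<dots> \<le> (\<Sum>p\<in>primes_between x (x ^ 8). 8 * ln (real x) * (1 / real p))"
  proof (rule sum_mono)
    fix p assume p: "p \<in> primes_between x (x ^ 8)"
    then have p0: "real p > 0" "real p \<le> real (x ^ 8)"
      by (auto simp: primes_between_def prime_gt_0_nat simp del: of_nat_power)
    then have "ln (real p) \<le> ln (real (x ^ 8))" by (intro ln_mono) (auto simp del: of_nat_power)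
    also have "\<dots> = 8 * ln (real x)" using x by (simp add: ln_realpow)
    finally show "ln (real p) / real p \<le> 8 * ln (real x) * (1 / real p)"
      using p0 by (simp add: divide_right_mono)
  qed
  also have "\<dots> = ln (real x) * (8 * recip_sum (primes_between x (x ^ 8)))"
    by (simp add: recip_sum_def sum_distrib_left mult_ac)
  finally have "ln (real x) * 1 \<le> ln (real x) * (8 * recip_sum (primes_between x (x ^ 8)))" by simp
  then have "1 \<le> 8 * recip_sum (primes_between x (x ^ 8))" using l by (simp only: mult_le_cancel_left)
  then show ?thesis by simp
qed

lemma recip_sum_long_window:
  assumes x: "x \<ge> 2"
  shows "real J / 8 \<le> recip_sum (primes_between x (x ^ (8 ^ J)))"
proof (induction J)
  case 0
  show ?case by (simp add: recip_sum_def sum_nonneg)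
next
  case (Suc J)
  define y where "y = x ^ (8 ^ J)"
  have xy: "x \<le> y" unfolding y_def using x by (simp add: self_le_power)
  have y2: "y \<ge> 2" using xy x by simp
  have y8: "x ^ (8 ^ Suc J) = y ^ 8" by (simp add: y_def mult.commute flip: power_mult)
  have "y \<le> y ^ 8" using y2 by (simp add: self_le_power)
  then have "primes_between x (y ^ 8) = primes_between x y \<union> primes_between y (y ^ 8)"
    using xy by (auto simp: primes_between_def)
  moreover have "primes_between x y \<inter> primes_between y (y ^ 8) = {}" by (auto simp: primes_between_def)
  ultimately have "recip_sum (primes_between x (y ^ 8)) = recip_sum (primes_between x y) + recip_sum (primes_between y (y ^ 8))"
    by (simp add: recip_sum_def sum.union_disjoint)
  then show ?case using Suc recip_sum_window[OF y2] unfolding y8 by (simp add: y_def)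
qed

text \<open>The product of distinct prime divisors divides \<open>g\<close>, and each of them is at least 2.\<close>

lemma card_prime_divisors_le:
  fixes g :: int
  assumes "finite S" "\<And>p. p \<in> S \<Longrightarrow> prime p" "\<And>p. p \<in> S \<Longrightarrow> int p dvd g" "g \<noteq> 0" "\<bar>g\<bar> \<le> 2 ^ l"
  shows "card S \<le> l"
proof -
  have "int (\<Prod>S) dvd g"
    using assms(1-3)
  proof (induction S rule: finite_induct)
    case (insert p S)
    have "coprime p (\<Prod>S)"
    proof (rule prod_coprime_right)
      fix r assume "r \<in> S"
      then show "coprime p r" using insert by (intro primes_coprime) auto
    qed
    then have "coprime (int p) (int (\<Prod>S))" by (simp only: coprime_int_iff)
    then have "int p * int (\<Prod>S) dvd g" using insert by (intro divides_mult) auto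
    then show ?case using insert by simp
  qed simp
  then have "int (\<Prod>S) \<le> \<bar>g\<bar>" using assms(4) by (metis abs_dvd_iff dvd_abs_iff zdvd_imp_le zero_less_abs_iff)
  moreover have "2 ^ card S \<le> \<Prod>S"
    using prod_mono[of S "\<lambda>_. 2" "\<lambda>p. p"] assms(2) prime_ge_2_nat by (simp add: prod_constant)
  ultimately have "int (2 ^ card S) \<le> 2 ^ l" using assms(5) by (meson of_nat_mono order_trans)
  then show ?thesis by simp
qed

lemma recip_sum_prime_divisors_le:
  fixes g :: int and w l :: nat
  assumes S: "finite S" "\<And>p. p \<in> S \<Longrightarrow> prime p" "\<And>p. p \<in> S \<Longrightarrow> w < p" and w: "w > 0"
    and g: "g \<noteq> 0" "\<bar>g\<bar> \<le> 2 ^ l"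
  shows "recip_sum {p \<in> S. int p dvd g} \<le> l / w"
proof -
  have "recip_sum {p \<in> S. int p dvd g} \<le> (\<Sum>p\<in>{p \<in> S. int p dvd g}. 1 / real w)"
    unfolding recip_sum_def
  proof (rule sum_mono)
    fix p assume "p \<in> {p \<in> S. int p dvd g}"
    then have "w < p" using S(3) by simp
    then show "1 / real p \<le> 1 / real w" using w by (simp add: frac_le)
  qed
  also have "\<dots> = card {p \<in> S. int p dvd g} / w" by simp
  also have "\<dots> \<le> l / w"
  proof (rule divide_right_mono)
    have "card {p \<in> S. int p dvd g} \<le> l"
      by (rule card_prime_divisors_le[OF _ _ _ g]) (use S(1,2) in simp_all)
    then show "real (card {p \<in> S. int p dvd g}) \<le> real l" by simp
  qed simp
  finally show ?thesis .
qed

section \<open>From structured products to structured factors\<close>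

text \<open>If all pairwise intersections were small, the sets would be nearly disjoint, and their total size could
  not reach twice that of \<open>B\<close>. An element that lies in \<open>m\<close> of the sets is counted by at least \<open>m - 1\<close> pairs.\<close>

lemma overlapping_pair:
  assumes fin: "finite B" "finite I" and sub: "\<And>i. i \<in> I \<Longrightarrow> N i \<subseteq> B" and B0: "card B > 0"
    and large: "2 * card B \<le> (\<Sum>i\<in>I. card (N i))"
  obtains i j where "i \<in> I" "j \<in> I" "i \<noteq> j" "card B \<le> (card I)\<^sup>2 * card (N i \<inter> N j)"
proof (rule ccontr)
  assume neg: "\<not> thesis"
  define Q where "Q = {(i, j) \<in> I \<times> I. i \<noteq> j}"
  have finQ: "finite Q" unfolding Q_def by (rule finite_subset[of _ "I \<times> I"]) (use fin in auto)
  have I0: "card I > 0" using large B0 fin by (cases "I = {}") (auto simp: card_gt_0_iff)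
  have "(\<Sum>i\<in>I. card (N i)) = (\<Sum>i\<in>I. card {b \<in> B. b \<in> N i})"
    using sub by (intro sum.cong refl arg_cong[where f = card]) auto
  also have "\<dots> = (\<Sum>b\<in>B. card {i \<in> I. b \<in> N i})" by (rule sum_card_fibres[OF fin(2,1)])
  also have "\<dots> \<le> (\<Sum>b\<in>B. 1 + card {p \<in> Q. b \<in> N (fst p) \<inter> N (snd p)})"
  proof (rule sum_mono)
    fix b
    let ?I = "{i \<in> I. b \<in> N i}"
    show "card ?I \<le> 1 + card {p \<in> Q. b \<in> N (fst p) \<inter> N (snd p)}"
    proof (cases "?I = {}")
      case False
      then obtain i0 where i0: "i0 \<in> ?I" by blast
      have "card (?I - {i0}) \<le> card {p \<in> Q. b \<in> N (fst p) \<inter> N (snd p)}"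
        by (rule card_inj_on_le[where f = "\<lambda>j. (i0, j)"])
           (use i0 finQ in \<open>auto simp: inj_on_def Q_def\<close>)
      then show ?thesis using i0 fin by (simp add: card_Diff_singleton)
    next
      case True
      then have "card ?I = 0" by (simp only: card.empty)
      then show ?thesis by linarith
    qed
  qed
  also have "\<dots> = card B + (\<Sum>b\<in>B. card {p \<in> Q. b \<in> N (fst p) \<inter> N (snd p)})"
    by (subst sum.distrib) simp
  also have "(\<Sum>b\<in>B. card {p \<in> Q. b \<in> N (fst p) \<inter> N (snd p)})
      = (\<Sum>p\<in>Q. card {b \<in> B. b \<in> N (fst p) \<inter> N (snd p)})"
    by (rule sum_card_fibres[OF fin(1) finQ])
  also have "\<dots> = (\<Sum>p\<in>Q. card (N (fst p) \<inter> N (snd p)))"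
    by (intro sum.cong refl arg_cong[where f = card]) (auto simp: Q_def dest: subsetD[OF sub])
  finally have *: "(\<Sum>i\<in>I. card (N i)) \<le> card B + (\<Sum>p\<in>Q. card (N (fst p) \<inter> N (snd p)))" .
  have "(card I)\<^sup>2 * (\<Sum>p\<in>Q. card (N (fst p) \<inter> N (snd p))) \<le> (\<Sum>p\<in>Q. card B - 1)"
    unfolding sum_distrib_left
  proof (rule sum_mono)
    fix p assume "p \<in> Q"
    then have "\<not> card B \<le> (card I)\<^sup>2 * card (N (fst p) \<inter> N (snd p))"
      using neg that by (auto simp: Q_def)
    then show "(card I)\<^sup>2 * card (N (fst p) \<inter> N (snd p)) \<le> card B - 1" by linarith
  qed
  also have "\<dots> = card Q * (card B - 1)" by simp
  also have "\<dots> \<le> (card I)\<^sup>2 * (card B - 1)"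
  proof (rule mult_right_mono)
    have "card Q \<le> card (I \<times> I)" unfolding Q_def by (rule card_mono) (use fin in auto)
    then show "card Q \<le> (card I)\<^sup>2" by (simp add: card_cartesian_product power2_eq_square)
  qed simp
  finally have "(\<Sum>p\<in>Q. card (N (fst p) \<inter> N (snd p))) \<le> card B - 1" using I0 by simp
  then show False using * large B0 by linarith
qed

text \<open>Maximise the number of edges minus a multiple of the number of vertices: deleting a vertex
  of low degree would increase this quantity.\<close>

lemma min_degree_subgraph:
  assumes fin: "finite B" and ne: "B \<noteq> {}" and G: "G \<subseteq> B \<times> B" and dense: "(card B)\<^sup>2 \<le> d * card G"
  obtains B1 C1 where "B1 \<subseteq> B" "C1 \<subseteq> B" "B1 \<noteq> {}" "C1 \<noteq> {}"
    "\<And>b. b \<in> B1 \<Longrightarrow> card B \<le> 4 * d * card {c \<in> C1. (b, c) \<in> G}"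
    "\<And>c. c \<in> C1 \<Longrightarrow> card B \<le> 4 * d * card {b \<in> B1. (b, c) \<in> G}"
proof -
  define n where "n = card B"
  have n0: "n > 0" using fin ne by (simp add: n_def card_gt_0_iff)
  (* the weight n makes \<Phi> (B, B) positive, so a maximiser has an edge *)
  define \<Phi> :: "'a set \<times> 'a set \<Rightarrow> int" where
    "\<Phi> p = 4 * int d * int (card (G \<inter> fst p \<times> snd p)) - int n * (int (card (fst p)) + int (card (snd p)))" for p
  have "finite (\<Phi> ` (Pow B \<times> Pow B))" "\<Phi> ` (Pow B \<times> Pow B) \<noteq> {}" using fin by auto
  then have "Max (\<Phi> ` (Pow B \<times> Pow B)) \<in> \<Phi> ` (Pow B \<times> Pow B)" by (rule Max_in)
  then obtain B1 C1 where BC: "B1 \<subseteq> B" "C1 \<subseteq> B" and eq: "\<Phi> (B1, C1) = Max (\<Phi> ` (Pow B \<times> Pow B))"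
    by auto
  have max: "\<Phi> (X, Y) \<le> \<Phi> (B1, C1)" if "X \<subseteq> B" "Y \<subseteq> B" for X Y
    unfolding eq by (rule Max_ge) (use that fin in auto)
  have finBC: "finite B1" "finite C1" "finite G"
    using BC fin G by (auto intro: finite_subset[of _ "B \<times> B"] finite_subset[of _ B])
  have "\<Phi> (B, B) = 4 * (int d * int (card G)) - 2 * (int n)\<^sup>2"
    using G by (simp add: \<Phi>_def n_def power2_eq_square Int_absorb2)
  moreover have "(int n)\<^sup>2 \<le> int d * int (card G)"
    using dense unfolding n_def by (simp flip: of_nat_mult of_nat_power)
  moreover have "(int n)\<^sup>2 > 0" using n0 by simp
  ultimately have "\<Phi> (B, B) > 0" by linarith
  then have "\<Phi> (B1, C1) > 0" using max[of B B] by simp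
  have "G \<inter> B1 \<times> C1 \<noteq> {}"
  proof
    assume "G \<inter> B1 \<times> C1 = {}"
    then have "\<Phi> (B1, C1) \<le> 0" by (simp add: \<Phi>_def)
    then show False using \<open>\<Phi> (B1, C1) > 0\<close> by simp
  qed
  then have ne': "B1 \<noteq> {}" "C1 \<noteq> {}" by auto
  have 1: "n \<le> 4 * d * card {c \<in> C1. (b, c) \<in> G}" if b: "b \<in> B1" for b
  proof -
    have "G \<inter> B1 \<times> C1 = (G \<inter> (B1 - {b}) \<times> C1) \<union> Pair b ` {c \<in> C1. (b, c) \<in> G}" using b by auto
    then have "card (G \<inter> B1 \<times> C1) = card (G \<inter> (B1 - {b}) \<times> C1) + card (Pair b ` {c \<in> C1. (b, c) \<in> G})"
      by (simp only:) (rule card_Un_disjoint, use finBC in auto)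
    also have "card (Pair b ` {c \<in> C1. (b, c) \<in> G}) = card {c \<in> C1. (b, c) \<in> G}"
      by (rule card_image) (simp add: inj_on_def)
    finally have e: "card (G \<inter> B1 \<times> C1) = card (G \<inter> (B1 - {b}) \<times> C1) + card {c \<in> C1. (b, c) \<in> G}" .
    have cb: "card B1 = Suc (card (B1 - {b}))" using b finBC by (metis card.remove)
    have "\<Phi> (B1 - {b}, C1) \<le> \<Phi> (B1, C1)" using BC by (intro max) auto
    then have "int n \<le> 4 * int d * int (card {c \<in> C1. (b, c) \<in> G})"
      unfolding \<Phi>_def fst_conv snd_conv e cb by (simp add: algebra_simps)
    then show ?thesis by (metis of_nat_le_iff of_nat_mult of_nat_numeral)
  qed
  have 2: "n \<le> 4 * d * card {b \<in> B1. (b, c) \<in> G}" if c: "c \<in> C1" for c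
  proof -
    have "G \<inter> B1 \<times> C1 = (G \<inter> B1 \<times> (C1 - {c})) \<union> (\<lambda>b. (b, c)) ` {b \<in> B1. (b, c) \<in> G}" using c by auto
    then have "card (G \<inter> B1 \<times> C1) = card (G \<inter> B1 \<times> (C1 - {c})) + card ((\<lambda>b. (b, c)) ` {b \<in> B1. (b, c) \<in> G})"
      by (simp only:) (rule card_Un_disjoint, use finBC in auto)
    also have "card ((\<lambda>b. (b, c)) ` {b \<in> B1. (b, c) \<in> G}) = card {b \<in> B1. (b, c) \<in> G}"
      by (rule card_image) (simp add: inj_on_def)
    finally have e: "card (G \<inter> B1 \<times> C1) = card (G \<inter> B1 \<times> (C1 - {c})) + card {b \<in> B1. (b, c) \<in> G}" .
    have cc: "card C1 = Suc (card (C1 - {c}))" using c finBC by (metis card.remove)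
    have "\<Phi> (B1, C1 - {c}) \<le> \<Phi> (B1, C1)" using BC by (intro max) auto
    then have "int n \<le> 4 * int d * int (card {b \<in> B1. (b, c) \<in> G})"
      unfolding \<Phi>_def fst_conv snd_conv e cc by (simp add: algebra_simps)
    then show ?thesis by (metis of_nat_le_iff of_nat_mult of_nat_numeral)
  qed
  show ?thesis by (rule that[OF BC ne' 1[unfolded n_def] 2[unfolded n_def]])
qed

text \<open>The additive structure of the products is passed on to the factors. Call two vertices popular
  if they have many common neighbours; among any \<open>8 d\<close> vertices two are popular. Let \<open>b1, b2\<close> be a
  popular pair at minimal distance, so that an interval shorter than \<open>|b1 - b2|\<close> contains fewer than \<open>8 d\<close>
  vertices. Let \<open>c0\<close> have maximal absolute value \<open>m\<close> among the vertices on the other side; this is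
  where the ordering of the integers enters. Choose \<open>C\<close> inside the common neighbourhood of \<open>b1, b2\<close> and
  inside an interval of length \<open>m / 4\<close>. Two equal sums \<open>b c0 + (b1 - b2) s\<close> with \<open>s \<in> C + C\<close> then have
  values of \<open>b\<close> closer than \<open>|b1 - b2|\<close>, so each value is taken at most \<open>8 d\<close> times.\<close>

theorem neighbourhood_with_small_doubling:
  fixes A B :: "int set"
  assumes finA: "finite A" and fin: "finite B" and G: "G \<subseteq> B \<times> B"
    and prod: "\<And>b c. (b, c) \<in> G \<Longrightarrow> b * c \<in> A"
    and dense: "(card B)\<^sup>2 \<le> d * card G" and K: "card (three_minus_two A) \<le> K * (card B)\<^sup>2"
    and d: "d > 0" and large: "32 * d\<^sup>2 \<le> card B"
  obtains b C where "b \<in> B" "C \<subseteq> {c. (b, c) \<in> G}" "card B \<le> 9 * (8 * d)\<^sup>2 * card C"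
    "card (C + C) \<le> 32 * d\<^sup>2 * K * (9 * (8 * d)\<^sup>2) * card C"
proof -
  define n where "n = card B"
  define r where "r = 8 * d"
  have n_large: "4 * d * r \<le> n" using large by (simp add: n_def r_def power2_eq_square)
  have r0: "r > 0" "r \<ge> 2" using d by (auto simp: r_def)
  have n0: "n > 0" using n_large d r0 by (cases n) auto
  then have ne: "B \<noteq> {}" by (auto simp: n_def)
  obtain B1 C1 where BC: "B1 \<subseteq> B" "C1 \<subseteq> B" "B1 \<noteq> {}" "C1 \<noteq> {}"
    and degB: "\<And>b. b \<in> B1 \<Longrightarrow> n \<le> 4 * d * card {c \<in> C1. (b, c) \<in> G}"
    and degC: "\<And>c. c \<in> C1 \<Longrightarrow> n \<le> 4 * d * card {b \<in> B1. (b, c) \<in> G}"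
    using min_degree_subgraph[OF fin ne G dense] unfolding n_def by blast
  have finBC: "finite B1" "finite C1" using BC fin by (auto intro: finite_subset)
  define N where "N b = {c \<in> C1. (b, c) \<in> G}" for b
  have finN: "finite (N b)" for b using finBC by (simp add: N_def)
  define pop where "pop p \<longleftrightarrow> fst p \<in> B1 \<and> snd p \<in> B1 \<and> fst p \<noteq> snd p \<and> n \<le> r\<^sup>2 * card (N (fst p) \<inter> N (snd p))" for p
  have poppair: "\<exists>b b'. b \<in> I \<and> b' \<in> I \<and> pop (b, b')" if I: "I \<subseteq> B1" "r \<le> card I" for I
  proof -
    obtain J where J: "J \<subseteq> I" "card J = r" "finite J" using obtain_subset_with_card_n[OF I(2)] by metis
    have "(4 * d) * (2 * n) = (\<Sum>i\<in>J. n)" using J by (simp add: r_def)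
    also have "\<dots> \<le> (\<Sum>i\<in>J. 4 * d * card (N i))"
      using degB J I unfolding N_def by (intro sum_mono) blast
    finally have "(4 * d) * (2 * n) \<le> (4 * d) * (\<Sum>i\<in>J. card (N i))" by (simp add: sum_distrib_left)
    then have "2 * card B \<le> (\<Sum>i\<in>J. card (N i))" using d by (simp add: n_def)
    moreover have "\<And>i. i \<in> J \<Longrightarrow> N i \<subseteq> B" using BC by (auto simp: N_def)
    ultimately obtain i j where "i \<in> J" "j \<in> J" "i \<noteq> j" "card B \<le> (card J)\<^sup>2 * card (N i \<inter> N j)"
      using overlapping_pair[OF fin J(3)] n0 unfolding n_def by metis
    then show ?thesis using J I unfolding pop_def n_def by (metis fst_conv snd_conv subsetD)
  qed
  have "r \<le> card B1"
  proof -
    obtain c where "c \<in> C1" using BC by blast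
    then have "4 * d * r \<le> 4 * d * card {b \<in> B1. (b, c) \<in> G}" using degC n_large by (meson order_trans)
    then have "r \<le> card {b \<in> B1. (b, c) \<in> G}" using d by simp
    also have "\<dots> \<le> card B1" by (rule card_mono) (use finBC in auto)
    finally show ?thesis .
  qed
  have "r \<le> card C1"
  proof -
    obtain b where "b \<in> B1" using BC by blast
    then have "4 * d * r \<le> 4 * d * card {c \<in> C1. (b, c) \<in> G}" using degB n_large by (meson order_trans)
    then have "r \<le> card {c \<in> C1. (b, c) \<in> G}" using d by simp
    also have "\<dots> \<le> card C1" by (rule card_mono) (use finBC in auto)
    finally show ?thesis .
  qed
  obtain p0 where "pop p0" using poppair[OF subset_refl \<open>r \<le> card B1\<close>] by blast
  then obtain p where p: "pop p" and pmin: "\<And>p'. pop p' \<Longrightarrow> nat \<bar>fst p - snd p\<bar> \<le> nat \<bar>fst p' - snd p'\<bar>"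
    using ex_has_least_nat[of pop p0 "\<lambda>p. nat \<bar>fst p - snd p\<bar>"] by blast
  define b1 b2 where "b1 = fst p" and "b2 = snd p"
  have b12: "b1 \<in> B1" "b2 \<in> B1" "b1 \<noteq> b2" "n \<le> r\<^sup>2 * card (N b1 \<inter> N b2)"
    using p by (auto simp: pop_def b1_def b2_def)
  have gap: "\<bar>b1 - b2\<bar> \<le> \<bar>b - b'\<bar>" if "pop (b, b')" for b b'
    using pmin[OF that] by (simp add: b1_def b2_def nat_le_eq_zle)
  define m where "m = Max (abs ` C1)"
  have "m \<in> abs ` C1" unfolding m_def using finBC BC by (intro Max_in) auto
  then obtain c0 where c0: "c0 \<in> C1" "\<bar>c0\<bar> = m" by auto
  have mmax: "\<bar>c\<bar> \<le> m" if "c \<in> C1" for c unfolding m_def using finBC that by (intro Max_ge) auto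
  have m0: "m > 0"
  proof (rule ccontr)
    assume "\<not> m > 0"
    then have "C1 \<subseteq> {0}" using mmax by force
    then have "card C1 \<le> 1" using card_mono[of "{0 :: int}" C1] by simp
    then show False using \<open>r \<le> card C1\<close> r0 by simp
  qed
  (* nine cells of length m / 4 cover the interval from -m to m *)
  have "(\<lambda>c. (4 * c) div m) ` (N b1 \<inter> N b2) \<subseteq> {-4..4}"
  proof
    fix i assume "i \<in> (\<lambda>c. (4 * c) div m) ` (N b1 \<inter> N b2)"
    then obtain c where c: "c \<in> C1" "i = (4 * c) div m" by (auto simp: N_def)
    then have "- m \<le> c" "c \<le> m" using mmax[OF c(1)] by auto
    then have le: "(- 4) * m \<le> 4 * c" "4 * c \<le> 4 * m" by linarith+
    have "((- 4) * m) div m \<le> (4 * c) div m" "(4 * c) div m \<le> (4 * m) div m"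
      by (rule zdiv_mono1[OF le(1) m0], rule zdiv_mono1[OF le(2) m0])
    moreover have "((- 4) * m) div m = - 4" "(4 * m) div m = 4"
      using m0 by (simp_all only: nonzero_mult_div_cancel_right)
    ultimately show "i \<in> {-4..4}" using c(2) by simp
  qed
  moreover have "card {- 4 .. 4 :: int} \<le> 9" by simp
  ultimately obtain i where i: "card (N b1 \<inter> N b2) \<le> 9 * card {c \<in> N b1 \<inter> N b2. (4 * c) div m = i}"
    using pigeonhole_fibre[of "N b1 \<inter> N b2" "\<lambda>c. (4 * c) div m" "{-4..4}" 9] finN by (metis finite_Int finite_atLeastAtMost_int)
  define C where "C = {c \<in> N b1 \<inter> N b2. (4 * c) div m = i}"
  have finC: "finite C" using finN by (simp add: C_def)
  have nC: "n \<le> 9 * r\<^sup>2 * card C"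
  proof -
    have "n \<le> r\<^sup>2 * card (N b1 \<inter> N b2)" by (fact b12)
    also have "\<dots> \<le> r\<^sup>2 * (9 * card C)" using i unfolding C_def by (rule mult_left_mono) simp
    finally show ?thesis by (simp add: mult_ac)
  qed
  have close: "2 * \<bar>s - s'\<bar> < m" if "s \<in> C + C" "s' \<in> C + C" for s s'
  proof -
    from that obtain c c' e e' where ce: "c \<in> C" "c' \<in> C" "e \<in> C" "e' \<in> C" "s = c + c'" "s' = e + e'"
      by (auto elim!: set_plus_elim)
    define w where "w = m * i"
    have rem: "w \<le> 4 * x" "4 * x < w + m" if "x \<in> C" for x
    proof -
      have "(4 * x) div m = i" using that by (simp add: C_def)
      then have "4 * x - m * i = (4 * x) mod m" using minus_mult_div_eq_mod[of "4 * x" m] by simp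
      moreover have "0 \<le> (4 * x) mod m" "(4 * x) mod m < m" using m0 by simp_all
      ultimately show "w \<le> 4 * x" "4 * x < w + m" unfolding w_def by linarith+
    qed
    have bounds: "2 * w \<le> 4 * (x + x')" "4 * (x + x') < 2 * w + 2 * m" if "x \<in> C" "x' \<in> C" for x x'
      using rem[OF that(1)] rem[OF that(2)] by (simp_all add: algebra_simps)
    have "4 * (s - s') < 2 * m" "4 * (s' - s) < 2 * m"
      using bounds[OF ce(1,2)] bounds[OF ce(3,4)] unfolding ce(5,6) by (simp_all add: algebra_simps)
    then show ?thesis by (simp add: abs_if)
  qed
  define T where "T = {b \<in> B1. (b, c0) \<in> G}"
  have finT: "finite T" using finBC by (simp add: T_def)
  define h where "h = (\<lambda>(b, s). b * c0 + (b1 - b2) * s)"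
  have img: "h ` (T \<times> (C + C)) \<subseteq> three_minus_two A"
  proof
    fix v assume "v \<in> h ` (T \<times> (C + C))"
    then obtain b c c' where bc: "b \<in> T" "c \<in> C" "c' \<in> C" "v = b * c0 + (b1 - b2) * (c + c')"
      by (auto simp: h_def elim!: set_plus_elim)
    then have v: "v = b * c0 + b1 * c + b1 * c' + - (b2 * c + b2 * c')" by (simp add: algebra_simps)
    show "v \<in> three_minus_two A" unfolding v three_minus_two_def
      using bc prod by (intro set_plus_intro imageI) (auto simp: T_def C_def N_def)
  qed
  have finimg: "finite (h ` (T \<times> (C + C)))" using finT finC by (simp add: finite_set_plus)
  have fibre: "card {q \<in> T \<times> (C + C). h q = v} \<le> r" for v
  proof (rule ccontr)
    assume neg: "\<not> ?thesis"
    let ?Q = "{q \<in> T \<times> (C + C). h q = v}"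
    have "inj_on fst ?Q" using b12(3) by (auto simp: inj_on_def h_def)
    then have rQ: "r \<le> card (fst ` ?Q)" using neg by (simp add: card_image)
    have sub: "fst ` ?Q \<subseteq> B1" by (auto simp: T_def)
    from poppair[OF sub rQ] obtain b b'
      where bb: "b \<in> fst ` ?Q" "b' \<in> fst ` ?Q" "pop (b, b')" by (elim exE conjE)
    then obtain s s' where s: "s \<in> C + C" "s' \<in> C + C"
      and eq: "b * c0 + (b1 - b2) * s = v" "b' * c0 + (b1 - b2) * s' = v"
      by (auto simp: h_def)
    have "(b - b') * c0 = (b1 - b2) * (s' - s)" using eq by (simp add: algebra_simps)
    then have "\<bar>b - b'\<bar> * m = \<bar>b1 - b2\<bar> * \<bar>s' - s\<bar>" using c0(2) by (metis abs_mult)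
    also have "\<dots> < \<bar>b1 - b2\<bar> * m"
    proof (rule mult_strict_left_mono)
      have "\<bar>s' - s\<bar> \<le> 2 * \<bar>s' - s\<bar>" by simp
      also have "\<dots> < m" by (rule close[OF s(2,1)])
      finally show "\<bar>s' - s\<bar> < m" .
    qed (use b12(3) in simp)
    finally have "\<bar>b - b'\<bar> < \<bar>b1 - b2\<bar>" using m0 by simp
    then show False using gap[OF bb(3)] by simp
  qed
  have "card T * card (C + C) = card (T \<times> (C + C))" by (simp add: card_cartesian_product)
  also have "\<dots> = (\<Sum>v\<in>h ` (T \<times> (C + C)). card {q \<in> T \<times> (C + C). h q = v})"
    using sum.group[of "T \<times> (C + C)" "h ` (T \<times> (C + C))" h "\<lambda>_. 1 :: nat"] finT finC
    by (simp add: finite_set_plus)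
  also have "\<dots> \<le> (\<Sum>v\<in>h ` (T \<times> (C + C)). r)" by (rule sum_mono[OF fibre])
  also have "\<dots> = card (h ` (T \<times> (C + C))) * r" by simp
  also have "\<dots> \<le> (K * n\<^sup>2) * r"
    using card_mono[OF finite_three_minus_two[OF finA] img] K unfolding n_def by (intro mult_right_mono) auto
  finally have 1: "card T * card (C + C) \<le> (K * n\<^sup>2) * r" .
  have "n * card (C + C) \<le> (4 * d * card T) * card (C + C)"
    using degC[OF c0(1)] unfolding T_def by (rule mult_right_mono) simp
  also have "\<dots> \<le> 4 * d * ((K * n\<^sup>2) * r)" using 1 by (simp add: mult.assoc)
  also have "\<dots> = n * (4 * d * r * K * n)" by (simp add: power2_eq_square mult_ac)
  finally have "card (C + C) \<le> 4 * d * r * K * n" using n0 by simp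
  also have "\<dots> \<le> 4 * d * r * K * (9 * r\<^sup>2 * card C)" using nC by (rule mult_left_mono) simp
  finally have "card (C + C) \<le> 32 * d\<^sup>2 * K * (9 * (8 * d)\<^sup>2) * card C"
    by (simp add: r_def power2_eq_square mult_ac)
  moreover have "C \<subseteq> {c. (b1, c) \<in> G}" by (auto simp: C_def N_def)
  moreover have "b1 \<in> B" using b12 BC by blast
  ultimately show ?thesis using that[of b1 C] nC by (simp add: n_def r_def)
qed

section \<open>Dense structured sets of products do not exist\<close>

lemma card_set_times_le:
  fixes B :: "'a::times set"
  assumes "finite B"
  shows "card (B * B) \<le> (card B)\<^sup>2"
proof -
  have "B * B = (\<lambda>(x, y). x * y) ` (B \<times> B)" by (auto simp: set_times_def)
  then have "card (B * B) \<le> card (B \<times> B)" using card_image_le[of "B \<times> B" "\<lambda>(x, y). x * y"] assms by simp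
  then show ?thesis by (simp add: card_cartesian_product power2_eq_square)
qed

text \<open>Chebyshev's inequality.\<close>

lemma card_le_twice_card_near_mean:
  fixes f :: "'a \<Rightarrow> real" and L :: real
  assumes fin: "finite Y" and L: "L > 0" and V: "200 * (\<Sum>y\<in>Y. (f y - L)\<^sup>2) \<le> card Y * L\<^sup>2"
  shows "card Y \<le> 2 * card {y \<in> Y. \<bar>f y - L\<bar> \<le> L / 10}"
proof -
  define F where "F = {y \<in> Y. \<not> \<bar>f y - L\<bar> \<le> L / 10}"
  have split: "card Y = card F + card {y \<in> Y. \<bar>f y - L\<bar> \<le> L / 10}"
  proof -
    have "Y = F \<union> {y \<in> Y. \<bar>f y - L\<bar> \<le> L / 10}" by (auto simp: F_def)
    moreover have "card (F \<union> {y \<in> Y. \<bar>f y - L\<bar> \<le> L / 10}) = card F + card {y \<in> Y. \<bar>f y - L\<bar> \<le> L / 10}"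
      by (rule card_Un_disjoint) (use fin in \<open>auto simp: F_def\<close>)
    ultimately show ?thesis by simp
  qed
  have "card F * (L / 10)\<^sup>2 \<le> (\<Sum>y\<in>F. (f y - L)\<^sup>2)"
  proof -
    have "(\<Sum>y\<in>F. (L / 10)\<^sup>2) \<le> (\<Sum>y\<in>F. (f y - L)\<^sup>2)"
    proof (rule sum_mono)
      fix y assume "y \<in> F"
      then have "\<bar>L / 10\<bar> \<le> \<bar>f y - L\<bar>" using L by (simp add: F_def)
      then show "(L / 10)\<^sup>2 \<le> (f y - L)\<^sup>2" by (simp only: abs_le_square_iff)
    qed
    then show ?thesis by simp
  qed
  also have "\<dots> \<le> (\<Sum>y\<in>Y. (f y - L)\<^sup>2)" by (rule sum_mono2) (use fin in \<open>auto simp: F_def\<close>)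
  finally have "200 * (card F * (L / 10)\<^sup>2) \<le> card Y * L\<^sup>2" using V by linarith
  then have "(2 * real (card F)) * L\<^sup>2 \<le> real (card Y) * L\<^sup>2" by (simp add: power_divide)
  then have "2 * real (card F) \<le> real (card Y)" using L by simp
  then have "2 * card F \<le> card Y" by linarith
  then show ?thesis using split by linarith
qed

text \<open>The variance bound is linear in the mean while the deviation allowed is a fixed proportion of it, so
  the concentration wins as soon as the mean is large in terms of \<open>K\<close>.\<close>

corollary structured_set_typical_omega:
  fixes X :: "int set"
  assumes fin: "finite X" and ne: "X \<noteq> {}" and K: "card (three_minus_two X) \<le> K * card X" and k: "k > 0"
    and big: "(2 * K ^ (8 * (4 * K * k)\<^sup>2) * K) ^ k < card X"
  obtains g where "g \<noteq> 0" "g \<in> X + uminus ` X"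
    "\<And>S. finite S \<Longrightarrow> (\<And>p. p \<in> S \<Longrightarrow> prime p) \<Longrightarrow> (\<And>p. p \<in> S \<Longrightarrow> \<not> int p dvd g) \<Longrightarrow>
       3 * (card S)\<^sup>2 \<le> 2 ^ k \<Longrightarrow> 3200 * real K ^ 2 + 1 \<le> recip_sum S \<Longrightarrow>
       card X \<le> 4 * K * card {x \<in> X. \<bar>omega S x - recip_sum S\<bar> \<le> recip_sum S / 10}"
proof -
  obtain Y g where Y: "Y \<subseteq> X" "card X \<le> 2 * K * card Y" "g \<noteq> 0" "g \<in> X + uminus ` X"
    and conc: "\<And>S. finite S \<Longrightarrow> (\<And>p. p \<in> S \<Longrightarrow> prime p) \<Longrightarrow> (\<And>p. p \<in> S \<Longrightarrow> \<not> int p dvd g) \<Longrightarrow>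
       3 * (card S)\<^sup>2 \<le> 2 ^ k \<Longrightarrow>
       (\<Sum>x\<in>Y. (omega S x - recip_sum S)\<^sup>2) \<le> 4 * K * card X * (recip_sum S + 1)"
    using structured_set_concentration[OF fin ne K k big] by metis
  have finY: "finite Y" using Y(1) fin by (rule finite_subset)
  have "card X \<le> 4 * K * card {x \<in> X. \<bar>omega S x - recip_sum S\<bar> \<le> recip_sum S / 10}"
    if S: "finite S" "\<And>p. p \<in> S \<Longrightarrow> prime p" "\<And>p. p \<in> S \<Longrightarrow> \<not> int p dvd g" "3 * (card S)\<^sup>2 \<le> 2 ^ k"
      and L: "3200 * real K ^ 2 + 1 \<le> recip_sum S" for S
  proof -
    define L where "L = recip_sum S"
    have L1: "L \<ge> 1" using L zero_le_power2[of "real K"] unfolding L_def by linarith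
    have "(\<Sum>x\<in>Y. (omega S x - L)\<^sup>2) \<le> 4 * K * card X * (L + 1)"
      unfolding L_def using conc[OF S] by simp
    also have "\<dots> \<le> 4 * K * (2 * K * card Y) * (2 * L)"
    proof (rule mult_mono)
      have "4 * K * card X \<le> 4 * K * (2 * K * card Y)" using Y(2) by (rule mult_left_mono) simp
      then show "real (4 * K * card X) \<le> real (4 * K * (2 * K * card Y))"
        by (simp only: of_nat_le_iff)
    qed (use L1 in auto)
    also have "\<dots> = 16 * (real K ^ 2 * (card Y * L))" by (simp add: power2_eq_square)
    finally have "200 * (\<Sum>x\<in>Y. (omega S x - L)\<^sup>2) \<le> (3200 * real K ^ 2) * (card Y * L)" by (simp add: mult_ac)
    also have "\<dots> \<le> L * (card Y * L)"
      using L L1 by (intro mult_right_mono) (auto simp: L_def)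
    finally have "200 * (\<Sum>x\<in>Y. (omega S x - L)\<^sup>2) \<le> card Y * L\<^sup>2" by (simp add: power2_eq_square mult_ac)
    then have "card Y \<le> 2 * card {y \<in> Y. \<bar>omega S y - L\<bar> \<le> L / 10}"
      using L1 card_le_twice_card_near_mean[OF finY, of L "omega S"] by simp
    also have "\<dots> \<le> 2 * card {x \<in> X. \<bar>omega S x - L\<bar> \<le> L / 10}"
      using Y(1) fin by (intro mult_left_mono card_mono) auto
    finally have "2 * K * card Y \<le> 2 * K * (2 * card {x \<in> X. \<bar>omega S x - L\<bar> \<le> L / 10})"
      by (rule mult_left_mono) simp
    with Y(2) have "card X \<le> 2 * K * (2 * card {x \<in> X. \<bar>omega S x - L\<bar> \<le> L / 10})" by (rule order_trans)
    also have "\<dots> = 4 * K * card {x \<in> X. \<bar>omega S x - L\<bar> \<le> L / 10}" by simp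
    finally show ?thesis unfolding L_def .
  qed
  then show ?thesis using that[OF Y(3,4)] by blast
qed

lemma omega_mult_le:
  assumes "finite S" "\<And>p. p \<in> S \<Longrightarrow> prime p"
  shows "omega S (x * y) \<le> omega S x + omega S y"
proof -
  have "{p \<in> S. int p dvd x * y} \<subseteq> {p \<in> S. int p dvd x} \<union> {p \<in> S. int p dvd y}"
    using assms(2) prime_dvd_mult_iff[where 'a = int] by auto
  then have "card {p \<in> S. int p dvd x * y} \<le> card ({p \<in> S. int p dvd x} \<union> {p \<in> S. int p dvd y})"
    using assms(1) by (intro card_mono) auto
  also have "\<dots> \<le> card {p \<in> S. int p dvd x} + card {p \<in> S. int p dvd y}" by (rule card_Un_le)
  finally show ?thesis by (simp add: omega_def flip: of_nat_add)
qed

text \<open>Excluding the divisors of \<open>x\<close> from \<open>S'\<close> prevents a common prime factor from being counted twice.\<close>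

lemma omega_mult_ge:
  assumes "finite S" "S' \<subseteq> S" "\<And>p. p \<in> S' \<Longrightarrow> \<not> int p dvd x"
  shows "omega S x + omega S' y \<le> omega S (x * y)"
proof -
  have "finite S'" using assms(1,2) finite_subset by blast
  then have "card ({p \<in> S. int p dvd x} \<union> {p \<in> S'. int p dvd y}) = card {p \<in> S. int p dvd x} + card {p \<in> S'. int p dvd y}"
    using assms by (intro card_Un_disjoint) auto
  moreover have "card ({p \<in> S. int p dvd x} \<union> {p \<in> S'. int p dvd y}) \<le> card {p \<in> S. int p dvd x * y}"
    using assms by (intro card_mono) auto
  ultimately show ?thesis by (simp add: omega_def flip: of_nat_add)
qed

lemma recip_sum_Diff_dvd_ge:
  fixes g :: int and w l :: nat
  assumes fin: "finite S" and S: "\<And>p. p \<in> S \<Longrightarrow> prime p" "\<And>p. p \<in> S \<Longrightarrow> w < p" and w: "w > 0"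
    and g: "g \<noteq> 0" "\<bar>g\<bar> \<le> 2 ^ l"
  shows "recip_sum S - l / w \<le> recip_sum {p \<in> S. \<not> int p dvd g}"
proof -
  have "S = {p \<in> S. \<not> int p dvd g} \<union> {p \<in> S. int p dvd g}" by auto
  then have "recip_sum S = recip_sum ({p \<in> S. \<not> int p dvd g} \<union> {p \<in> S. int p dvd g})" by simp
  also have "\<dots> = recip_sum {p \<in> S. \<not> int p dvd g} + recip_sum {p \<in> S. int p dvd g}"
    unfolding recip_sum_def using fin by (intro sum.union_disjoint) auto
  finally show ?thesis using recip_sum_prime_divisors_le[OF fin S w g] by linarith
qed

text \<open>The numerical core of the argument. The numbers \<open>K\<close> and \<open>K'\<close> bound the doubling of \<open>A\<close> and of the structured
  neighbourhoods, \<open>c\<close> and \<open>\<kappa>\<close> the inverse densities of these sets, \<open>2\<^sup>k\<close> is the length of the progressions, and \<open>l\<close>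
  bounds the number of prime divisors of any integer that occurs; the primes in \<open>W\<close> exceed \<open>w\<close>, so
  that removing \<open>l\<close> of them changes the sum of reciprocals by at most \<open>1/100\<close>.\<close>

lemma no_structured_dense_product_subset:
  fixes A B :: "int set" and K c k w l :: nat
  assumes fin: "finite B" and A: "A \<subseteq> B * B" and dense: "(card B)\<^sup>2 \<le> c * card A"
    and K: "card (three_minus_two A) \<le> K * card A" and K0: "K > 0"
  defines "d \<equiv> 32 * K * c" 
  defines "\<kappa> \<equiv> 9 * (8 * d)\<^sup>2"
  defines "K' \<equiv> (32 * d\<^sup>2 * K * \<kappa>) ^ 5"
  assumes k: "k > 0" and bigA: "(2 * K ^ (8 * (4 * K * k)\<^sup>2) * K) ^ k < card A"
    and bigC: "\<kappa> * (2 * K' ^ (8 * (4 * K' * k)\<^sup>2) * K') ^ k < card B"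
    and W: "finite W" "\<And>p. p \<in> W \<Longrightarrow> prime p" "\<And>p. p \<in> W \<Longrightarrow> w < p" and w: "w > 0"
    and cardW: "3 * (card W)\<^sup>2 \<le> 2 ^ k"
    and massW: "3200 * real K ^ 2 + 3200 * real K' ^ 2 + 2 \<le> recip_sum W"
    and bound: "\<And>b. b \<in> B \<Longrightarrow> 2 * \<bar>b\<bar>\<^sup>2 \<le> 2 ^ l" and lw: "100 * l \<le> w"
    and large: "32 * d\<^sup>2 \<le> card B"
  shows False
proof -
  define n where "n = card B"
  have finA: "finite A" using A fin by (meson finite_subset finite_set_times)
  have A0: "card A > 0" using bigA by simp
  then have neA: "A \<noteq> {}" by auto
  have n0: "n > 0" using bigC by (simp add: n_def)
  have c0: "c > 0" using dense n0 by (cases c) (auto simp: n_def)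
  have d0: "d > 0" using c0 K0 by (simp add: d_def)
  have cAn: "card A \<le> n\<^sup>2"
  proof -
    have "card A \<le> card (B * B)" using A fin by (intro card_mono) (auto simp: finite_set_times)
    also have "\<dots> \<le> n\<^sup>2" unfolding n_def by (rule card_set_times_le[OF fin])
    finally show ?thesis .
  qed
  have lw': "real l / real w \<le> 1 / 100" using lw w by (simp add: field_simps)
  have boundB: "\<bar>b\<bar> \<le> 2 ^ l \<and> 2 * \<bar>b\<bar> \<le> 2 ^ l" if "b \<in> B" for b
  proof -
    have "\<bar>b\<bar> \<le> \<bar>b\<bar>\<^sup>2"
    proof (cases "b = 0")
      case False
      then show ?thesis by (intro self_le_power) auto
    qed simp
    then show ?thesis using bound[OF that] by linarith
  qed
  have boundA: "2 * \<bar>a\<bar> \<le> 2 ^ l" if "a \<in> A" for a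
  proof -
    have "a \<in> B * B" using A that by blast
    then obtain x y where xy: "x \<in> B" "y \<in> B" "a = x * y" by (auto simp: set_times_def)
    have "2 * \<bar>a\<bar> \<le> \<bar>x\<bar>\<^sup>2 + \<bar>y\<bar>\<^sup>2"
    proof -
      have "0 \<le> (\<bar>x\<bar> - \<bar>y\<bar>)\<^sup>2" by (rule zero_le_power2)
      then show ?thesis unfolding xy(3) abs_mult power2_diff by simp
    qed
    then show ?thesis using bound[OF xy(1)] bound[OF xy(2)] by linarith
  qed
  have boundD: "\<bar>g\<bar> \<le> 2 ^ l" if "g \<in> X + uminus ` X" "\<And>x. x \<in> X \<Longrightarrow> 2 * \<bar>x\<bar> \<le> 2 ^ l" for g :: int and X
  proof -
    from that(1) obtain x e where "x \<in> X" "e \<in> uminus ` X" "g = x + e" by (rule set_plus_elim)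
    then obtain y where xy: "x \<in> X" "y \<in> X" "g = x - y" by auto
    have "\<bar>g\<bar> \<le> \<bar>x\<bar> + \<bar>y\<bar>" unfolding xy(3) by (rule abs_triangle_ineq4)
    moreover have "2 * \<bar>x\<bar> + 2 * \<bar>y\<bar> \<le> 2 ^ l + 2 ^ l"
      by (rule add_mono[OF that(2)[OF xy(1)] that(2)[OF xy(2)]])
    then have "\<bar>x\<bar> + \<bar>y\<bar> \<le> 2 ^ l" by simp
    ultimately show ?thesis by (rule order_trans)
  qed
  obtain g where g: "g \<noteq> 0" "g \<in> A + uminus ` A"
    and typA: "\<And>S. finite S \<Longrightarrow> (\<And>p. p \<in> S \<Longrightarrow> prime p) \<Longrightarrow> (\<And>p. p \<in> S \<Longrightarrow> \<not> int p dvd g) \<Longrightarrow>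
       3 * (card S)\<^sup>2 \<le> 2 ^ k \<Longrightarrow> 3200 * real K ^ 2 + 1 \<le> recip_sum S \<Longrightarrow>
       card A \<le> 4 * K * card {x \<in> A. \<bar>omega S x - recip_sum S\<bar> \<le> recip_sum S / 10}"
  proof (rule structured_set_typical_omega[OF finA neA K k bigA])
    fix g assume g: "g \<noteq> 0" "g \<in> A + uminus ` A"
      and concl: "\<And>S. finite S \<Longrightarrow> (\<And>p. p \<in> S \<Longrightarrow> prime p) \<Longrightarrow> (\<And>p. p \<in> S \<Longrightarrow> \<not> int p dvd g) \<Longrightarrow>
       3 * (card S)\<^sup>2 \<le> 2 ^ k \<Longrightarrow> 3200 * real K ^ 2 + 1 \<le> recip_sum S \<Longrightarrow>
       card A \<le> 4 * K * card {x \<in> A. \<bar>omega S x - recip_sum S\<bar> \<le> recip_sum S / 10}"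
    show thesis by (rule that[OF g concl])
  qed
  define S where "S = {p \<in> W. \<not> int p dvd g}"
  have S: "finite S" "\<And>p. p \<in> S \<Longrightarrow> prime p" "\<And>p. p \<in> S \<Longrightarrow> w < p" "\<And>p. p \<in> S \<Longrightarrow> \<not> int p dvd g"
    using W by (auto simp: S_def)
  have small: "3 * (card T)\<^sup>2 \<le> 2 ^ k" if "T \<subseteq> W" for T
  proof -
    have "card T \<le> card W" using that W(1) by (rule card_mono[rotated])
    then have "(card T)\<^sup>2 \<le> (card W)\<^sup>2" by (rule power_mono) simp
    then show ?thesis using cardW by linarith
  qed
  define L where "L = recip_sum S"
  have "recip_sum W - l / w \<le> L"
    unfolding L_def S_def by (rule recip_sum_Diff_dvd_ge[OF W w g(1) boundD[OF g(2) boundA]])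
  then have L: "3200 * real K ^ 2 + 3200 * real K' ^ 2 + 199 / 100 \<le> L" using massW lw' by linarith
  have sqs: "0 \<le> 3200 * real K ^ 2" "0 \<le> 3200 * real K' ^ 2" by simp_all
  have L1: "L \<ge> 1" using L sqs by linarith
  define A1 where "A1 = {x \<in> A. \<bar>omega S x - L\<bar> \<le> L / 10}"
  have cA1: "card A \<le> 4 * K * card A1"
    unfolding A1_def L_def
  proof (rule typA[OF S(1,2,4)])
    show "3 * (card S)\<^sup>2 \<le> 2 ^ k" by (rule small) (auto simp: S_def)
    show "3200 * real K ^ 2 + 1 \<le> recip_sum S" using L sqs unfolding L_def by linarith
  qed
  (* the product 0 is excluded because every prime divides it *)
  define G where "G = {(x, y) \<in> B \<times> B. x * y \<in> A1 \<and> x * y \<noteq> 0}"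
  have finA1: "finite A1" using finA by (simp add: A1_def)
  have GB: "G \<subseteq> B \<times> B" by (auto simp: G_def)
  have finG: "finite G" using GB fin by (meson finite_SigmaI finite_subset)
  have "A1 - {0} \<subseteq> (\<lambda>(x, y). x * y) ` G"
  proof
    fix a assume a: "a \<in> A1 - {0}"
    then have "a \<in> B * B" using A by (auto simp: A1_def)
    then obtain x y where "x \<in> B" "y \<in> B" "a = x * y" by (auto simp: set_times_def)
    then show "a \<in> (\<lambda>(x, y). x * y) ` G" using a by (force simp: G_def)
  qed
  then have "card (A1 - {0}) \<le> card G" using finG by (meson card_image_le card_mono finite_imageI order_trans)
  moreover have "card A1 \<le> 2 * card (A1 - {0})"
  proof (cases "card A1 \<le> 1")
    case True
    have "card A \<le> 4 * K * 1" using cA1 True by (meson mult_le_mono2 order_trans)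
    then have "c * card A \<le> c * (4 * K * 1)" by (rule mult_left_mono) simp
    with dense have "n\<^sup>2 \<le> c * (4 * K * 1)" unfolding n_def by (rule order_trans)
    then have "n\<^sup>2 \<le> 4 * (K * c)" by (simp only: mult_ac mult_1_right)
    moreover have "4 * (K * c) < d" using K0 c0 by (simp add: d_def)
    moreover have "d \<le> d\<^sup>2" "n \<le> n\<^sup>2" by (simp_all add: power2_eq_square)
    ultimately show ?thesis using large by (simp add: n_def)
  next
    case False
    have "card A1 - 1 \<le> card (A1 - {0})" by (simp add: card_Diff_singleton_if)
    then show ?thesis using False by linarith
  qed
  ultimately have cG: "card A1 \<le> 2 * card G" by linarith
  have "n\<^sup>2 \<le> c * (4 * K * (2 * card G))"
  proof -
    have "card A \<le> 4 * K * (2 * card G)"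
      using cA1 mult_left_mono[OF cG, of "4 * K"] by (rule order_trans) simp
    then have "c * card A \<le> c * (4 * K * (2 * card G))" by (rule mult_left_mono) simp
    with dense show ?thesis unfolding n_def by (rule order_trans)
  qed
  then have nG: "4 * n\<^sup>2 \<le> d * card G" by (simp add: d_def mult_ac)
  have cheap: "\<exists>b c. (b, c) \<in> G' \<and> omega S b \<le> L / 4" if G': "G' \<subseteq> G" "n\<^sup>2 \<le> d * card G'" for G'
  proof -
    have prod: "\<And>b c. (b, c) \<in> G' \<Longrightarrow> b * c \<in> A" using G'(1) by (auto simp: G_def A1_def)
    have K2: "card (three_minus_two A) \<le> K * (card B)\<^sup>2"
      using K cAn unfolding n_def by (meson mult_le_mono2 order_trans)
    have G'B: "G' \<subseteq> B \<times> B" using G'(1) GB by (rule order_trans)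
    obtain b C where b: "b \<in> B" "C \<subseteq> {c. (b, c) \<in> G'}" "card B \<le> 9 * (8 * d)\<^sup>2 * card C"
      "card (C + C) \<le> 32 * d\<^sup>2 * K * (9 * (8 * d)\<^sup>2) * card C"
      by (rule neighbourhood_with_small_doubling[OF finA fin G'B prod G'(2)[unfolded n_def] K2 d0 large])
    note b = b[folded \<kappa>_def]
    have CB: "C \<subseteq> B" using b(2) G'(1) GB by blast
    have finC: "finite C" using CB fin by (rule finite_subset)
    have neC: "C \<noteq> {}" using b(3) n0 by (auto simp: n_def)
    have K'C: "card (three_minus_two C) \<le> K' * card C"
      unfolding K'_def by (rule plunnecke_three_minus_two[OF finC finC neC b(4)])
    have "\<kappa> * (2 * K' ^ (8 * (4 * K' * k)\<^sup>2) * K') ^ k < \<kappa> * card C"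
      using bigC b(3) by linarith
    then have bigC': "(2 * K' ^ (8 * (4 * K' * k)\<^sup>2) * K') ^ k < card C" by simp
    obtain h where h: "h \<noteq> 0" "h \<in> C + uminus ` C"
      and typC: "\<And>S. finite S \<Longrightarrow> (\<And>p. p \<in> S \<Longrightarrow> prime p) \<Longrightarrow> (\<And>p. p \<in> S \<Longrightarrow> \<not> int p dvd h) \<Longrightarrow>
         3 * (card S)\<^sup>2 \<le> 2 ^ k \<Longrightarrow> 3200 * real K' ^ 2 + 1 \<le> recip_sum S \<Longrightarrow>
         card C \<le> 4 * K' * card {x \<in> C. \<bar>omega S x - recip_sum S\<bar> \<le> recip_sum S / 10}"
    proof (rule structured_set_typical_omega[OF finC neC K'C k bigC'])
      fix h assume h: "h \<noteq> 0" "h \<in> C + uminus ` C"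
        and concl: "\<And>S. finite S \<Longrightarrow> (\<And>p. p \<in> S \<Longrightarrow> prime p) \<Longrightarrow> (\<And>p. p \<in> S \<Longrightarrow> \<not> int p dvd h) \<Longrightarrow>
         3 * (card S)\<^sup>2 \<le> 2 ^ k \<Longrightarrow> 3200 * real K' ^ 2 + 1 \<le> recip_sum S \<Longrightarrow>
         card C \<le> 4 * K' * card {x \<in> C. \<bar>omega S x - recip_sum S\<bar> \<le> recip_sum S / 10}"
      show thesis by (rule that[OF h concl])
    qed
    have b0: "b \<noteq> 0" using neC b(2) G'(1) by (auto simp: G_def)
    define S1 where "S1 = {p \<in> S. \<not> int p dvd h}"
    define S2 where "S2 = {p \<in> S1. \<not> int p dvd b}"
    have S1: "finite S1" "\<And>p. p \<in> S1 \<Longrightarrow> prime p" "\<And>p. p \<in> S1 \<Longrightarrow> w < p" using S by (auto simp: S1_def)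
    have "recip_sum S - l / w \<le> recip_sum S1" unfolding S1_def
      by (rule recip_sum_Diff_dvd_ge[OF S(1-3) w h(1) boundD[OF h(2)]]) (use CB boundB in auto)
    moreover have "recip_sum S1 - l / w \<le> recip_sum S2" unfolding S2_def
      by (rule recip_sum_Diff_dvd_ge[OF S1 w b0 conjunct1[OF boundB[OF b(1)]]])
    ultimately have L2: "recip_sum S2 \<ge> L - 2 / 100" using lw' unfolding L_def by linarith
    have "card C \<le> 4 * K' * card {x \<in> C. \<bar>omega S2 x - recip_sum S2\<bar> \<le> recip_sum S2 / 10}"
    proof (rule typC)
      show "3 * (card S2)\<^sup>2 \<le> 2 ^ k" by (rule small) (auto simp: S2_def S1_def S_def)
      show "3200 * real K' ^ 2 + 1 \<le> recip_sum S2" using L2 L sqs by linarith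
    qed (use S(1,2) in \<open>auto simp: S2_def S1_def\<close>)
    then have "{x \<in> C. \<bar>omega S2 x - recip_sum S2\<bar> \<le> recip_sum S2 / 10} \<noteq> {}"
      using neC finC by (metis card_0_eq card.empty le_zero_eq mult_is_0)
    then obtain c where c: "c \<in> C" "\<bar>omega S2 c - recip_sum S2\<bar> \<le> recip_sum S2 / 10" by blast
    have G'c: "(b, c) \<in> G'" using b(2) c(1) by blast
    then have "b * c \<in> A1" using G'(1) by (auto simp: G_def)
    then have "\<bar>omega S (b * c) - L\<bar> \<le> L / 10" by (simp add: A1_def)
    then have "omega S (b * c) \<le> L + L / 10" unfolding abs_le_iff by linarith
    moreover have "omega S b + omega S2 c \<le> omega S (b * c)"
      by (rule omega_mult_ge[OF S(1)]) (auto simp: S2_def S1_def)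
    moreover have "omega S2 c \<ge> recip_sum S2 - recip_sum S2 / 10" using c(2) unfolding abs_le_iff by linarith
    ultimately have "omega S b \<le> L / 4" using L2 L1 by linarith
    then show ?thesis using G'c by blast
  qed
  (* H contains no edge of the kind found above, so it is not dense *)
  define H where "H = {(b, c) \<in> G. omega S b > L / 4}"
  have HG: "H \<subseteq> G" by (auto simp: H_def)
  have "\<not> n\<^sup>2 \<le> d * card H" using cheap[OF HG] by (force simp: H_def)
  then have "4 * (d * card H) < d * card G" using nG by linarith
  then have H4: "4 * card H < card G" using d0 by (simp add: mult.left_commute)
  have finH: "finite H" using HG finG by (rule finite_subset)
  have "card (H \<union> prod.swap ` H) \<le> card H + card (prod.swap ` H)" by (rule card_Un_le)
  also have "\<dots> \<le> 2 * card H" using card_image_le[OF finH, of prod.swap] by simp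
  also have "\<dots> < card G" using H4 by linarith
  finally have "\<not> G \<subseteq> H \<union> prod.swap ` H" using finH card_mono[of "H \<union> prod.swap ` H" G] by fastforce
  then obtain q where q: "q \<in> G" "q \<notin> H" "q \<notin> prod.swap ` H" by blast
  obtain b c where "q = (b, c)" by (cases q)
  with q have bc: "(b, c) \<in> G" "(b, c) \<notin> H" "(b, c) \<notin> prod.swap ` H" by simp_all
  have "(c, b) \<in> G" using bc(1) by (auto simp: G_def mult.commute)
  moreover have "(c, b) \<notin> H" using bc(3) by force
  ultimately have "omega S b \<le> L / 4" "omega S c \<le> L / 4" using bc by (auto simp: H_def not_less)
  moreover have "omega S (b * c) \<le> omega S b + omega S c" by (rule omega_mult_le[OF S(1,2)])
  moreover have "\<bar>omega S (b * c) - L\<bar> \<le> L / 10" using bc(1) by (simp add: G_def A1_def)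
  then have "omega S (b * c) \<ge> L - L / 10" unfolding abs_le_iff by linarith
  ultimately show False using L1 by linarith
qed

section \<open>Conclusion\<close>

text \<open>As \<open>B * B\<close> has at most \<open>n\<^sup>2\<close> elements and its energy is at most the cube of its size, large energy forces
  it to have \<open>\<eta> n\<^sup>2\<close> elements, and its energy is then within a constant factor of the maximum.\<close>

lemma dense_structured_subset_of_energy:
  fixes B :: "int set" and \<eta> :: real
  assumes fin: "finite B" and "B \<noteq> {}" and \<eta>: "0 < \<eta>" "\<eta> \<le> 1"
    and en: "\<eta> * real (card B) ^ 6 < real (additive_energy (B * B))"
  obtains A where "A \<subseteq> B * B" "real (card B) ^ 2 \<le> 8 / \<eta>\<^sup>2 * card A"
    "card (three_minus_two A) \<le> nat \<lceil>8 / \<eta> * (4 * 32\<^sup>2 * (2 / \<eta>) ^ 9)\<rceil> ^ 5 * card A"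
proof -
  define n where "n = real (card B)"
  have n0: "n > 0" using fin \<open>B \<noteq> {}\<close> by (simp add: n_def card_gt_0_iff)
  define P where "P = B * B"
  have finP: "finite P" using fin by (simp add: P_def finite_set_times)
  have neP: "P \<noteq> {}" using \<open>B \<noteq> {}\<close> by (auto simp: P_def set_times_def)
  define N where "N = real (card P)"
  have N0: "N > 0" using finP neP by (simp add: N_def card_gt_0_iff)
  have Nn: "N \<le> n\<^sup>2"
  proof -
    have "real (card P) \<le> real ((card B)\<^sup>2)" unfolding P_def of_nat_le_iff by (rule card_set_times_le[OF fin])
    then show ?thesis by (simp add: N_def n_def)
  qed
  have EN: "real (additive_energy P) \<le> N ^ 3"
  proof -
    have "(\<Sum>(a, c)\<in>P \<times> P. diff_count P (a - c)) \<le> (\<Sum>q\<in>P \<times> P. card P)"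
      unfolding case_prod_unfold by (intro sum_mono diff_count_le[OF finP])
    then have "additive_energy P \<le> card P * card P * card P"
      by (simp add: additive_energy_eq_sum_diff_count[OF finP] card_cartesian_product)
    then have "real (additive_energy P) \<le> real (card P * card P * card P)" by (simp only: of_nat_le_iff)
    then show ?thesis by (simp add: N_def power3_eq_cube)
  qed
  have "\<eta> * N ^ 3 \<le> \<eta> * (n\<^sup>2) ^ 3"
    using Nn N0 \<eta> by (intro mult_left_mono power_mono) auto
  also have "\<dots> = \<eta> * n ^ 6" by (simp flip: power_mult)
  also have "\<dots> \<le> real (additive_energy P)" using en by (simp add: P_def n_def)
  finally have "\<eta> * real (card P) ^ 3 \<le> real (additive_energy P)" by (simp add: N_def)
  then obtain A where A: "A \<subseteq> P" "A \<noteq> {}" "real (card A) \<ge> \<eta> / 8 * card P"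
    "real (card (A + uminus ` A)) \<le> 4 * 32\<^sup>2 * (2 / \<eta>) ^ 9 * card P"
    using balog_szemeredi_gowers[OF finP neP \<eta>(1)] by blast
  have finA: "finite A" using A(1) finP by (rule finite_subset)
  have Nlow: "\<eta> * n\<^sup>2 \<le> N"
  proof -
    have "(\<eta> * n\<^sup>2) * (n\<^sup>2)\<^sup>2 = \<eta> * n ^ 6" by (simp flip: power_mult power_add)
    also have "\<dots> \<le> N ^ 3" using en EN by (simp add: P_def n_def)
    also have "\<dots> = N * N\<^sup>2" by (simp add: power2_eq_square power3_eq_cube)
    also have "\<dots> \<le> N * (n\<^sup>2)\<^sup>2" using Nn N0 by (intro mult_left_mono power_mono) auto
    finally show ?thesis using n0 by simp
  qed
  have PA: "N \<le> 8 / \<eta> * card A" using A(3) \<eta> by (simp add: N_def field_simps)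
  have "\<eta> * n\<^sup>2 \<le> 8 / \<eta> * card A" using Nlow PA by (rule order_trans)
  then have 1: "n ^ 2 \<le> 8 / \<eta>\<^sup>2 * card A" using \<eta> by (simp add: field_simps power2_eq_square)
  let ?K = "nat \<lceil>8 / \<eta> * (4 * 32\<^sup>2 * (2 / \<eta>) ^ 9)\<rceil>"
  have "real (card (A + uminus ` A)) \<le> (4 * 32\<^sup>2 * (2 / \<eta>) ^ 9) * (8 / \<eta> * card A)"
    using A(4) PA \<eta> unfolding N_def by (elim order_trans, intro mult_left_mono) auto
  also have "\<dots> = 8 / \<eta> * (4 * 32\<^sup>2 * (2 / \<eta>) ^ 9) * card A" by simp
  also have "\<dots> \<le> real ?K * card A" by (intro mult_right_mono real_nat_ceiling_ge) simp
  finally have "card (A + uminus ` A) \<le> ?K * card A" by (simp only: of_nat_le_iff flip: of_nat_mult)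
  then have "card (three_minus_two (uminus ` A)) \<le> ?K ^ 5 * card A"
    by (intro plunnecke_three_minus_two) (use finA A(2) in auto)
  then have "card (three_minus_two A) \<le> ?K ^ 5 * card A" by (simp only: three_minus_two_uminus card_image_uminus)
  then show ?thesis using that[of A] A(1) 1 by (simp add: P_def n_def)
qed

lemma eventually_polynomial_le_exponential:
  "\<forall>\<^sub>F k in sequentially. 3 * k ^ m \<le> (2 :: nat) ^ k"
proof -
  have "((\<lambda>x :: real. x ^ m / exp x) \<longlongrightarrow> 0) at_top" by (rule tendsto_power_div_exp_0)
  moreover have "filterlim (\<lambda>k. real k * ln 2) at_top sequentially"
    by (rule filterlim_at_top_mult_tendsto_pos[of _ "ln 2"]) (auto intro: filterlim_real_sequentially)
  ultimately have "((\<lambda>k. (real k * ln 2) ^ m / exp (real k * ln 2)) \<longlongrightarrow> 0) sequentially"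
    by (rule filterlim_compose)
  then have "\<forall>\<^sub>F k in sequentially. (real k * ln 2) ^ m / exp (real k * ln 2) < ln 2 ^ m / 3"
    by (rule order_tendstoD) simp
  then show ?thesis
  proof eventually_elim
    case (elim k)
    have e: "exp (real k * ln 2) = 2 ^ k" by (simp add: exp_of_nat_mult)
    have "(ln 2 ^ m * (3 * real k ^ m)) < ln 2 ^ m * 2 ^ k"
      using elim unfolding e by (simp add: field_simps power_mult_distrib)
    then have "3 * real k ^ m < 2 ^ k" by simp
    then have "real (3 * k ^ m) < real (2 ^ k)" by simp
    then show ?case by (simp only: of_nat_less_iff less_imp_le)
  qed
qed

text \<open>The size required to find a progression of length \<open>2\<^sup>k\<close> is exponential in \<open>k\<^sup>3\<close>, so \<open>k\<close> can be taken
  of the order of the cube root of \<open>log n\<close>.\<close>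

lemma iterated_cost_le:
  fixes K k :: nat
  assumes "K > 0" "k > 0" "K \<le> M"
  shows "(2 * K ^ (8 * (4 * K * k)\<^sup>2) * K) ^ k \<le> (2 * M ^ (128 * M\<^sup>2 + 1)) ^ (k ^ 3)"
proof -
  have "2 * K ^ (8 * (4 * K * k)\<^sup>2) * K \<le> (2 * M ^ (128 * M\<^sup>2 + 1)) ^ (k\<^sup>2)"
  proof -
    have M: "M \<ge> 1" using assms by simp
    have k2: "1 \<le> k\<^sup>2" using assms by (simp add: Suc_le_eq)
    have "2 * K ^ (8 * (4 * K * k)\<^sup>2) * K = 2 * K ^ (128 * K\<^sup>2 * k\<^sup>2 + 1)"
      by (simp add: power_mult_distrib mult.assoc)
    also have "\<dots> \<le> 2 * M ^ (128 * K\<^sup>2 * k\<^sup>2 + 1)"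
      using assms by (intro mult_left_mono power_mono) auto
    also have "\<dots> \<le> 2 * M ^ ((128 * M\<^sup>2 + 1) * k\<^sup>2)"
    proof (intro mult_left_mono power_increasing M)
      have "K\<^sup>2 \<le> M\<^sup>2" using assms by (intro power_mono) auto
      then have "128 * K\<^sup>2 * k\<^sup>2 \<le> 128 * M\<^sup>2 * k\<^sup>2" by (intro mult_right_mono mult_left_mono) auto
      then have "128 * K\<^sup>2 * k\<^sup>2 + 1 \<le> 128 * M\<^sup>2 * k\<^sup>2 + k\<^sup>2" using k2 by (rule add_mono)
      then show "128 * K\<^sup>2 * k\<^sup>2 + 1 \<le> (128 * M\<^sup>2 + 1) * k\<^sup>2" by (simp only: distrib_right mult_1)
    qed simp
    also have "\<dots> \<le> 2 ^ (k\<^sup>2) * M ^ ((128 * M\<^sup>2 + 1) * k\<^sup>2)"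
      using power_increasing[OF k2, of "2 :: nat"] by (intro mult_right_mono) auto
    also have "\<dots> = (2 * M ^ (128 * M\<^sup>2 + 1)) ^ (k\<^sup>2)" by (simp only: power_mult_distrib power_mult)
    finally show ?thesis .
  qed
  then have "(2 * K ^ (8 * (4 * K * k)\<^sup>2) * K) ^ k \<le> ((2 * M ^ (128 * M\<^sup>2 + 1)) ^ (k\<^sup>2)) ^ k"
    by (rule power_mono) simp
  also have "\<dots> = (2 * M ^ (128 * M\<^sup>2 + 1)) ^ (k\<^sup>2 * k)" by (simp only: power_mult)
  also have "k\<^sup>2 * k = k ^ 3" by (simp add: power2_eq_square power3_eq_cube)
  finally show ?thesis .
qed

lemma scale_exists:
  fixes D n k0 :: nat
  assumes D: "D \<ge> 2" and n: "D ^ (k0 ^ 3) \<le> n"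
  obtains k where "k0 \<le> k" "D ^ (k ^ 3) \<le> n" "n < D ^ (Suc k ^ 3)"
proof -
  define Q where "Q = {k. D ^ (k ^ 3) \<le> n}"
  have "k \<le> n" if "k \<in> Q" for k
  proof -
    have "k \<le> k ^ 3" by (cases "k = 0") (auto simp: self_le_power)
    also have "\<dots> \<le> 2 ^ (k ^ 3)" using less_exp[of "k ^ 3"] by simp
    also have "\<dots> \<le> D ^ (k ^ 3)" using D by (rule power_mono) simp
    finally show ?thesis using that by (simp add: Q_def)
  qed
  then have finQ: "finite Q" using finite_nat_set_iff_bounded_le by blast
  have k0: "k0 \<in> Q" using n by (simp add: Q_def)
  have "Max Q \<in> Q" using finQ k0 by (intro Max_in) auto
  moreover have "k0 \<le> Max Q" using finQ k0 by (rule Max_ge)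
  moreover have "Suc (Max Q) \<notin> Q" using Max_ge[OF finQ, of "Suc (Max Q)"] by (meson Suc_n_not_le_n)
  ultimately show ?thesis using that[of "Max Q"] by (simp add: Q_def)
qed

text \<open>When \<open>log n\<close> has order \<open>k\<^sup>3\<close>, polynomial growth means that all integers involved have
  \<open>O(k\<^sup>3)\<close> binary digits, fewer than the \<open>k\<^sup>4\<close> at which the window of primes will start.\<close>

lemma square_bound_at_scale:
  fixes C1 C2 x :: real and D n k a h :: nat
  assumes C: "C1 > 0" "C2 > 0" and a: "C1 \<le> 2 ^ a" and h: "C2 \<le> real h" and D: "D \<ge> 1"
    and k: "k > 0" and n: "n > 0" "n < D ^ (Suc k ^ 3)" and x: "\<bar>x\<bar> < C1 * real n powr C2"
  shows "2 * \<bar>x\<bar>\<^sup>2 \<le> 2 ^ ((1 + 2 * a + 16 * D * h) * k ^ 3)"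
proof -
  define e where "e = D * (8 * k ^ 3) * h"
  have "Suc k ^ 3 \<le> (2 * k) ^ 3" using k by (intro power_mono) auto
  then have s: "Suc k ^ 3 \<le> 8 * k ^ 3" by (simp add: power_mult_distrib)
  have "n \<le> 2 ^ (D * (8 * k ^ 3))"
  proof -
    have "n \<le> D ^ (Suc k ^ 3)" using n by simp
    also have "\<dots> \<le> D ^ (8 * k ^ 3)" using s D by (intro power_increasing) auto
    also have "\<dots> \<le> (2 ^ D) ^ (8 * k ^ 3)" using less_exp[of D] by (intro power_mono) auto
    finally show ?thesis by (simp add: power_mult)
  qed
  then have n2: "real n \<le> 2 ^ (D * (8 * k ^ 3))" by (metis of_nat_le_iff of_nat_numeral of_nat_power)
  have "real n powr C2 \<le> real n powr real h" using n h by (intro powr_mono) auto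
  also have "\<dots> = real n ^ h" using n by (simp add: powr_realpow)
  also have "\<dots> \<le> (2 ^ (D * (8 * k ^ 3))) ^ h" using n2 by (intro power_mono) auto
  also have "\<dots> = 2 ^ e" by (simp add: e_def power_mult)
  finally have "C1 * real n powr C2 \<le> 2 ^ a * 2 ^ e" using a C by (intro mult_mono) auto
  then have "\<bar>x\<bar> \<le> 2 ^ (a + e)" using x by (simp add: power_add)
  then have "\<bar>x\<bar>\<^sup>2 \<le> (2 ^ (a + e))\<^sup>2" by (intro power_mono) auto
  then have "2 * \<bar>x\<bar>\<^sup>2 \<le> 2 ^ Suc (2 * (a + e))" by (simp add: mult.commute flip: power_mult)
  also have "\<dots> \<le> 2 ^ ((1 + 2 * a + 16 * D * h) * k ^ 3)"
  proof (rule power_increasing)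
    have "1 \<le> k ^ 3" using k by (simp add: Suc_le_eq)
    then have "1 + 2 * a \<le> (1 + 2 * a) * k ^ 3" by (metis mult.right_neutral mult_le_mono2)
    then show "Suc (2 * (a + e)) \<le> (1 + 2 * a + 16 * D * h) * k ^ 3"
      by (simp add: e_def algebra_simps)
  qed simp
  finally show ?thesis .
qed

theorem corollary1p2:
  fixes C1 C2 :: real
  assumes "C1 > 0" and "C2 > 0"
  shows "\<forall>\<eta>::real. \<eta> > 0 \<longrightarrow>
    (\<exists>N::nat. \<forall>B::int set.
       finite B \<and> card B \<ge> N \<and> (\<forall>b\<in>B. real_of_int \<bar>b\<bar> < C1 * real (card B) powr C2) \<longrightarrow>
       real (additive_energy (B * B)) \<le> \<eta> * real (card B) ^ 6)"
proof (intro allI impI)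
  fix \<eta> :: real assume "\<eta> > 0"
  define \<theta> where "\<theta> = min \<eta> 1"
  have \<theta>: "0 < \<theta>" "\<theta> \<le> 1" "\<theta> \<le> \<eta>" using \<open>\<eta> > 0\<close> by (auto simp: \<theta>_def)
  define K where "K = nat \<lceil>8 / \<theta> * (4 * 32\<^sup>2 * (2 / \<theta>) ^ 9)\<rceil> ^ 5"
  have K0: "K > 0" using \<theta> by (simp add: K_def)
  define c where "c = nat \<lceil>8 / \<theta>\<^sup>2\<rceil>"
  define d where "d = 32 * K * c"
  define \<kappa> where "\<kappa> = 9 * (8 * d)\<^sup>2"
  define K' where "K' = (32 * d\<^sup>2 * K * \<kappa>) ^ 5"
  have c0: "c > 0" using \<theta> by (simp add: c_def)
  have d0: "d > 0" using K0 c0 by (simp add: d_def)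
  have \<kappa>0: "\<kappa> > 0" using d0 by (simp add: \<kappa>_def)
  have K'0: "K' > 0" using d0 K0 \<kappa>0 by (simp add: K'_def)
  define M where "M = K + K'"
  (* the power D ^ (k ^ 3) exceeds the size needed to find progressions of length 2 ^ k in both kinds of sets *)
  define D where "D = 2 * M ^ (128 * M\<^sup>2 + 1) * (c + \<kappa> + 1)"
  have D2: "D \<ge> 2"
  proof -
    have "M ^ (128 * M\<^sup>2 + 1) * (c + \<kappa> + 1) > 0" using K0 by (simp add: M_def)
    then have "1 \<le> M ^ (128 * M\<^sup>2 + 1) * (c + \<kappa> + 1)" by linarith
    then have "2 * 1 \<le> 2 * (M ^ (128 * M\<^sup>2 + 1) * (c + \<kappa> + 1))" by (rule mult_left_mono) simp
    then show ?thesis by (simp only: D_def mult.assoc mult_1_right)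
  qed
  define J where "J = 8 * (3200 * K\<^sup>2 + 3200 * K'\<^sup>2 + 2)"
  define E where "E = (8 :: nat) ^ J"
  obtain a where a: "C1 \<le> 2 ^ a" using real_arch_pow[of 2 C1] by (auto intro: less_imp_le)
  obtain h where h: "C2 \<le> real h" using real_arch_simple by blast
  define c3 where "c3 = 1 + 2 * a + 16 * D * h"
  obtain k1 where k1: "\<And>k. k \<ge> k1 \<Longrightarrow> 3 * k ^ (8 * E) \<le> (2 :: nat) ^ k"
    using eventually_polynomial_le_exponential[of "8 * E"] by (auto simp: eventually_sequentially)
  (* the four summands ensure cardW, lw, large and k \<ge> 2 below *)
  define k0 where "k0 = k1 + 100 * c3 + 32 * d\<^sup>2 + 2"
  show "\<exists>N::nat. \<forall>B::int set.
       finite B \<and> card B \<ge> N \<and> (\<forall>b\<in>B. real_of_int \<bar>b\<bar> < C1 * real (card B) powr C2) \<longrightarrow>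
       real (additive_energy (B * B)) \<le> \<eta> * real (card B) ^ 6"
  proof (intro exI[of _ "D ^ (k0 ^ 3)"] allI impI, elim conjE, rule ccontr)
    fix B :: "int set"
    assume fin: "finite B" and big: "D ^ (k0 ^ 3) \<le> card B"
      and bound: "\<forall>b\<in>B. real_of_int \<bar>b\<bar> < C1 * real (card B) powr C2"
      and neg: "\<not> real (additive_energy (B * B)) \<le> \<eta> * real (card B) ^ 6"
    obtain k where k: "k0 \<le> k" "D ^ (k ^ 3) \<le> card B" "card B < D ^ (Suc k ^ 3)"
      using scale_exists[OF D2 big] by blast
    have kpos: "k \<ge> 2" "k > 0" using k(1) by (auto simp: k0_def)
    have kle: "k \<le> D ^ (k ^ 3)"
    proof -
      have "k \<le> k ^ 3" using kpos by (intro self_le_power) auto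
      also have "\<dots> \<le> 2 ^ (k ^ 3)" using less_exp[of "k ^ 3"] by simp
      also have "\<dots> \<le> D ^ (k ^ 3)" using D2 by (rule power_mono) simp
      finally show ?thesis .
    qed
    have n0: "card B > 0" using kle k(2) kpos by linarith
    then have neB: "B \<noteq> {}" by auto
    have "\<theta> * real (card B) ^ 6 \<le> \<eta> * real (card B) ^ 6" using \<theta>(3) by (rule mult_right_mono) simp
    then have "\<theta> * real (card B) ^ 6 < real (additive_energy (B * B))" using neg by linarith
    then obtain A where A: "A \<subseteq> B * B" "real (card B) ^ 2 \<le> 8 / \<theta>\<^sup>2 * card A"
      "card (three_minus_two A) \<le> K * card A"
      using dense_structured_subset_of_energy[OF fin neB \<theta>(1,2)] unfolding K_def by blast
    have dense: "(card B)\<^sup>2 \<le> c * card A"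
    proof -
      have "8 / \<theta>\<^sup>2 * card A \<le> real c * card A"
        unfolding c_def by (intro mult_right_mono real_nat_ceiling_ge) simp
      then have "real ((card B)\<^sup>2) \<le> real (c * card A)" using A(2) by simp
      then show ?thesis by (simp only: of_nat_le_iff)
    qed
    have cost: "(c + \<kappa> + 1) * (2 * L ^ (8 * (4 * L * k)\<^sup>2) * L) ^ k \<le> card B" if "L > 0" "L \<le> M" for L
    proof -
      have "1 \<le> k ^ 3" using kpos by (simp add: Suc_le_eq)
      then have "(c + \<kappa> + 1) ^ 1 \<le> (c + \<kappa> + 1) ^ (k ^ 3)" by (intro power_increasing) auto
      then have "(c + \<kappa> + 1) * (2 * L ^ (8 * (4 * L * k)\<^sup>2) * L) ^ k
          \<le> (c + \<kappa> + 1) ^ (k ^ 3) * (2 * M ^ (128 * M\<^sup>2 + 1)) ^ (k ^ 3)"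
        using iterated_cost_le[OF that(1) kpos(2) that(2)] by (intro mult_mono) auto
      also have "\<dots> = D ^ (k ^ 3)" by (simp only: D_def power_mult_distrib mult_ac)
      finally show ?thesis using k(2) by (rule order_trans)
    qed
    have pow_pos: "(2 * L ^ (8 * (4 * L * k)\<^sup>2) * L) ^ k > 0" if "L > 0" for L :: nat using that by simp
    have bigA: "(2 * K ^ (8 * (4 * K * k)\<^sup>2) * K) ^ k < card A"
    proof -
      let ?q = "(2 * K ^ (8 * (4 * K * k)\<^sup>2) * K) ^ k"
      have "c * ?q < (c + \<kappa> + 1) * ?q" using pow_pos[OF K0] by (intro mult_strict_right_mono) auto
      also have "\<dots> \<le> card B" using cost[OF K0] by (simp add: M_def)
      also have "\<dots> \<le> (card B)\<^sup>2" using n0 by (simp add: power2_eq_square)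
      also have "\<dots> \<le> c * card A" by (rule dense)
      finally show ?thesis by simp
    qed
    have bigC: "\<kappa> * (2 * K' ^ (8 * (4 * K' * k)\<^sup>2) * K') ^ k < card B"
    proof -
      let ?q = "(2 * K' ^ (8 * (4 * K' * k)\<^sup>2) * K') ^ k"
      have "\<kappa> * ?q < (c + \<kappa> + 1) * ?q" using pow_pos[OF K'0] by (intro mult_strict_right_mono) auto
      also have "\<dots> \<le> card B" using cost[OF K'0] by (simp add: M_def)
      finally show ?thesis .
    qed
    define w where "w = k ^ 4"
    define W where "W = primes_between w (w ^ E)"
    have w2: "w \<ge> 2"
    proof -
      have "k \<le> w" unfolding w_def using kpos by (intro self_le_power) auto
      then show ?thesis using kpos by linarith
    qed
    have cardW: "3 * (card W)\<^sup>2 \<le> 2 ^ k"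
    proof -
      have "card W \<le> card {1..w ^ E}"
        by (rule card_mono) (auto simp: W_def primes_between_def)
      then have "card W \<le> w ^ E" by simp
      then have "(card W)\<^sup>2 \<le> (w ^ E)\<^sup>2" by (rule power_mono) simp
      also have "\<dots> = k ^ (8 * E)" by (simp add: w_def mult.commute flip: power_mult)
      finally have "3 * (card W)\<^sup>2 \<le> 3 * k ^ (8 * E)" by simp
      also have "\<dots> \<le> 2 ^ k" by (rule k1) (use k(1) in \<open>simp add: k0_def\<close>)
      finally show ?thesis .
    qed
    have massW: "3200 * real K ^ 2 + 3200 * real K' ^ 2 + 2 \<le> recip_sum W"
    proof -
      have "real J / 8 \<le> recip_sum W" unfolding W_def E_def by (rule recip_sum_long_window[OF w2])
      then show ?thesis by (simp add: J_def)
    qed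
    have bnd: "2 * \<bar>b\<bar>\<^sup>2 \<le> 2 ^ (c3 * k ^ 3)" if "b \<in> B" for b
    proof -
      have "\<bar>real_of_int b\<bar> < C1 * real (card B) powr C2" using bound that by simp
      then have "2 * \<bar>real_of_int b\<bar>\<^sup>2 \<le> 2 ^ (c3 * k ^ 3)" unfolding c3_def
        using square_bound_at_scale[OF assms a h _ kpos(2) n0 k(3)] D2 by simp
      then have "real_of_int (2 * \<bar>b\<bar>\<^sup>2) \<le> real_of_int (2 ^ (c3 * k ^ 3))" by simp
      then show ?thesis by (simp only: of_int_le_iff)
    qed
    have lw: "100 * (c3 * k ^ 3) \<le> w"
    proof -
      have "100 * c3 \<le> k" using k(1) by (simp add: k0_def)
      then have "(100 * c3) * k ^ 3 \<le> k * k ^ 3" by (rule mult_right_mono) simp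
      then show ?thesis by (simp add: w_def power_numeral_reduce mult_ac)
    qed
    have large: "32 * d\<^sup>2 \<le> card B"
    proof -
      have "32 * d\<^sup>2 \<le> k" using k(1) by (simp add: k0_def)
      then show ?thesis using kle k(2) by linarith
    qed
    show False
    proof (rule no_structured_dense_product_subset[of B A c K k W w "c3 * k ^ 3"])
    qed (use fin A(1,3) dense K0 kpos bigA bigC cardW massW bnd lw large w2 in
        \<open>simp_all add: W_def primes_between_def d_def \<kappa>_def K'_def\<close>)
  qed
qed

end
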